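(* Let $\mathbb{F}$ be a field, $G$ an abelian group, $H_1,H_2\subseteq G$ finite subgroups, and denote $H_{12}=H_1\cap H_2$. Let $\chi_1,\ldots,\chi_t\in\widehat{H_{12}}$, where $\chi_i\neq\chi_j$ for $i\neq j$, and let $g_1,\ldots,g_t\in G$. Then there exist a poset $X$ and a $G$-grading on the incidence algebra $I(X)$ over $\mathbb{F}$ such that $$I(X)\cong_G\begin{pmatrix}\mathbb{F}H_1&M\\ &\mathbb{F}H_2\end{pmatrix},$$ where $M\cong_G[(\chi_1,g_1),\ldots,(\chi_t,g_t)]$.
   Context: A $G$-grading on an algebra $\mathcal{A}$ is a vector space decomposition $\mathcal{A}=\bigoplus_{g\in G}\mathcal{A}_g$ with $\mathcal{A}_g\mathcal{A}_h\subseteq\mathcal{A}_{gh}$; $\cong_G$ denotes an isomorphism (of algebras, respectively of bimodules) preserving the homogeneous components. A $G$-graded $(\mathcal{A},\mathcal{B})$-bimodule is a bimodule $M=\bigoplus_{g\in G}M_g$ with $\mathcal{A}_hM_g\mathcal{B}_k\subseteq M_{hgk}$. The group algebra $\mathbb{F}H$ of a subgroup $H\subseteq G$ is $G$-graded with $h\in H$ homogeneous of degree $h$. If $\mathcal{A},\mathcal{B}$ are $G$-graded algebras and $M$ is a $G$-graded $(\mathcal{A},\mathcal{B})$-bimodule, the triangular algebra $\begin{pmatrix}\mathcal{A}&M\\&\mathcal{B}\end{pmatrix}$ has the usual matrix multiplication (using the bimodule actions) and the direct sum grading. The incidence algebra $I(X)$ of a finite poset $X$ over $\mathbb{F}$ has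 basis $\{e_{xy}: x\le y\}$ and multiplication $e_{xy}e_{wz}=\delta_{yw}e_{xz}$. $\widehat{H}$ is the group of characters $H\to\mathbb{F}^\times$. For $\chi\in\widehat{H_{12}}$ and $g\in G$, $[(\chi,g)]$ denotes the $G$-graded $(\mathbb{F}H_1,\mathbb{F}H_2)$-bimodule $\mathbb{F}(H_1\times H_2)\otimes_{\mathbb{F}H_{12}}\mathcal{V}$, where $\mathcal{V}=\mathbb{F}m$ is one-dimensional, $h\in H_{12}$ acts on $m$ by $\chi(h)$, $\mathbb{F}(H_1\times H_2)$ is a right $\mathbb{F}H_{12}$-module by $(h_1,h_2)\cdot h=(h_1h,h^{-1}h_2)$, the bimodule action is $h\cdot((h_1,h_2)\otimes v)\cdot k=(hh_1,h_2k)\otimes v$, and $\deg((h_1,h_2)\otimes m)=h_1gh_2$. (Equivalently, it is generated by $m=(1,1)\otimes m$, homogeneous of degree $g$, with $hm=\chi(h)mh$ for $h\in H_{12}$.) Finally $[(\chi_1,g_1),\ldots,(\chi_t,g_t)]$ denotes the direct sum $\bigoplus_i[(\chi_i,g_i)]$.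
   Formalization: The field F is additionally assumed to contain primitive roots of unity of orders exp(H1) and exp(H2); without this the claim fails (e.g. F = Q, H1 of order 3, H2 trivial), and the condition is necessary in every case. *)

theory Defs
  imports "HOL-Algebra.Algebra" "HOL-Algebra.Algebraic_Closure_Type"
begin

section \<open>Algebras and bimodules\<close>

text \<open>The base field is a type of class \<open>field\<close>; \<open>\<F>\<close> is its record form.\<close>

abbreviation base_field :: "'f::field ring" (\<open>\<F>\<close>)
  where "\<F> \<equiv> ring_of_type_algebra"

text \<open>The locale \<open>algebra\<close> of the library is commutative.\<close>

locale assoc_algebra = module R A + A?: ring A for R (structure) and A (structure) +
  assumes smult_mult_left:
    "\<lbrakk>c \<in> carrier R; x \<in> carrier A; y \<in> carrier A\<rbrakk> \<Longrightarrow>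
       (c \<odot>\<^bsub>A\<^esub> x) \<otimes>\<^bsub>A\<^esub> y = c \<odot>\<^bsub>A\<^esub> (x \<otimes>\<^bsub>A\<^esub> y)"
    and smult_mult_right:
    "\<lbrakk>c \<in> carrier R; x \<in> carrier A; y \<in> carrier A\<rbrakk> \<Longrightarrow>
       x \<otimes>\<^bsub>A\<^esub> (c \<odot>\<^bsub>A\<^esub> y) = c \<odot>\<^bsub>A\<^esub> (x \<otimes>\<^bsub>A\<^esub> y)"

text \<open>As for every \<open>module\<close> record, the fields \<open>mult\<close> and \<open>one\<close> of a bimodule carry no
  meaning.\<close>

record ('f, 'a, 'b, 'm) bimodule = "('f, 'm) module" +
  lact :: "'a \<Rightarrow> 'm \<Rightarrow> 'm"
  ract :: "'m \<Rightarrow> 'b \<Rightarrow> 'm"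

locale bimodule =
  A: assoc_algebra R A + B: assoc_algebra R B + M: module R M
  for R :: "'f ring" and A :: "('f, 'a) module" and B :: "('f, 'b) module"
    and M :: "('f, 'a, 'b, 'm) bimodule" +
  assumes lact_closed: "\<lbrakk>a \<in> carrier A; m \<in> carrier M\<rbrakk> \<Longrightarrow> lact M a m \<in> carrier M"
    and lact_add_left: "\<lbrakk>a \<in> carrier A; a' \<in> carrier A; m \<in> carrier M\<rbrakk> \<Longrightarrow>
      lact M (a \<oplus>\<^bsub>A\<^esub> a') m = lact M a m \<oplus>\<^bsub>M\<^esub> lact M a' m"
    and lact_add_right: "\<lbrakk>a \<in> carrier A; m \<in> carrier M; m' \<in> carrier M\<rbrakk> \<Longrightarrow>
      lact M a (m \<oplus>\<^bsub>M\<^esub> m') = lact M a m \<oplus>\<^bsub>M\<^esub> lact M a m'"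
    and lact_smult_left: "\<lbrakk>c \<in> carrier R; a \<in> carrier A; m \<in> carrier M\<rbrakk> \<Longrightarrow>
      lact M (c \<odot>\<^bsub>A\<^esub> a) m = c \<odot>\<^bsub>M\<^esub> lact M a m"
    and lact_smult_right: "\<lbrakk>c \<in> carrier R; a \<in> carrier A; m \<in> carrier M\<rbrakk> \<Longrightarrow>
      lact M a (c \<odot>\<^bsub>M\<^esub> m) = c \<odot>\<^bsub>M\<^esub> lact M a m"
    and lact_mult: "\<lbrakk>a \<in> carrier A; a' \<in> carrier A; m \<in> carrier M\<rbrakk> \<Longrightarrow>
      lact M (a \<otimes>\<^bsub>A\<^esub> a') m = lact M a (lact M a' m)"
    and lact_one: "m \<in> carrier M \<Longrightarrow> lact M \<one>\<^bsub>A\<^esub> m = m"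
    and ract_closed: "\<lbrakk>m \<in> carrier M; b \<in> carrier B\<rbrakk> \<Longrightarrow> ract M m b \<in> carrier M"
    and ract_add_left: "\<lbrakk>m \<in> carrier M; m' \<in> carrier M; b \<in> carrier B\<rbrakk> \<Longrightarrow>
      ract M (m \<oplus>\<^bsub>M\<^esub> m') b = ract M m b \<oplus>\<^bsub>M\<^esub> ract M m' b"
    and ract_add_right: "\<lbrakk>m \<in> carrier M; b \<in> carrier B; b' \<in> carrier B\<rbrakk> \<Longrightarrow>
      ract M m (b \<oplus>\<^bsub>B\<^esub> b') = ract M m b \<oplus>\<^bsub>M\<^esub> ract M m b'"
    and ract_smult_left: "\<lbrakk>c \<in> carrier R; m \<in> carrier M; b \<in> carrier B\<rbrakk> \<Longrightarrow>
      ract M (c \<odot>\<^bsub>M\<^esub> m) b = c \<odot>\<^bsub>M\<^esub> ract M m b"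
    and ract_smult_right: "\<lbrakk>c \<in> carrier R; m \<in> carrier M; b \<in> carrier B\<rbrakk> \<Longrightarrow>
      ract M m (c \<odot>\<^bsub>B\<^esub> b) = c \<odot>\<^bsub>M\<^esub> ract M m b"
    and ract_mult: "\<lbrakk>m \<in> carrier M; b \<in> carrier B; b' \<in> carrier B\<rbrakk> \<Longrightarrow>
      ract M m (b \<otimes>\<^bsub>B\<^esub> b') = ract M (ract M m b) b'"
    and ract_one: "m \<in> carrier M \<Longrightarrow> ract M m \<one>\<^bsub>B\<^esub> = m"
    and lact_ract: "\<lbrakk>a \<in> carrier A; m \<in> carrier M; b \<in> carrier B\<rbrakk> \<Longrightarrow>
      ract M (lact M a m) b = lact M a (ract M m b)"


section \<open>Gradings\<close>

text \<open>\<open>V\<close> is the internal direct sum of the submodules \<open>\<Gamma> g\<close>.\<close>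

definition direct_decomposition ::
    "'f ring \<Rightarrow> 'g monoid \<Rightarrow> ('f, 'v, 'z) module_scheme \<Rightarrow> ('g \<Rightarrow> 'v set) \<Rightarrow> bool"
  where "direct_decomposition R G V \<Gamma> \<longleftrightarrow>
    (\<forall>g\<in>carrier G. submodule (\<Gamma> g) R V) \<and>
    (\<forall>v\<in>carrier V. \<exists>!f. f \<in> (\<Pi>\<^sub>E g\<in>carrier G. \<Gamma> g) \<and>
       finite {g \<in> carrier G. f g \<noteq> \<zero>\<^bsub>V\<^esub>} \<and>
       v = (\<Oplus>\<^bsub>V\<^esub> g\<in>{g \<in> carrier G. f g \<noteq> \<zero>\<^bsub>V\<^esub>}. f g))"

definition graded_algebra ::
    "'f ring \<Rightarrow> 'g monoid \<Rightarrow> ('f, 'a) module \<Rightarrow> ('g \<Rightarrow> 'a set) \<Rightarrow> bool"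
  where "graded_algebra R G A \<Gamma> \<longleftrightarrow>
    assoc_algebra R A \<and> direct_decomposition R G A \<Gamma> \<and>
    (\<forall>g\<in>carrier G. \<forall>h\<in>carrier G. \<forall>x\<in>\<Gamma> g. \<forall>y\<in>\<Gamma> h. x \<otimes>\<^bsub>A\<^esub> y \<in> \<Gamma> (g \<otimes>\<^bsub>G\<^esub> h))"

definition graded_bimodule ::
    "'f ring \<Rightarrow> 'g monoid \<Rightarrow> ('f, 'a) module \<Rightarrow> ('g \<Rightarrow> 'a set) \<Rightarrow>
     ('f, 'b) module \<Rightarrow> ('g \<Rightarrow> 'b set) \<Rightarrow>
     ('f, 'a, 'b, 'm) bimodule \<Rightarrow> ('g \<Rightarrow> 'm set) \<Rightarrow> bool"
  where "graded_bimodule R G A \<Gamma>A B \<Gamma>B M \<Gamma>M \<longleftrightarrow>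
    graded_algebra R G A \<Gamma>A \<and> graded_algebra R G B \<Gamma>B \<and>
    bimodule R A B M \<and> direct_decomposition R G M \<Gamma>M \<and>
    (\<forall>h\<in>carrier G. \<forall>g\<in>carrier G. \<forall>k\<in>carrier G.
       \<forall>a\<in>\<Gamma>A h. \<forall>m\<in>\<Gamma>M g. \<forall>b\<in>\<Gamma>B k.
         ract M (lact M a m) b \<in> \<Gamma>M (h \<otimes>\<^bsub>G\<^esub> g \<otimes>\<^bsub>G\<^esub> k))"

definition graded_algebra_iso ::
    "'f ring \<Rightarrow> 'g monoid \<Rightarrow> ('f, 'a) module \<Rightarrow> ('g \<Rightarrow> 'a set) \<Rightarrow>
     ('f, 'b) module \<Rightarrow> ('g \<Rightarrow> 'b set) \<Rightarrow> bool"
  where "graded_algebra_iso R G A \<Gamma>A B \<Gamma>B \<longleftrightarrow>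
    (\<exists>\<phi>\<in>ring_iso A B.
       (\<forall>c\<in>carrier R. \<forall>x\<in>carrier A. \<phi> (c \<odot>\<^bsub>A\<^esub> x) = c \<odot>\<^bsub>B\<^esub> \<phi> x) \<and>
       (\<forall>g\<in>carrier G. \<phi> ` \<Gamma>A g = \<Gamma>B g))"

definition graded_bimodule_iso ::
    "'f ring \<Rightarrow> 'g monoid \<Rightarrow> ('f, 'a) module \<Rightarrow> ('f, 'b) module \<Rightarrow>
     ('f, 'a, 'b, 'm) bimodule \<Rightarrow> ('g \<Rightarrow> 'm set) \<Rightarrow>
     ('f, 'a, 'b, 'n) bimodule \<Rightarrow> ('g \<Rightarrow> 'n set) \<Rightarrow> bool"
  where "graded_bimodule_iso R G A B M \<Gamma>M N \<Gamma>N \<longleftrightarrow>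
    (\<exists>\<phi>. bij_betw \<phi> (carrier M) (carrier N) \<and>
       (\<forall>x\<in>carrier M. \<forall>y\<in>carrier M. \<phi> (x \<oplus>\<^bsub>M\<^esub> y) = \<phi> x \<oplus>\<^bsub>N\<^esub> \<phi> y) \<and>
       (\<forall>c\<in>carrier R. \<forall>x\<in>carrier M. \<phi> (c \<odot>\<^bsub>M\<^esub> x) = c \<odot>\<^bsub>N\<^esub> \<phi> x) \<and>
       (\<forall>a\<in>carrier A. \<forall>x\<in>carrier M. \<phi> (lact M a x) = lact N a (\<phi> x)) \<and>
       (\<forall>b\<in>carrier B. \<forall>x\<in>carrier M. \<phi> (ract M x b) = ract N (\<phi> x) b) \<and>
       (\<forall>g\<in>carrier G. \<phi> ` \<Gamma>M g = \<Gamma>N g))"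


section \<open>Incidence, group and triangular algebras\<close>

text \<open>The element \<open>a\<close> stands for the sum of all \<open>a x y \<cdot> e\<^sub>x\<^sub>y\<close> with \<open>(x, y) \<in> r\<close>,
  where \<open>r\<close> is the order relation of the finite poset \<open>P\<close>.\<close>

definition incidence_algebra :: "'x set \<Rightarrow> 'x rel \<Rightarrow> ('f::field, 'x \<Rightarrow> 'x \<Rightarrow> 'f) module"
  where "incidence_algebra P r =
    \<lparr>carrier = {a. \<forall>x y. (x, y) \<notin> r \<longrightarrow> a x y = 0},
     monoid.mult = (\<lambda>a b x z. \<Sum>y\<in>P. a x y * b y z),
     monoid.one = (\<lambda>x y. if x \<in> P \<and> x = y then 1 else 0),
     ring.zero = (\<lambda>x y. 0),
     ring.add = (\<lambda>a b x y. a x y + b x y),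
     module.smult = (\<lambda>c a x y. c * a x y)\<rparr>"

text \<open>For a finite subgroup \<open>H\<close>, elements of the group algebra are the functions supported
  on \<open>H\<close>.\<close>

definition group_algebra :: "'g monoid \<Rightarrow> 'g set \<Rightarrow> ('f::field, 'g \<Rightarrow> 'f) module"
  where "group_algebra G H =
    \<lparr>carrier = {a. \<forall>h. h \<notin> H \<longrightarrow> a h = 0},
     monoid.mult = (\<lambda>a b g. \<Sum>(h, k) \<in> {(h, k) \<in> H \<times> H. h \<otimes>\<^bsub>G\<^esub> k = g}. a h * b k),
     monoid.one = (\<lambda>h. if h = \<one>\<^bsub>G\<^esub> then 1 else 0),
     ring.zero = (\<lambda>h. 0),
     ring.add = (\<lambda>a b h. a h + b h),
     module.smult = (\<lambda>c a h. c * a h)\<rparr>"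

definition group_algebra_grading :: "'g set \<Rightarrow> 'g \<Rightarrow> ('g \<Rightarrow> 'f::field) set"
  where "group_algebra_grading H g = {a. \<forall>h. \<not> (h \<in> H \<and> h = g) \<longrightarrow> a h = 0}"

text \<open>The triple \<open>(a, m, b)\<close> is the matrix with diagonal \<open>a, b\<close> and upper right entry
  \<open>m\<close>.\<close>

definition triangular_algebra ::
    "('f, 'a) module \<Rightarrow> ('f, 'b) module \<Rightarrow> ('f, 'a, 'b, 'm) bimodule \<Rightarrow>
     ('f, 'a \<times> 'm \<times> 'b) module"
  where "triangular_algebra A B M =
    \<lparr>carrier = carrier A \<times> carrier M \<times> carrier B,
     monoid.mult = (\<lambda>(a, m, b) (a', m', b').
       (a \<otimes>\<^bsub>A\<^esub> a', lact M a m' \<oplus>\<^bsub>M\<^esub> ract M m b', b \<otimes>\<^bsub>B\<^esub> b')),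
     monoid.one = (\<one>\<^bsub>A\<^esub>, \<zero>\<^bsub>M\<^esub>, \<one>\<^bsub>B\<^esub>),
     ring.zero = (\<zero>\<^bsub>A\<^esub>, \<zero>\<^bsub>M\<^esub>, \<zero>\<^bsub>B\<^esub>),
     ring.add = (\<lambda>(a, m, b) (a', m', b'). (a \<oplus>\<^bsub>A\<^esub> a', m \<oplus>\<^bsub>M\<^esub> m', b \<oplus>\<^bsub>B\<^esub> b')),
     module.smult = (\<lambda>c (a, m, b). (c \<odot>\<^bsub>A\<^esub> a, c \<odot>\<^bsub>M\<^esub> m, c \<odot>\<^bsub>B\<^esub> b))\<rparr>"

definition triangular_grading ::
    "('g \<Rightarrow> 'a set) \<Rightarrow> ('g \<Rightarrow> 'b set) \<Rightarrow> ('g \<Rightarrow> 'm set) \<Rightarrow> 'g \<Rightarrow> ('a \<times> 'm \<times> 'b) set"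
  where "triangular_grading \<Gamma>A \<Gamma>B \<Gamma>M g = \<Gamma>A g \<times> \<Gamma>M g \<times> \<Gamma>B g"


section \<open>Characters and the bimodules they define\<close>

text \<open>Extensionality makes characters equal as functions iff they agree on \<open>H\<close>.\<close>

definition characters :: "'g monoid \<Rightarrow> 'g set \<Rightarrow> ('g \<Rightarrow> 'f::field) set"
  where "characters G H = hom (G\<lparr>carrier := H\<rparr>) (mult_of \<F>) \<inter> extensional H"

text \<open>The bimodule \<open>\<F>(H1 \<times> H2) \<otimes>\<^bsub>\<F>\<^esub> \<V>\<close> for the one-dimensional space \<open>\<V> = \<F>m\<close>,
  before balancing over the subgroup \<open>H1 \<inter> H2\<close>: since the elements of \<open>H1 \<times> H2\<close> form a basis
  of the left factor, its elements are the functions from \<open>H1 \<times> H2\<close> to \<open>\<V>\<close>, and \<open>\<V>\<close> is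
  identified with the field along \<open>m \<mapsto> 1\<close>.\<close>

definition pre_tensor ::
    "'g monoid \<Rightarrow> 'g set \<Rightarrow> 'g set \<Rightarrow>
     ('f::field, 'g \<Rightarrow> 'f, 'g \<Rightarrow> 'f, 'g \<times> 'g \<Rightarrow> 'f) bimodule"
  where "pre_tensor G H1 H2 =
    \<lparr>carrier = {u. \<forall>p. p \<notin> H1 \<times> H2 \<longrightarrow> u p = 0},
     monoid.mult = undefined,
     monoid.one = undefined,
     ring.zero = (\<lambda>p. 0),
     ring.add = (\<lambda>u v p. u p + v p),
     module.smult = (\<lambda>c u p. c * u p),
     lact = (\<lambda>a u (x, h2). \<Sum>(h, h1) \<in> {(h, h1) \<in> H1 \<times> H1. h \<otimes>\<^bsub>G\<^esub> h1 = x}. a h * u (h1, h2)),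
     ract = (\<lambda>u b (h1, x). \<Sum>(h2, k) \<in> {(h2, k) \<in> H2 \<times> H2. h2 \<otimes>\<^bsub>G\<^esub> k = x}. u (h1, h2) * b k)\<rparr>"

text \<open>\<open>pure_tensor p v\<close> is \<open>p \<otimes> v\<close> for \<open>p\<close> in \<open>H1 \<times> H2\<close>.\<close>

definition pure_tensor :: "'g \<times> 'g \<Rightarrow> 'f::field \<Rightarrow> 'g \<times> 'g \<Rightarrow> 'f"
  where "pure_tensor p v = (\<lambda>q. if q = p then v else 0)"

text \<open>The balancing relations \<open>p \<cdot> h \<otimes> v - p \<otimes> h v\<close> of the tensor product over the group
  algebra of \<open>H1 \<inter> H2\<close>.\<close>

definition balancing_relations ::
    "'g monoid \<Rightarrow> 'g set \<Rightarrow> 'g set \<Rightarrow> ('g \<Rightarrow> 'f::field) \<Rightarrow> ('g \<times> 'g \<Rightarrow> 'f) set"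
  where "balancing_relations G H1 H2 \<chi> =
    {pure_tensor (h1 \<otimes>\<^bsub>G\<^esub> h, inv\<^bsub>G\<^esub> h \<otimes>\<^bsub>G\<^esub> h2) v \<ominus>\<^bsub>pre_tensor G H1 H2\<^esub> pure_tensor (h1, h2) (\<chi> h * v)
      | h1 h2 h v. h1 \<in> H1 \<and> h2 \<in> H2 \<and> h \<in> H1 \<inter> H2}"

definition submodule_span ::
    "'f ring \<Rightarrow> ('f, 'v, 'z) module_scheme \<Rightarrow> 'v set \<Rightarrow> 'v set"
  where "submodule_span R V S = \<Inter> {W. submodule W R V \<and> S \<subseteq> W}"

text \<open>In the quotient by \<open>W\<close>, the coset \<open>W\<close> is added back because the pointwise image of a
  coset under a linear map need not be a full coset.\<close>

definition quotient_bimodule ::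
    "('f, 'a, 'b, 'm) bimodule \<Rightarrow> 'm set \<Rightarrow> ('f, 'a, 'b, 'm set) bimodule"
  where "quotient_bimodule M W =
    \<lparr>carrier = a_rcosets\<^bsub>M\<^esub> W,
     monoid.mult = undefined,
     monoid.one = undefined,
     ring.zero = W,
     ring.add = (<+>\<^bsub>M\<^esub>),
     module.smult = (\<lambda>c C. W <+>\<^bsub>M\<^esub> ((\<lambda>x. c \<odot>\<^bsub>M\<^esub> x) ` C)),
     lact = (\<lambda>a C. W <+>\<^bsub>M\<^esub> (lact M a ` C)),
     ract = (\<lambda>C b. W <+>\<^bsub>M\<^esub> ((\<lambda>x. ract M x b) ` C))\<rparr>"

text \<open>The bimodule \<open>[(\<chi>, g)]\<close>, where \<open>deg ((h1, h2) \<otimes> m) = h1 g h2\<close>.\<close>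

definition char_bimodule ::
    "'g monoid \<Rightarrow> 'g set \<Rightarrow> 'g set \<Rightarrow> ('g \<Rightarrow> 'f::field) \<Rightarrow>
     ('f, 'g \<Rightarrow> 'f, 'g \<Rightarrow> 'f, ('g \<times> 'g \<Rightarrow> 'f) set) bimodule"
  where "char_bimodule G H1 H2 \<chi> =
    quotient_bimodule (pre_tensor G H1 H2)
      (submodule_span \<F> (pre_tensor G H1 H2) (balancing_relations G H1 H2 \<chi>))"

definition char_bimodule_grading ::
    "'g monoid \<Rightarrow> 'g set \<Rightarrow> 'g set \<Rightarrow> ('g \<Rightarrow> 'f::field) \<Rightarrow> 'g \<Rightarrow> 'g \<Rightarrow> ('g \<times> 'g \<Rightarrow> 'f) set set"
  where "char_bimodule_grading G H1 H2 \<chi> g d =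
    {submodule_span \<F> (pre_tensor G H1 H2) (balancing_relations G H1 H2 \<chi>) +>\<^bsub>pre_tensor G H1 H2\<^esub> u
      | u. u \<in> carrier (pre_tensor G H1 H2) \<and>
           (\<forall>h1 h2. u (h1, h2) \<noteq> 0 \<longrightarrow> h1 \<otimes>\<^bsub>G\<^esub> g \<otimes>\<^bsub>G\<^esub> h2 = d)}"

definition direct_sum_bimodule ::
    "'i set \<Rightarrow> ('i \<Rightarrow> ('f, 'a, 'b, 'm) bimodule) \<Rightarrow> ('f, 'a, 'b, 'i \<Rightarrow> 'm) bimodule"
  where "direct_sum_bimodule I M =
    \<lparr>carrier = (\<Pi>\<^sub>E i\<in>I. carrier (M i)),
     monoid.mult = undefined,
     monoid.one = undefined,
     ring.zero = (\<lambda>i\<in>I. \<zero>\<^bsub>M i\<^esub>),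
     ring.add = (\<lambda>x y. \<lambda>i\<in>I. x i \<oplus>\<^bsub>M i\<^esub> y i),
     module.smult = (\<lambda>c x. \<lambda>i\<in>I. c \<odot>\<^bsub>M i\<^esub> x i),
     lact = (\<lambda>a x. \<lambda>i\<in>I. lact (M i) a (x i)),
     ract = (\<lambda>x b. \<lambda>i\<in>I. ract (M i) (x i) b)\<rparr>"

definition direct_sum_grading :: "'i set \<Rightarrow> ('i \<Rightarrow> 'g \<Rightarrow> 'm set) \<Rightarrow> 'g \<Rightarrow> ('i \<Rightarrow> 'm) set"
  where "direct_sum_grading I \<Gamma> g = (\<Pi>\<^sub>E i\<in>I. \<Gamma> i g)"


section \<open>Roots of unity\<close>

text \<open>For a finite abelian group \<open>H\<close> of exponent \<open>n\<close>, the group algebra of \<open>H\<close> is a product of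
  copies of the field iff the field contains a primitive root of unity of order \<open>n\<close>. An
  incidence algebra has the group algebra of \<open>H\<close> as a diagonal block only in that case.\<close>

definition primitive_root_of_unity :: "nat \<Rightarrow> 'f::field \<Rightarrow> bool"
  where "primitive_root_of_unity n z \<longleftrightarrow>
    0 < n \<and> z ^ n = 1 \<and> (\<forall>k. 0 < k \<and> k < n \<longrightarrow> z ^ k \<noteq> 1)"

definition subgroup_exponent :: "'g monoid \<Rightarrow> 'g set \<Rightarrow> nat"
  where "subgroup_exponent G H = Lcm (group.ord G ` H)"

end

theory Submission
  imports Defs
begin

text \<open>Since the field contains a primitive root of unity of order the exponent of \<open>H\<close>, the translations
  by elements of a finite abelian group \<open>H\<close> are simultaneously diagonalizable, so the Fourier transform
  identifies \<open>\<F>H\<close> with the algebra of functions on the set of characters of \<open>H\<close>. The same transform on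
  \<open>H1 \<times> H2\<close> makes the actions on \<open>\<F>(H1 \<times> H2)\<close> pointwise and turns the balancing relations for \<open>\<chi>\<close>
  into the vanishing of all coefficients at pairs \<open>(\<alpha>, \<beta>)\<close> with \<open>\<alpha> = \<chi> \<beta>\<close> on \<open>H1 \<inter> H2\<close>. Hence
  \<open>[(\<chi>, g)]\<close> has one basis vector for each such pair, and for distinct \<open>\<chi>\<^sub>i\<close> these sets of pairs are
  disjoint. So the triangular algebra is the incidence algebra of the set of characters of \<open>H1\<close> and of
  \<open>H2\<close>, where \<open>\<alpha> < \<beta>\<close> iff \<open>\<alpha> = \<chi>\<^sub>i \<beta>\<close> on \<open>H1 \<inter> H2\<close> for some \<open>i\<close>; the grading is transported along this
  isomorphism.\<close>

section \<open>Fourier transform on a finite subgroup\<close>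

text \<open>An incidence algebra has at most one dimension between two points. Distinctness of the
  characters \<chi> i is what makes the middle block fit: a pair (\<alpha>, \<beta>) determines the
  quotient \<alpha> / \<beta> on the intersection and hence at most one index i. The hypothesis on
  roots of unity controls only the exponent of a subgroup. Two facts are extracted from it: the
  order is invertible in the field, and the characters separate the elements of the group algebra.
  The second is proved without counting characters or decomposing the group into cyclic factors, by
  producing a common eigenvector of all translations. Injectivity of the transform also replaces
  most computations with convolutions, since algebra and bimodule laws can be checked on
  coefficients. The definition of a grading asks for unique decompositions, which are awkward to
  push through quotients, sums and isomorphisms. They are carried by families of homogeneous
  projections with a common finite set of degrees instead.\<close>

lemma primitive_root_inverse_power_neq_1:
  fixes \<zeta> :: "'f::field"
  assumes "primitive_root_of_unity n \<zeta>" "0 < k" "k < n"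
  shows "inverse \<zeta> ^ k \<noteq> 1"
  using assms by (simp add: primitive_root_of_unity_def power_inverse)

text \<open>If n = p * k in characteristic p, then (\<zeta> ^ k - 1) ^ p = \<zeta> ^ n - 1 = 0 by
  Frobenius, so \<zeta> ^ k = 1 for a positive k below n, against primitivity.\<close>

lemma of_nat_neq_0_primitive_root:
  fixes \<zeta> :: "'f::field"
  assumes "primitive_root_of_unity n \<zeta>"
  shows "of_nat n \<noteq> (0::'f)"
proof
  assume "of_nat n = (0::'f)"
  then have dvd: "CHAR('f) dvd n"
    by (simp add: of_nat_eq_0_iff_char_dvd)
  have n: "0 < n" "\<zeta> ^ n = 1"
    using assms by (auto simp: primitive_root_of_unity_def)
  then have "CHAR('f) > 0"
    using dvd by (auto intro: Nat.gr0I)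
  then have p: "Factorial_Ring.prime CHAR('f)"
    by (rule prime_CHAR_semidom)
  obtain k where k: "n = CHAR('f) * k"
    using dvd by blast
  \<comment> \<open>Frobenius is applied to a sum with 1, so no sign has to be tracked; the left
    side is \<zeta> ^ n = 1.\<close>
  have "(\<zeta> ^ k - 1 + 1) ^ CHAR('f) = (\<zeta> ^ k - 1) ^ CHAR('f) + 1 ^ CHAR('f)"
    by (rule freshmans_dream) (use p in auto)
  then have "(\<zeta> ^ k - 1) ^ CHAR('f) = 0"
    using n k by (simp add: power_mult[symmetric] mult.commute)
  then have "\<zeta> ^ k = 1"
    using p by simp
  moreover have "0 < k" "k < n"
    using k n prime_gt_1_nat[OF p] by auto
  ultimately show False
    using assms by (auto simp: primitive_root_of_unity_def)
qed

lemma base_field_simps [simp]: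
  "carrier \<F> = (UNIV :: 'f::field set)"
  "x \<otimes>\<^bsub>\<F>\<^esub> y = (x * y :: 'f)" "x \<oplus>\<^bsub>\<F>\<^esub> y = (x + y :: 'f)"
  "\<one>\<^bsub>\<F>\<^esub> = (1 :: 'f)" "\<zero>\<^bsub>\<F>\<^esub> = (0 :: 'f)"
  by (simp_all add: ring_of_type_algebra_def)

text \<open>At a character \<alpha> this is the value at \<open>a\<close> of the algebra
  homomorphism from the group algebra to the field that extends \<alpha> linearly.\<close>

definition fourier :: "'g set \<Rightarrow> ('g \<Rightarrow> 'f::field) \<Rightarrow> ('g \<Rightarrow> 'f) \<Rightarrow> 'f"
  where "fourier H a \<alpha> = (\<Sum>h\<in>H. a h * \<alpha> h)"

text \<open>The characters enter inverted because \<open>fourier\<close> pairs without inversion.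
  The value 0 off \<open>H\<close> puts the result into the carrier of the group algebra.\<close>

definition inverse_fourier :: "'g monoid \<Rightarrow> 'g set \<Rightarrow> (('g \<Rightarrow> 'f::field) \<Rightarrow> 'f) \<Rightarrow> 'g \<Rightarrow> 'f"
  where "inverse_fourier G H f h =
    (if h \<in> H then (\<Sum>\<alpha>\<in>characters G H. f \<alpha> * inverse (\<alpha> h)) / of_nat (card H) else 0)"

lemma fourier_add: "fourier H (\<lambda>h. a h + b h) \<alpha> = fourier H a \<alpha> + fourier H b \<alpha>"
  by (simp add: fourier_def sum.distrib algebra_simps)

lemma fourier_smult: "fourier H (\<lambda>h. c * a h) \<alpha> = c * fourier H a \<alpha>"
  by (simp add: fourier_def sum_distrib_left algebra_simps)

lemma fourier_sum: "fourier H (\<lambda>h. \<Sum>i\<in>I. a i h) \<alpha> = (\<Sum>i\<in>I. fourier H (a i) \<alpha>)"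
  by (simp add: fourier_def sum_distrib_right sum.swap[of _ I])

lemma characters_mult:
  assumes "\<alpha> \<in> characters G H" "x \<in> H" "y \<in> H"
  shows "\<alpha> (x \<otimes>\<^bsub>G\<^esub> y) = \<alpha> x * \<alpha> y"
  using assms by (auto simp: characters_def hom_def)

lemma characters_neq_0:
  assumes "\<alpha> \<in> characters G H" "x \<in> H"
  shows "\<alpha> x \<noteq> 0"
  using assms by (auto simp: characters_def hom_def)

lemma characters_eqI:
  assumes "\<alpha> \<in> characters G H" "\<beta> \<in> characters G H" "\<And>x. x \<in> H \<Longrightarrow> \<alpha> x = \<beta> x"
  shows "\<alpha> = \<beta>"
  using assms by (auto simp: characters_def intro: extensionalityI)

lemma charactersI:
  assumes "\<And>x. x \<in> H \<Longrightarrow> \<alpha> x \<noteq> 0" "\<And>x y. x \<in> H \<Longrightarrow> y \<in> H \<Longrightarrow> \<alpha> (x \<otimes>\<^bsub>G\<^esub> y) = \<alpha> x * \<alpha> y"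
    "\<alpha> \<in> extensional H"
  shows "\<alpha> \<in> characters G H"
  using assms by (auto simp: characters_def hom_def)

locale finite_subgroup = comm_group G for G :: "'a monoid" (structure) +
  fixes H :: "'a set"
  assumes subgroup_H: "subgroup H G" and finite_H: "finite H"
begin

lemma H_closed [simp]:
  "x \<in> H \<Longrightarrow> y \<in> H \<Longrightarrow> x \<otimes> y \<in> H" "\<one> \<in> H" "x \<in> H \<Longrightarrow> inv x \<in> H" "x \<in> H \<Longrightarrow> x \<in> carrier G"
  using subgroup_H by (auto intro: subgroup.m_closed subgroup.one_closed subgroup.m_inv_closed
      dest: subgroup.mem_carrier)

lemma H_pow_closed [simp]: "x \<in> H \<Longrightarrow> x [^] (k::nat) \<in> H"
  by (induction k) auto

lemma sum_translate: "h \<in> H \<Longrightarrow> (\<Sum>x\<in>H. f (h \<otimes> x)) = (\<Sum>x\<in>H. f x)"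
  by (rule sum.reindex_bij_witness[of _ "\<lambda>x. inv h \<otimes> x" "\<lambda>x. h \<otimes> x"])
    (auto simp: m_assoc[symmetric])

text \<open>The fibres of the multiplication over the elements of \<open>H\<close> partition
  \<open>H \<times> H\<close>.\<close>

lemma sum_convolution:
  "(\<Sum>x\<in>H. \<Sum>(h, k) \<in> {(h, k) \<in> H \<times> H. h \<otimes> k = x}. F h k) = (\<Sum>h\<in>H. \<Sum>k\<in>H. F h k)"
proof -
  have "(\<Sum>x\<in>H. \<Sum>(h, k) \<in> {(h, k) \<in> H \<times> H. h \<otimes> k = x}. F h k)
      = (\<Sum>x\<in>H. \<Sum>p | p \<in> H \<times> H \<and> fst p \<otimes> snd p = x. F (fst p) (snd p))"
    by (intro sum.cong) auto
  also have "\<dots> = (\<Sum>p\<in>H \<times> H. F (fst p) (snd p))"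
    by (rule sum.group) (auto simp: finite_H)
  also have "\<dots> = (\<Sum>h\<in>H. \<Sum>k\<in>H. F h k)"
    by (simp add: sum.cartesian_product case_prod_beta)
  finally show ?thesis .
qed

lemma characters_one: "\<alpha> \<in> characters G H \<Longrightarrow> \<alpha> \<one> = 1"
  using characters_mult[of \<alpha> G H \<one> \<one>] characters_neq_0[of \<alpha> G H \<one>] by simp

lemma characters_inv: "\<alpha> \<in> characters G H \<Longrightarrow> x \<in> H \<Longrightarrow> \<alpha> (inv x) = inverse (\<alpha> x)"
  using characters_mult[of \<alpha> G H "inv x" x] characters_one[of \<alpha>]
  by (simp add: inverse_eq_divide characters_neq_0 eq_divide_eq)

lemma characters_pow: "\<alpha> \<in> characters G H \<Longrightarrow> x \<in> H \<Longrightarrow> \<alpha> (x [^] (k::nat)) = \<alpha> x ^ k"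
  by (induction k) (auto simp: characters_mult characters_one)

text \<open>After regrouping into a sum over all pairs, multiplicativity of \<alpha> factors the
  double sum. Stated for bare functions, so that it serves the product of the group algebra as well
  as both actions on the bimodule.\<close>

lemma fourier_convolution:
  assumes "\<alpha> \<in> characters G H"
  shows "fourier H (\<lambda>x. \<Sum>(h, k) \<in> {(h, k) \<in> H \<times> H. h \<otimes> k = x}. a h * b k) \<alpha>
    = fourier H a \<alpha> * fourier H b \<alpha>"
proof -
  have "fourier H (\<lambda>x. \<Sum>(h, k) \<in> {(h, k) \<in> H \<times> H. h \<otimes> k = x}. a h * b k) \<alpha>
    = (\<Sum>x\<in>H. \<Sum>(h, k) \<in> {(h, k) \<in> H \<times> H. h \<otimes> k = x}. a h * b k * \<alpha> (h \<otimes> k))"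
    by (auto simp: fourier_def sum_distrib_right intro!: sum.cong)
  also have "\<dots> = (\<Sum>h\<in>H. \<Sum>k\<in>H. a h * b k * \<alpha> (h \<otimes> k))"
    by (rule sum_convolution)
  also have "\<dots> = (\<Sum>h\<in>H. a h * \<alpha> h) * (\<Sum>k\<in>H. b k * \<alpha> k)"
    by (auto simp: sum_product characters_mult[OF assms] intro!: sum.cong)
  finally show ?thesis
    by (simp add: fourier_def)
qed

end

section \<open>Consequences of a primitive root of unity whose order is the exponent of the
  subgroup\<close>

locale split_subgroup = finite_subgroup +
  fixes \<zeta> :: "'f::field"
  assumes primitive_root: "primitive_root_of_unity (subgroup_exponent G H) \<zeta>"
begin

abbreviation N :: nat where "N \<equiv> subgroup_exponent G H"

lemma N_pos: "0 < N" and \<zeta>_pow_N: "\<zeta> ^ N = 1" and \<zeta>_neq_0: "\<zeta> \<noteq> 0"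
  using primitive_root by (auto simp: primitive_root_of_unity_def power_0_left split: if_splits)

lemma ord_dvd_N: "x \<in> H \<Longrightarrow> ord x dvd N"
  by (auto simp: subgroup_exponent_def intro: dvd_Lcm)

lemma H_pow_N: "x \<in> H \<Longrightarrow> x [^] N = \<one>"
  by (simp add: pow_eq_id ord_dvd_N)

text \<open>If the characteristic divided the order of \<open>H\<close>, some element would have the
  characteristic as its order. It would then divide the exponent \<open>N\<close>, which the
  primitive root excludes.\<close>

lemma of_nat_card_neq_0: "of_nat (card H) \<noteq> (0::'f)"
proof
  assume "of_nat (card H) = (0::'f)"
  then have dvd: "CHAR('f) dvd card H"
    by (simp add: of_nat_eq_0_iff_char_dvd)
  have "card H > 0"
    using finite_H H_closed(2) card_gt_0_iff by blast
  then have "CHAR('f) > 0"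
    using dvd by (auto intro: Nat.gr0I)
  then have p: "Factorial_Ring.prime CHAR('f)"
    by (rule prime_CHAR_semidom)
  interpret HG: group "G\<lparr>carrier := H\<rparr>"
    using subgroup_H by (rule subgroup.subgroup_is_group) (rule is_group)
  obtain k where k: "card H = CHAR('f) * k"
    using dvd by blast
  \<comment> \<open>Cauchy's theorem as the case of exponent 1 of Sylow's; the cofactor
    \<open>k\<close> may still be divisible by the characteristic.\<close>
  have "\<exists>K. subgroup K (G\<lparr>carrier := H\<rparr>) \<and> card K = CHAR('f) ^ 1"
    by (rule sylow_thm[of _ _ _ k]) (use p k finite_H HG.is_group in \<open>auto simp: Coset.order_def\<close>)
  then obtain K where K: "subgroup K (G\<lparr>carrier := H\<rparr>)" "card K = CHAR('f)"
    by auto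
  have KG: "subgroup K G"
    using K(1) subgroup_H by (rule incl_subgroup[rotated])
  have "K \<noteq> {\<one>}"
    using K(2) prime_gt_1_nat[OF p] by auto
  then obtain x where x: "x \<in> K" "x \<noteq> \<one>"
    using subgroup.one_closed[OF KG] by blast
  have xH: "x \<in> H"
    using x(1) K(1) subgroup.subset by fastforce
  interpret KG: group "G\<lparr>carrier := K\<rparr>"
    using KG by (rule subgroup.subgroup_is_group) (rule is_group)
  have "x [^]\<^bsub>G\<lparr>carrier := K\<rparr>\<^esub> Coset.order (G\<lparr>carrier := K\<rparr>) = \<one>\<^bsub>G\<lparr>carrier := K\<rparr>\<^esub>"
    by (rule KG.pow_order_eq_1) (use x in auto)
  then have "x [^] CHAR('f) = \<one>"
    by (simp add: Coset.order_def K(2) nat_pow_consistent[symmetric])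
  then have "ord x dvd CHAR('f)"
    using xH by (simp add: pow_eq_id)
  moreover have "ord x \<noteq> 1"
    using x(2) xH ord_eq_1[of x] by simp
  ultimately have "ord x = CHAR('f)"
    using p by (auto simp: prime_nat_iff)
  then have "of_nat N = (0::'f)"
    using ord_dvd_N[OF xH] by (simp add: of_nat_eq_0_iff_char_dvd)
  then show False
    using of_nat_neq_0_primitive_root[OF primitive_root] by simp
qed

text \<open>Every value on \<open>H\<close> is a root of X ^ N - 1, and characters are extensional,
  so they lie in a finite product of finite sets of roots.\<close>

lemma finite_characters: "finite (characters G H :: ('a \<Rightarrow> 'f) set)"
proof -
  have "finite {z::'f. poly (monom 1 N - 1) z = 0}"
  proof (rule poly_roots_finite)
    have "coeff (monom 1 N - 1 :: 'f poly) N \<noteq> 0"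
      using N_pos by simp
    then show "monom 1 N - 1 \<noteq> (0 :: 'f poly)"
      by (metis coeff_0)
  qed
  then have "finite (\<Pi>\<^sub>E h\<in>H. {z::'f. poly (monom 1 N - 1) z = 0})"
    by (intro finite_PiE finite_H) auto
  moreover have "characters G H \<subseteq> (\<Pi>\<^sub>E h\<in>H. {z::'f. poly (monom 1 N - 1) z = 0})"
  proof
    fix \<alpha> :: "'a \<Rightarrow> 'f"
    assume \<alpha>: "\<alpha> \<in> characters G H"
    then have "\<alpha> x ^ N = 1" if "x \<in> H" for x
      using that characters_pow[of \<alpha> x N] H_pow_N[of x] characters_one[of \<alpha>] by simp
    then show "\<alpha> \<in> (\<Pi>\<^sub>E h\<in>H. {z::'f. poly (monom 1 N - 1) z = 0})"
      using \<alpha> by (auto simp: characters_def poly_monom PiE_iff)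
  qed
  ultimately show ?thesis
    by (rule rev_finite_subset)
qed

text \<open>For 0 < k < N the power of the inverse root differs from 1 while its N-th power is 1, so
  the geometric sum vanishes. This isolates the term k = 0 when the eigencomponents of a translation
  are added up.\<close>

lemma sum_root_powers:
  assumes "k < N"
  shows "(\<Sum>j<N. inverse \<zeta> ^ (j * k)) = (if k = 0 then of_nat N else 0)"
proof (cases "k = 0")
  case False
  let ?w = "inverse \<zeta> ^ k"
  have "?w \<noteq> 1"
    using primitive_root_inverse_power_neq_1[OF primitive_root _ assms] False by simp
  moreover have "?w ^ N = 1"
    using \<zeta>_pow_N by (simp add: power_inverse power_mult[symmetric] mult.commute[of k])
      (simp add: power_mult)
  ultimately have "(\<Sum>j<N. ?w ^ j) = 0"
    by (simp add: geometric_sum)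
  then show ?thesis
    using False by (simp add: power_mult[symmetric] mult.commute)
qed auto

text \<open>Translation by \<open>h\<close> satisfies \<open>X\<^sup>N = 1\<close>, which splits with simple roots, so some component of
  \<open>a\<close> in the eigenspace decomposition of this operator is nonzero.\<close>

lemma translation_eigenvector:
  fixes a :: "'a \<Rightarrow> 'f"
  assumes h: "h \<in> H" and a: "\<exists>x\<in>H. a x \<noteq> 0"
    and zero: "\<And>\<alpha>. \<alpha> \<in> characters G H \<Longrightarrow> fourier H a \<alpha> = 0"
  obtains b d where "\<exists>x\<in>H. b x \<noteq> 0" "\<And>\<alpha>. \<alpha> \<in> characters G H \<Longrightarrow> fourier H b \<alpha> = 0"
    "\<And>x. x \<in> H \<Longrightarrow> b (h \<otimes> x) = d * b x"
    "\<And>s c. s \<in> H \<Longrightarrow> \<forall>x\<in>H. a (s \<otimes> x) = c * a x \<Longrightarrow> \<forall>x\<in>H. b (s \<otimes> x) = c * b x"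
proof -
  \<comment> \<open>Up to the factor \<open>N\<close>, this is the component of \<open>a\<close> in
    the eigenspace of translation by \<open>h\<close> with eigenvalue \<zeta> ^ j.\<close>
  define b where "b j x = (\<Sum>k<N. inverse \<zeta> ^ (j * k) * a (h [^] k \<otimes> x))" for j x
  obtain y where y: "y \<in> H" "a y \<noteq> 0"
    using a by blast
  \<comment> \<open>The components add up to \<open>N\<close> times \<open>a\<close>, and
    \<open>N\<close> is nonzero in the field, so one of them does not vanish at
    \<open>y\<close>.\<close>
  have "(\<Sum>j<N. b j y) = (\<Sum>k<N. (\<Sum>j<N. inverse \<zeta> ^ (j * k)) * a (h [^] k \<otimes> y))"
    unfolding b_def by (subst sum.swap) (simp add: sum_distrib_right)
  also have "\<dots> = (\<Sum>k<N. (if k = 0 then of_nat N * a y else 0))"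
    using y h by (intro sum.cong) (auto simp: sum_root_powers)
  also have "\<dots> = of_nat N * a y"
    using N_pos by simp
  finally have "(\<Sum>j<N. b j y) \<noteq> 0"
    using y of_nat_neq_0_primitive_root[OF primitive_root] by simp
  then obtain j where j: "b j y \<noteq> 0"
    by (meson sum.not_neutral_contains_not_neutral)
  show thesis
  proof (rule that[of "b j" "\<zeta> ^ j"])
    show "\<exists>x\<in>H. b j x \<noteq> 0"
      using j y by blast
    show "fourier H (b j) \<alpha> = 0" if \<alpha>: "\<alpha> \<in> characters G H" for \<alpha>
    proof -
      \<comment> \<open>Translating \<open>a\<close> by \<open>s\<close> multiplies its coefficient
        at \<alpha> by \<open>\<alpha> (inv s)\<close>, so vanishing coefficients stay zero, and
        \<open>b j\<close> is a combination of translates.\<close>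
      have shift: "fourier H (\<lambda>x. a (s \<otimes> x)) \<alpha> = 0" if s: "s \<in> H" for s
      proof -
        have "fourier H (\<lambda>x. a (s \<otimes> x)) \<alpha> = (\<Sum>x\<in>H. a (s \<otimes> x) * \<alpha> (inv s \<otimes> (s \<otimes> x)))"
          unfolding fourier_def using s by (intro sum.cong) (auto simp: m_assoc[symmetric])
        also have "\<dots> = (\<Sum>x\<in>H. a x * \<alpha> (inv s \<otimes> x))"
          by (rule sum_translate[OF s])
        also have "\<dots> = \<alpha> (inv s) * fourier H a \<alpha>"
          using s \<alpha> by (simp add: characters_mult fourier_def sum_distrib_left algebra_simps)
        finally show ?thesis
          by (simp add: zero \<alpha>)
      qed
      show ?thesis
        unfolding b_def fourier_sum fourier_smult by (intro sum.neutral) (simp add: shift h)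
    qed
    show "b j (h \<otimes> x) = \<zeta> ^ j * b j x" if x: "x \<in> H" for x
    proof -
      define f where "f k = inverse \<zeta> ^ (j * k) * a (h [^] k \<otimes> x)" for k
      \<comment> \<open>Translation by \<open>h\<close> shifts the summation index by one; the new
        term at \<open>N\<close> replaces the lost term at 0.\<close>
      have fN: "f N = f 0"
      proof -
        have "inverse \<zeta> ^ (j * N) = 1"
          by (simp add: mult.commute[of j] power_mult power_inverse \<zeta>_pow_N)
        then show ?thesis
          using h by (simp add: f_def H_pow_N)
      qed
      have "(\<Sum>k<N. f (Suc k)) = (\<Sum>k<N. f k)"
      proof -
        have "f 0 + (\<Sum>k<N. f (Suc k)) = (\<Sum>k<N. f k) + f N"
          by (simp add: sum.lessThan_Suc_shift[symmetric])
        then show ?thesis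
          by (simp add: fN)
      qed
      moreover have "inverse \<zeta> ^ (j * k) * a (h [^] k \<otimes> (h \<otimes> x)) = \<zeta> ^ j * f (Suc k)" for k
        using h x \<zeta>_neq_0 by (simp add: f_def m_assoc power_add power_inverse)
      ultimately show ?thesis
        unfolding b_def by (simp add: sum_distrib_left[symmetric]) (simp add: f_def)
    qed
    \<comment> \<open>Translations commute, so eigenvector relations that \<open>a\<close> already
      satisfies pass to \<open>b j\<close>. This lets the translations be treated one at a
      time.\<close>
    show "\<forall>x\<in>H. b j (s \<otimes> x) = c * b j x" if s: "s \<in> H" "\<forall>x\<in>H. a (s \<otimes> x) = c * a x" for s c
    proof
      fix x
      assume x: "x \<in> H"
      have "a (h [^] k \<otimes> (s \<otimes> x)) = c * a (h [^] k \<otimes> x)" for k :: nat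
        using s h x m_lcomm[of "h [^] k" s x] by simp
      then show "b j (s \<otimes> x) = c * b j x"
        by (simp add: b_def sum_distrib_left mult.left_commute)
    qed
  qed
qed

text \<open>A nonzero function with vanishing coefficients could be replaced by a common eigenvector
  of all translations. Its eigenvalues form a multiplicative function c, and the eigenvector is a
  multiple of c; its coefficient at the inverse of c is then the order of \<open>H\<close> times a
  nonzero value, a contradiction. This is the completeness of the characters.\<close>

lemma fourier_eq_0D:
  fixes a :: "'a \<Rightarrow> 'f"
  assumes zero: "\<And>\<alpha>. \<alpha> \<in> characters G H \<Longrightarrow> fourier H a \<alpha> = 0" and "x \<in> H"
  shows "a x = 0"
proof (rule ccontr)
  assume "a x \<noteq> 0"
  \<comment> \<open>\<open>Q\<close> describes the counterexamples; the induction turns one of them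
    into an eigenvector for more and more translations.\<close>
  define Q where "Q b \<longleftrightarrow> (\<exists>x\<in>H. b x \<noteq> 0) \<and> (\<forall>\<alpha>\<in>characters G H. fourier H b \<alpha> = 0)"
    for b :: "'a \<Rightarrow> 'f"
  have "\<exists>b. Q b \<and> (\<forall>h\<in>S. \<exists>c. \<forall>x\<in>H. b (h \<otimes> x) = c * b x)" if "finite S" "S \<subseteq> H" for S
    using that
  proof (induction S rule: finite_induct)
    case empty
    then show ?case
      using \<open>a x \<noteq> 0\<close> assms by (auto simp: Q_def)
  next
    case (insert h S)
    then obtain b where b: "Q b" "\<forall>h\<in>S. \<exists>c. \<forall>x\<in>H. b (h \<otimes> x) = c * b x"
      by auto
    have h: "h \<in> H" "S \<subseteq> H"
      using insert.prems by auto
    obtain b' d where b': "\<exists>x\<in>H. b' x \<noteq> 0" "\<And>\<alpha>. \<alpha> \<in> characters G H \<Longrightarrow> fourier H b' \<alpha> = 0"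
      "\<And>x. x \<in> H \<Longrightarrow> b' (h \<otimes> x) = d * b' x"
      "\<And>s c. s \<in> H \<Longrightarrow> \<forall>x\<in>H. b (s \<otimes> x) = c * b x \<Longrightarrow> \<forall>x\<in>H. b' (s \<otimes> x) = c * b' x"
      using translation_eigenvector[OF h(1), of b] b(1) unfolding Q_def by blast
    have "Q b'"
      using b' by (auto simp: Q_def)
    moreover have "\<forall>h\<in>insert h S. \<exists>c. \<forall>x\<in>H. b' (h \<otimes> x) = c * b' x"
      using b'(3,4) b(2) h(2) by (metis insert_iff subsetD)
    ultimately show ?case
      by blast
  qed
  from this[OF finite_H subset_refl] obtain b
    where b: "Q b" "\<forall>h\<in>H. \<exists>c. \<forall>x\<in>H. b (h \<otimes> x) = c * b x"
    by blast
  then obtain c where c: "\<And>h x. h \<in> H \<Longrightarrow> x \<in> H \<Longrightarrow> b (h \<otimes> x) = c h * b x"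
    by metis
  obtain y where y: "y \<in> H" "b y \<noteq> 0"
    using b(1) by (auto simp: Q_def)
  have c1: "b h = c h * b \<one>" if "h \<in> H" for h
    using c[OF that, of \<one>] that by simp
  have b1: "b \<one> \<noteq> 0"
    using y c1[OF y(1)] by auto
  have c_mult: "c (h \<otimes> k) = c h * c k" if "h \<in> H" "k \<in> H" for h k
  proof -
    have "c (h \<otimes> k) * b \<one> = c h * (c k * b \<one>)"
      by (metis H_closed(1) c c1 that)
    then show ?thesis
      using b1 by simp
  qed
  have c_one: "c \<one> = 1"
    using c1[of \<one>] b1 by simp
  have c_neq_0: "c h \<noteq> 0" if "h \<in> H" for h
    using c_mult[of h "inv h"] that c_one by auto
  \<comment> \<open>The inverse makes every summand \<open>b h * \<alpha> h\<close> equal to the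
    constant \<open>b \<one>\<close>.\<close>
  define \<alpha> where "\<alpha> = (\<lambda>h\<in>H. inverse (c h))"
  have "\<alpha> \<in> characters G H"
    by (rule charactersI) (auto simp: \<alpha>_def c_neq_0 c_mult)
  then have "fourier H b \<alpha> = 0"
    using b(1) by (auto simp: Q_def)
  moreover have "b h * \<alpha> h = b \<one>" if "h \<in> H" for h
    using c1[OF that] c_neq_0[OF that] that by (simp add: \<alpha>_def)
  then have "fourier H b \<alpha> = (\<Sum>h\<in>H. b \<one>)"
    unfolding fourier_def by (intro sum.cong) auto
  ultimately show False
    using of_nat_card_neq_0 b1 by simp
qed

lemma fourier_eqD:
  fixes a b :: "'a \<Rightarrow> 'f"
  assumes "\<And>\<alpha>. \<alpha> \<in> characters G H \<Longrightarrow> fourier H a \<alpha> = fourier H b \<alpha>" and "x \<in> H"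
  shows "a x = b x"
  using fourier_eq_0D[of "\<lambda>x. a x + (-1) * b x" x] assms
  by (simp only: fourier_add fourier_smult) simp

text \<open>Translating the sum by an element \<open>k\<close> with \<alpha> k \<noteq> \<beta> k
  multiplies it by \<beta> k / \<alpha> k \<noteq> 1, so it is zero.\<close>

lemma character_orthogonality:
  fixes \<alpha> \<beta> :: "'a \<Rightarrow> 'f"
  assumes \<alpha>: "\<alpha> \<in> characters G H" and \<beta>: "\<beta> \<in> characters G H"
  shows "(\<Sum>h\<in>H. inverse (\<alpha> h) * \<beta> h) = (if \<alpha> = \<beta> then of_nat (card H) else 0)"
proof (cases "\<alpha> = \<beta>")
  case True
  then show ?thesis
    using characters_neq_0[OF \<alpha>] by simp
next
  case False
  then obtain k where k: "k \<in> H" "\<alpha> k \<noteq> \<beta> k"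
    using characters_eqI[OF \<alpha> \<beta>] by blast
  have "(\<Sum>h\<in>H. inverse (\<alpha> h) * \<beta> h) = (\<Sum>h\<in>H. inverse (\<alpha> (k \<otimes> h)) * \<beta> (k \<otimes> h))"
    by (rule sum_translate[OF k(1), symmetric])
  also have "\<dots> = \<beta> k / \<alpha> k * (\<Sum>h\<in>H. inverse (\<alpha> h) * \<beta> h)"
    using k(1) \<alpha> \<beta> by (simp add: sum_distrib_left characters_mult field_simps)
  finally have "(\<beta> k / \<alpha> k - 1) * (\<Sum>h\<in>H. inverse (\<alpha> h) * \<beta> h) = 0"
    by (simp add: algebra_simps)
  then show ?thesis
    using False k characters_neq_0[OF \<alpha> k(1)] by auto
qed

text \<open>Orthogonality leaves only the summand of \<beta>. Together with
  \<open>fourier_eq_0D\<close> this identifies the group algebra with the functions on the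
  characters.\<close>

lemma fourier_inverse_fourier:
  fixes \<beta> :: "'a \<Rightarrow> 'f"
  assumes \<beta>: "\<beta> \<in> characters G H"
  shows "fourier H (inverse_fourier G H f) \<beta> = f \<beta>"
proof -
  have "fourier H (inverse_fourier G H f) \<beta>
      = (\<Sum>h\<in>H. \<Sum>\<alpha>\<in>characters G H. f \<alpha> * (inverse (\<alpha> h) * \<beta> h) / of_nat (card H))"
    by (simp add: fourier_def inverse_fourier_def sum_distrib_right sum_divide_distrib mult.assoc)
  also have "\<dots> = (\<Sum>\<alpha>\<in>characters G H. f \<alpha> / of_nat (card H) * (\<Sum>h\<in>H. inverse (\<alpha> h) * \<beta> h))"
    by (subst sum.swap) (simp add: sum_distrib_left)
  also have "\<dots> = (\<Sum>\<alpha>\<in>characters G H. if \<alpha> = \<beta> then f \<alpha> else 0)"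
    using \<beta> of_nat_card_neq_0 by (intro sum.cong) (auto simp: character_orthogonality)
  also have "\<dots> = f \<beta>"
    using \<beta> finite_characters by simp
  finally show ?thesis .
qed

end


section \<open>Gradings and homogeneous projections\<close>

text \<open>Over an infinite index set both sums are zero by convention, so only the finite case
  needs induction. The value at zero is an assumption because additivity alone does not give it in a
  monoid.\<close>

lemma finsum_additive:
  assumes "abelian_monoid V" "abelian_monoid W"
    and \<phi>: "\<And>x. x \<in> carrier V \<Longrightarrow> \<phi> x \<in> carrier W"
      "\<And>x y. x \<in> carrier V \<Longrightarrow> y \<in> carrier V \<Longrightarrow> \<phi> (x \<oplus>\<^bsub>V\<^esub> y) = \<phi> x \<oplus>\<^bsub>W\<^esub> \<phi> y"
      "\<phi> \<zero>\<^bsub>V\<^esub> = \<zero>\<^bsub>W\<^esub>"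
    and f: "\<And>i. i \<in> A \<Longrightarrow> f i \<in> carrier V"
  shows "\<phi> (\<Oplus>\<^bsub>V\<^esub>i\<in>A. f i) = (\<Oplus>\<^bsub>W\<^esub>i\<in>A. \<phi> (f i))"
proof -
  interpret V: abelian_monoid V by fact
  interpret W: abelian_monoid W by fact
  show ?thesis
  proof (cases "finite A")
    case True
    then show ?thesis
      using f by (induction A rule: finite_induct) (auto simp: \<phi> Pi_iff)
  qed (simp add: \<phi>)
qed

text \<open>A grading described by its projections: \<open>\<pi>_sum\<close> supplies a
  decomposition and \<open>\<pi>_\<Gamma>\<close> makes it unique. \<open>D\<close> is any finite
  set of degrees containing those that occur, not necessarily the exact support.\<close>

locale homogeneous_projections = module R V for R :: "'r ring" (structure) and V :: "('r, 'v, 'z) module_scheme" (structure) +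
  fixes G :: "'g monoid" and D :: "'g set" and \<Gamma> :: "'g \<Rightarrow> 'v set" and \<pi> :: "'g \<Rightarrow> 'v \<Rightarrow> 'v"
  assumes finite_D: "finite D" and D_subset: "D \<subseteq> carrier G"
    and submodule_\<Gamma>: "g \<in> carrier G \<Longrightarrow> submodule (\<Gamma> g) R V"
    and \<pi>_in: "g \<in> carrier G \<Longrightarrow> x \<in> carrier V \<Longrightarrow> \<pi> g x \<in> \<Gamma> g"
    and \<pi>_add: "g \<in> carrier G \<Longrightarrow> x \<in> carrier V \<Longrightarrow> y \<in> carrier V \<Longrightarrow> \<pi> g (x \<oplus>\<^bsub>V\<^esub> y) = \<pi> g x \<oplus>\<^bsub>V\<^esub> \<pi> g y"
    and \<pi>_\<Gamma>: "g \<in> carrier G \<Longrightarrow> h \<in> carrier G \<Longrightarrow> x \<in> \<Gamma> h \<Longrightarrow> \<pi> g x = (if g = h then x else \<zero>\<^bsub>V\<^esub>)"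
    and \<pi>_outside: "g \<in> carrier G \<Longrightarrow> g \<notin> D \<Longrightarrow> x \<in> carrier V \<Longrightarrow> \<pi> g x = \<zero>\<^bsub>V\<^esub>"
    and \<pi>_sum: "x \<in> carrier V \<Longrightarrow> (\<Oplus>\<^bsub>V\<^esub>g\<in>D. \<pi> g x) = x"
begin

lemma \<Gamma>_closed: "g \<in> carrier G \<Longrightarrow> x \<in> \<Gamma> g \<Longrightarrow> x \<in> carrier V"
  using submoduleE(1)[OF submodule_\<Gamma>] by blast

lemma \<pi>_closed: "g \<in> carrier G \<Longrightarrow> x \<in> carrier V \<Longrightarrow> \<pi> g x \<in> carrier V"
  using \<pi>_in \<Gamma>_closed by blast

lemma \<pi>_zero: "g \<in> carrier G \<Longrightarrow> \<pi> g \<zero>\<^bsub>V\<^esub> = \<zero>\<^bsub>V\<^esub>"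
  using \<pi>_\<Gamma>[of g g "\<zero>\<^bsub>V\<^esub>"] subgroup.one_closed[OF submodule.axioms(1)[OF submodule_\<Gamma>]] by simp

lemma \<pi>_sum_mono:
  assumes "finite E" "D \<subseteq> E" "E \<subseteq> carrier G" "x \<in> carrier V"
  shows "(\<Oplus>\<^bsub>V\<^esub>g\<in>E. \<pi> g x) = x"
proof -
  have "(\<Oplus>\<^bsub>V\<^esub>g\<in>D. \<pi> g x) = (\<Oplus>\<^bsub>V\<^esub>g\<in>E. \<pi> g x)"
    by (rule M.add.finprod_mono_neutral_cong_left) (use assms in \<open>auto simp: \<pi>_outside \<pi>_closed subset_iff\<close>)
  then show ?thesis
    using \<pi>_sum assms by simp
qed

text \<open>Enlarging \<open>D\<close> only adds zero components. It allows several modules to share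
  one \<open>D\<close>, as the constructions of direct sums and triangular algebras below
  require.\<close>

lemma mono_support:
  assumes "finite E" "D \<subseteq> E" "E \<subseteq> carrier G"
  shows "homogeneous_projections R V G E \<Gamma> \<pi>"
  using assms \<pi>_sum_mono
  by (intro homogeneous_projections.intro homogeneous_projections_axioms.intro)
    (auto simp: module_axioms submodule_\<Gamma> \<pi>_in \<pi>_add \<pi>_\<Gamma> intro: \<pi>_outside)

text \<open>The projections provide the components; conversely, applying \<open>\<pi> h\<close> to
  any decomposition of \<open>v\<close> leaves just its term of degree \<open>h\<close>.\<close>

lemma direct_decomposition: "direct_decomposition R G V \<Gamma>"
  unfolding direct_decomposition_def
proof (intro conjI ballI)
  fix v
  assume v: "v \<in> carrier V"
  let ?S = "\<lambda>f. {g \<in> carrier G. f g \<noteq> \<zero>\<^bsub>V\<^esub>}"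
  show "\<exists>!f. f \<in> (\<Pi>\<^sub>E g\<in>carrier G. \<Gamma> g) \<and> finite (?S f) \<and> v = (\<Oplus>\<^bsub>V\<^esub>g\<in>?S f. f g)"
  proof (rule ex1I[of _ "\<lambda>g\<in>carrier G. \<pi> g v"])
    let ?f = "\<lambda>g\<in>carrier G. \<pi> g v"
    have sub: "?S ?f \<subseteq> D"
    proof
      fix g
      assume "g \<in> ?S ?f"
      then show "g \<in> D"
        using v \<pi>_outside[of g v] by (cases "g \<in> D") auto
    qed
    \<comment> \<open>The definition sums over the degrees with nonzero component, whereas
      \<open>\<pi>_sum\<close> sums over \<open>D\<close>; the difference consists of zero
      terms.\<close>
    have "(\<Oplus>\<^bsub>V\<^esub>g\<in>?S ?f. ?f g) = (\<Oplus>\<^bsub>V\<^esub>g\<in>D. \<pi> g v)"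
    proof (rule M.add.finprod_mono_neutral_cong_left[OF finite_D sub])
      show "\<pi> g v = \<zero>\<^bsub>V\<^esub>" if "g \<in> D - ?S ?f" for g
        using D_subset that by auto
      show "(\<lambda>g. \<pi> g v) \<in> D \<rightarrow> carrier V"
        using v D_subset by (auto intro: \<pi>_closed)
    qed simp
    then show "?f \<in> (\<Pi>\<^sub>E g\<in>carrier G. \<Gamma> g) \<and> finite (?S ?f) \<and> v = (\<Oplus>\<^bsub>V\<^esub>g\<in>?S ?f. ?f g)"
      using v finite_subset[OF sub finite_D] \<pi>_sum[OF v] by (simp add: \<pi>_in)
  next
    fix f
    assume f: "f \<in> (\<Pi>\<^sub>E g\<in>carrier G. \<Gamma> g) \<and> finite (?S f) \<and> v = (\<Oplus>\<^bsub>V\<^esub>g\<in>?S f. f g)"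
    have f_in: "f g \<in> \<Gamma> g" if "g \<in> carrier G" for g
      using conjunct1[OF f] that by (rule PiE_mem)
    have fV: "f g \<in> carrier V" if "g \<in> carrier G" for g
      by (rule \<Gamma>_closed[OF that f_in[OF that]])
    note fin = conjunct1[OF conjunct2[OF f]] and v_sum = conjunct2[OF conjunct2[OF f]]
    have "f h = \<pi> h v" if h: "h \<in> carrier G" for h
    proof -
      have "\<pi> h v = \<pi> h (\<Oplus>\<^bsub>V\<^esub>g\<in>?S f. f g)"
        by (rule arg_cong[OF v_sum])
      also have "\<dots> = (\<Oplus>\<^bsub>V\<^esub>g\<in>?S f. \<pi> h (f g))"
        using h fV
        by (intro finsum_additive) (auto simp: \<pi>_closed \<pi>_add \<pi>_zero M.abelian_monoid_axioms)
      also have "\<dots> = (\<Oplus>\<^bsub>V\<^esub>g\<in>?S f. if h = g then f g else \<zero>\<^bsub>V\<^esub>)"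
        using h f_in by (intro M.add.finprod_cong') (auto simp: \<pi>_\<Gamma> fV)
      also have "\<dots> = f h"
      proof (cases "h \<in> ?S f")
        case True
        then show ?thesis
          using fin fV by (intro M.add.finprod_singleton) auto
      next
        case False
        then have "(\<Oplus>\<^bsub>V\<^esub>g\<in>?S f. if h = g then f g else \<zero>\<^bsub>V\<^esub>) = \<zero>\<^bsub>V\<^esub>"
          by (intro M.add.finprod_one_eqI) auto
        then show ?thesis
          using False h by simp
      qed
      finally show ?thesis ..
    qed
    then show "f = (\<lambda>g\<in>carrier G. \<pi> g v)"
      using \<pi>_in v by (intro PiE_ext[OF conjunct1[OF f]]) auto
  qed
qed (rule submodule_\<Gamma>)

end

text \<open>Nothing is assumed about \<open>Q\<close> beyond its operations, so the same locale
  covers quotients before they are known to be modules. For that reason \<open>q_zero\<close> is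
  listed separately: it cannot be derived without cancellation in \<open>Q\<close>.\<close>

locale linear_surjection = module R V for R :: "'r ring" (structure) and V :: "('r, 'v, 'z) module_scheme" (structure) +
  fixes Q :: "('r, 'w, 'y) module_scheme" and q
  assumes image: "q ` carrier V = carrier Q"
    and q_add: "x \<in> carrier V \<Longrightarrow> y \<in> carrier V \<Longrightarrow> q (x \<oplus>\<^bsub>V\<^esub> y) = q x \<oplus>\<^bsub>Q\<^esub> q y"
    and q_smult: "c \<in> carrier R \<Longrightarrow> x \<in> carrier V \<Longrightarrow> q (c \<odot>\<^bsub>V\<^esub> x) = c \<odot>\<^bsub>Q\<^esub> q x"
    and q_zero: "q \<zero>\<^bsub>V\<^esub> = \<zero>\<^bsub>Q\<^esub>"
begin

lemma q_closed: "x \<in> carrier V \<Longrightarrow> q x \<in> carrier Q"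
  using image by blast

text \<open>Identities pass to a surjective image, and the negative of \<open>q x\<close> is
  \<open>q\<close> of the negative of \<open>x\<close>.\<close>

lemma module_image: "module R Q"
proof (rule moduleI)
  show "abelian_group Q"
  proof (rule abelian_groupI)
    fix y assume "y \<in> carrier Q"
    then obtain x where x: "x \<in> carrier V" "y = q x"
      using image by blast
    then have "q (\<ominus>\<^bsub>V\<^esub> x) \<oplus>\<^bsub>Q\<^esub> y = \<zero>\<^bsub>Q\<^esub>"
      by (simp add: q_add[symmetric] q_zero M.l_neg)
    then show "\<exists>z\<in>carrier Q. z \<oplus>\<^bsub>Q\<^esub> y = \<zero>\<^bsub>Q\<^esub>"
      using x by (auto intro!: q_closed)
  qed (auto simp: image[symmetric] q_add[symmetric] q_zero[symmetric] M.a_ac)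
qed (auto simp: image[symmetric] q_add[symmetric] q_smult[symmetric] R.cring_axioms
    smult_l_distr smult_r_distr smult_assoc1)

lemma submodule_image:
  assumes "submodule W R V"
  shows "submodule (q ` W) R Q"
proof -
  interpret Q: module R Q by (rule module_image)
  note W = submoduleE[OF assms]
  show ?thesis
  proof (rule Q.submoduleI)
    show "q ` W \<subseteq> carrier Q"
      using W(1) q_closed by blast
    show "\<zero>\<^bsub>Q\<^esub> \<in> q ` W"
      using subgroup.one_closed[OF submodule.axioms(1)[OF assms]] q_zero[symmetric] by auto
    show "\<ominus>\<^bsub>Q\<^esub> y \<in> q ` W" if "y \<in> q ` W" for y
    proof -
      obtain x where x: "x \<in> W" "y = q x"
        using \<open>y \<in> q ` W\<close> by blast
      then have xV: "x \<in> carrier V"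
        using W(1) by blast
      have "q (\<ominus>\<^bsub>V\<^esub> x) \<oplus>\<^bsub>Q\<^esub> q x = \<zero>\<^bsub>Q\<^esub>"
        using xV by (simp add: q_add[symmetric] q_zero M.l_neg)
      then have "\<ominus>\<^bsub>Q\<^esub> y = q (\<ominus>\<^bsub>V\<^esub> x)"
        using x xV by (simp add: q_closed Q.minus_equality)
      then show ?thesis
        using W(3) x by simp
    qed
  qed (use W in \<open>auto simp: q_add[symmetric] q_smult[symmetric] subset_iff\<close>)
qed

text \<open>The second assumption says that the projections descend along \<open>q\<close>; for a
  quotient map this amounts to the kernel being a graded submodule.\<close>

lemma homogeneous_projections_image:
  assumes "homogeneous_projections R V G D \<Gamma> \<pi>"
    and \<pi>': "\<And>g x. g \<in> carrier G \<Longrightarrow> x \<in> carrier V \<Longrightarrow> \<pi>' g (q x) = q (\<pi> g x)"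
  shows "homogeneous_projections R Q G D (\<lambda>g. q ` \<Gamma> g) \<pi>'"
proof -
  interpret V: homogeneous_projections R V G D \<Gamma> \<pi> by fact
  interpret Q: module R Q by (rule module_image)
  show ?thesis
  proof (intro homogeneous_projections.intro homogeneous_projections_axioms.intro)
    show "submodule (q ` \<Gamma> g) R Q" if "g \<in> carrier G" for g
      using that by (intro submodule_image V.submodule_\<Gamma>)
    show "\<pi>' g y = (if g = h then y else \<zero>\<^bsub>Q\<^esub>)"
      if "g \<in> carrier G" "h \<in> carrier G" "y \<in> q ` \<Gamma> h" for g h y
      using that V.\<Gamma>_closed by (auto simp: \<pi>' V.\<pi>_\<Gamma> q_zero)
    show "(\<Oplus>\<^bsub>Q\<^esub>g\<in>D. \<pi>' g y) = y" if y: "y \<in> carrier Q" for y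
    proof -
      obtain x where x: "x \<in> carrier V" "y = q x"
        using y image by blast
      have "q x = q (\<Oplus>\<^bsub>V\<^esub>g\<in>D. \<pi> g x)"
        by (simp add: V.\<pi>_sum x)
      also have "\<dots> = (\<Oplus>\<^bsub>Q\<^esub>g\<in>D. q (\<pi> g x))"
        using x V.D_subset
        by (intro finsum_additive)
          (auto simp: q_closed q_add q_zero V.\<pi>_closed M.abelian_monoid_axioms Q.abelian_monoid_axioms)
      also have "\<dots> = (\<Oplus>\<^bsub>Q\<^esub>g\<in>D. \<pi>' g y)"
        using x V.D_subset by (intro Q.add.finprod_cong') (auto simp: \<pi>' q_closed V.\<pi>_closed)
      finally show ?thesis
        using x by simp
    qed
  qed (auto simp: Q.module_axioms image[symmetric] \<pi>' V.\<pi>_in V.\<pi>_add V.\<pi>_outside V.\<pi>_closed q_zero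
      q_add[symmetric] V.finite_D subsetD[OF V.D_subset])
qed

end

lemma bimodule_image:
  fixes M :: "('f, 'a, 'b, 'm) bimodule" and N :: "('f, 'a, 'b, 'n) bimodule"
  assumes "bimodule R A B M" and "linear_surjection R M N q"
    and q_lact: "\<And>a x. a \<in> carrier A \<Longrightarrow> x \<in> carrier M \<Longrightarrow> lact N a (q x) = q (lact M a x)"
    and q_ract: "\<And>b x. b \<in> carrier B \<Longrightarrow> x \<in> carrier M \<Longrightarrow> ract N (q x) b = q (ract M x b)"
  shows "bimodule R A B N"
proof -
  interpret M: bimodule R A B M by fact
  interpret q: linear_surjection R M N q by fact
  interpret N: module R N by (rule q.module_image)
  note * = q.image[symmetric] q.q_closed q_lact q_ract q.q_add[symmetric] q.q_smult[symmetric]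
    M.lact_closed M.ract_closed
  show ?thesis
    by unfold_locales
      (auto simp: * M.lact_add_left M.lact_add_right M.lact_smult_left M.lact_smult_right M.lact_mult
        M.lact_one M.ract_add_left M.ract_add_right M.ract_smult_left M.ract_smult_right M.ract_mult
        M.ract_one M.lact_ract)
qed

text \<open>The grading of \<open>B\<close> is by definition the image of that of \<open>A\<close>,
  so the inverse of \<phi> respects degrees at once. What needs proof is that the images decompose
  \<open>B\<close>, which conjugated projections show.\<close>

lemma graded_algebra_image:
  fixes A :: "('f, 'a) module" and B :: "('f, 'b) module"
  assumes A: "graded_algebra R G A \<Gamma>" and A_proj: "homogeneous_projections R A G D \<Gamma> \<pi>"
    and B: "assoc_algebra R B"
    and \<phi>: "\<phi> \<in> ring_iso A B"
    and \<phi>_smult: "\<And>c x. c \<in> carrier R \<Longrightarrow> x \<in> carrier A \<Longrightarrow> \<phi> (c \<odot>\<^bsub>A\<^esub> x) = c \<odot>\<^bsub>B\<^esub> \<phi> x"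
  shows "graded_algebra R G B (\<lambda>g. \<phi> ` \<Gamma> g)"
    and "graded_algebra_iso R G B (\<lambda>g. \<phi> ` \<Gamma> g) A \<Gamma>"
proof -
  interpret A: assoc_algebra R A
    using A by (simp add: graded_algebra_def)
  interpret AP: homogeneous_projections R A G D \<Gamma> \<pi> by fact
  interpret B: assoc_algebra R B by fact
  have bij: "bij_betw \<phi> (carrier A) (carrier B)"
    and hom: "\<phi> \<in> ring_hom A B"
    using \<phi> by (auto simp: ring_iso_def)
  have "\<phi> \<zero>\<^bsub>A\<^esub> = \<zero>\<^bsub>B\<^esub>"
    using hom A.ring_axioms B.ring_axioms by (rule ring_hom_zero)
  then interpret S: linear_surjection R A B \<phi>
    using bij hom \<phi>_smult
    by unfold_locales (auto simp: bij_betw_def ring_hom_add)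
  let ?\<psi> = "inv_into (carrier A) \<phi>"
  have \<psi>\<phi>: "?\<psi> (\<phi> x) = x" if "x \<in> carrier A" for x
    using bij that by (simp add: bij_betw_def inv_into_f_f)
  have "homogeneous_projections R B G D (\<lambda>g. \<phi> ` \<Gamma> g) (\<lambda>g y. \<phi> (\<pi> g (?\<psi> y)))"
    by (rule S.homogeneous_projections_image[OF A_proj]) (simp add: \<psi>\<phi>)
  then interpret BP: homogeneous_projections R B G D "\<lambda>g. \<phi> ` \<Gamma> g" "\<lambda>g y. \<phi> (\<pi> g (?\<psi> y))" .
  show "graded_algebra R G B (\<lambda>g. \<phi> ` \<Gamma> g)"
    unfolding graded_algebra_def
  proof (intro conjI ballI)
    fix g h x y
    assume *: "g \<in> carrier G" "h \<in> carrier G" "x \<in> \<phi> ` \<Gamma> g" "y \<in> \<phi> ` \<Gamma> h"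
    then obtain x' y' where xy: "x' \<in> \<Gamma> g" "x = \<phi> x'" "y' \<in> \<Gamma> h" "y = \<phi> y'"
      by blast
    then have "x' \<otimes>\<^bsub>A\<^esub> y' \<in> \<Gamma> (g \<otimes>\<^bsub>G\<^esub> h)"
      using A * by (simp add: graded_algebra_def)
    moreover have "x \<otimes>\<^bsub>B\<^esub> y = \<phi> (x' \<otimes>\<^bsub>A\<^esub> y')"
      using xy * hom by (simp add: AP.\<Gamma>_closed ring_hom_mult)
    ultimately show "x \<otimes>\<^bsub>B\<^esub> y \<in> \<phi> ` \<Gamma> (g \<otimes>\<^bsub>G\<^esub> h)"
      by blast
  qed (rule B BP.direct_decomposition)+
  show "graded_algebra_iso R G B (\<lambda>g. \<phi> ` \<Gamma> g) A \<Gamma>"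
    unfolding graded_algebra_iso_def
  proof (intro bexI[of _ ?\<psi>] conjI ballI)
    show "?\<psi> \<in> ring_iso B A"
      using A.ring_axioms \<phi> by (rule ring_iso_set_sym)
    show "?\<psi> (c \<odot>\<^bsub>B\<^esub> y) = c \<odot>\<^bsub>A\<^esub> ?\<psi> y" if "c \<in> carrier R" "y \<in> carrier B" for c y
      using that by (auto simp: S.image[symmetric] \<phi>_smult[symmetric] \<psi>\<phi>)
    show "?\<psi> ` \<phi> ` \<Gamma> g = \<Gamma> g" if "g \<in> carrier G" for g
      using that by (force simp: image_image \<psi>\<phi> AP.\<Gamma>_closed)
  qed
qed


section \<open>Modules of functions\<close>

text \<open>The common frame of the group algebra and of the bimodule before balancing; the record
  scheme admits both kinds of record.\<close>

locale pointwise_module =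
  fixes V :: "('f::field, 'p \<Rightarrow> 'f, 'z) module_scheme"
  assumes zero_eq: "\<zero>\<^bsub>V\<^esub> = (\<lambda>p. 0)"
    and add_eq: "\<And>x y. x \<oplus>\<^bsub>V\<^esub> y = (\<lambda>p. x p + y p)"
    and smult_eq: "\<And>c x. c \<odot>\<^bsub>V\<^esub> x = (\<lambda>p. c * x p)"
    and zero_in: "(\<lambda>p. 0) \<in> carrier V"
    and add_in: "\<And>x y. x \<in> carrier V \<Longrightarrow> y \<in> carrier V \<Longrightarrow> (\<lambda>p. x p + y p) \<in> carrier V"
    and smult_in: "\<And>c x. x \<in> carrier V \<Longrightarrow> (\<lambda>p. c * x p) \<in> carrier V"
begin

lemma uminus_in: "x \<in> carrier V \<Longrightarrow> (\<lambda>p. - x p) \<in> carrier V"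
  using smult_in[of x "- 1"] by simp

lemma is_module: "module \<F> V"
proof (rule moduleI)
  show "cring (\<F> :: 'f ring)"
    by (rule cring_from_type_algebra)
  show "abelian_group V"
  proof (rule abelian_groupI)
    show "\<exists>y\<in>carrier V. y \<oplus>\<^bsub>V\<^esub> x = \<zero>\<^bsub>V\<^esub>" if "x \<in> carrier V" for x
      using uminus_in[OF that] by (auto simp: add_eq zero_eq intro!: bexI[of _ "\<lambda>p. - x p"])
  qed (auto simp: add_eq zero_eq zero_in add_in add.assoc add.commute)
qed (auto simp: add_eq smult_eq smult_in algebra_simps)

sublocale module \<F> V
  by (rule is_module)

lemma a_inv_eq: "x \<in> carrier V \<Longrightarrow> \<ominus>\<^bsub>V\<^esub> x = (\<lambda>p. - x p)"
  by (rule M.minus_equality) (auto simp: add_eq zero_eq uminus_in)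

lemma a_minus_eq: "y \<in> carrier V \<Longrightarrow> x \<ominus>\<^bsub>V\<^esub> y = (\<lambda>p. x p - y p)"
  by (simp add: a_minus_def a_inv_eq add_eq)

lemma finsum_eq:
  assumes "finite I" "\<And>i. i \<in> I \<Longrightarrow> f i \<in> carrier V"
  shows "(\<Oplus>\<^bsub>V\<^esub>i\<in>I. f i) = (\<lambda>p. \<Sum>i\<in>I. f i p)"
  using assms by (induction I rule: finite_induct) (auto simp: zero_eq add_eq Pi_iff)

lemma submodule_iff:
  "submodule W \<F> V \<longleftrightarrow> W \<subseteq> carrier V \<and> (\<lambda>p. 0) \<in> W \<and>
    (\<forall>x\<in>W. \<forall>y\<in>W. (\<lambda>p. x p + y p) \<in> W) \<and> (\<forall>c. \<forall>x\<in>W. (\<lambda>p. c * x p) \<in> W)"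
proof (intro iffI conjI ballI allI)
  assume W: "submodule W \<F> V"
  show "(\<lambda>p. 0) \<in> W"
    using subgroup.one_closed[OF submodule.axioms(1)[OF W]] by (simp add: zero_eq)
  fix x y assume "x \<in> W" "y \<in> W"
  then show "(\<lambda>p. x p + y p) \<in> W"
    using submoduleE(5)[OF W, of x y] by (simp add: add_eq)
next
  fix c x assume W: "submodule W \<F> V" and "x \<in> W"
  then show "(\<lambda>p. c * x p) \<in> W"
    using submoduleE(4)[OF W, of c x] by (simp add: smult_eq)
next
  assume "submodule W \<F> V"
  then show "W \<subseteq> carrier V"
    by (rule submoduleE)
next
  assume *: "W \<subseteq> carrier V \<and> (\<lambda>p. 0) \<in> W \<and>
    (\<forall>x\<in>W. \<forall>y\<in>W. (\<lambda>p. x p + y p) \<in> W) \<and> (\<forall>c. \<forall>x\<in>W. (\<lambda>p. c * x p) \<in> W)"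
  show "submodule W \<F> V"
  proof (rule submoduleI)
    show "\<ominus>\<^bsub>V\<^esub> x \<in> W" if "x \<in> W" for x
    proof -
      have "(\<lambda>p. (- 1) * x p) \<in> W" "x \<in> carrier V"
        using * that by blast+
      then show ?thesis
        by (simp add: a_inv_eq)
    qed
  qed (use * in \<open>auto simp: zero_eq add_eq smult_eq\<close>)
qed

lemma submodule_sum:
  assumes W: "submodule W \<F> V" and "finite I" and "\<And>i. i \<in> I \<Longrightarrow> f i \<in> W"
  shows "(\<lambda>p. \<Sum>i\<in>I. f i p) \<in> W"
  using assms(2,3) W by (induction I rule: finite_induct) (auto simp: submodule_iff)

end

section \<open>The group algebra\<close>

lemma group_algebra_simps:
  "carrier (group_algebra G H) = {a. \<forall>h. h \<notin> H \<longrightarrow> a h = 0}"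
  "a \<otimes>\<^bsub>group_algebra G H\<^esub> b = (\<lambda>x. \<Sum>(h, k) \<in> {(h, k) \<in> H \<times> H. h \<otimes>\<^bsub>G\<^esub> k = x}. a h * b k)"
  "\<one>\<^bsub>group_algebra G H\<^esub> = (\<lambda>h. if h = \<one>\<^bsub>G\<^esub> then 1 else 0)"
  "\<zero>\<^bsub>group_algebra G H\<^esub> = (\<lambda>h. 0)"
  "a \<oplus>\<^bsub>group_algebra G H\<^esub> b = (\<lambda>h. a h + b h)"
  "c \<odot>\<^bsub>group_algebra G H\<^esub> a = (\<lambda>h. c * a h)"
  by (simp_all add: group_algebra_def)

lemma pointwise_module_group_algebra: "pointwise_module (group_algebra G H)"
  by unfold_locales (auto simp: group_algebra_simps)

context finite_subgroup
begin

lemma fourier_one: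
  assumes "\<alpha> \<in> characters G H"
  shows "fourier H (\<lambda>h. if h = \<one> then 1 else 0) \<alpha> = 1"
proof -
  have "fourier H (\<lambda>h. if h = \<one> then 1 else 0) \<alpha> = (\<Sum>h\<in>H. if h = \<one> then \<alpha> h else 0)"
    unfolding fourier_def by (intro sum.cong) auto
  then show ?thesis
    using assms by (simp add: finite_H characters_one)
qed

lemma group_algebra_mult_closed:
  fixes a b :: "'a \<Rightarrow> 'f::field"
  assumes "a \<in> carrier (group_algebra G H)" "b \<in> carrier (group_algebra G H)"
  shows "a \<otimes>\<^bsub>group_algebra G H\<^esub> b \<in> carrier (group_algebra G H)"
  by (auto simp: group_algebra_simps intro!: sum.neutral)

lemma homogeneous_projections_group_algebra:
  "homogeneous_projections \<F> (group_algebra G H :: ('f::field, 'a \<Rightarrow> 'f) module) G H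
    (group_algebra_grading H) (\<lambda>g a h. if h \<in> H \<and> h = g then a h else 0)"
proof -
  interpret P: pointwise_module "group_algebra G H :: ('f, 'a \<Rightarrow> 'f) module"
    by (rule pointwise_module_group_algebra)
  let ?V = "group_algebra G H :: ('f, 'a \<Rightarrow> 'f) module"
  show ?thesis
  proof (intro homogeneous_projections.intro homogeneous_projections_axioms.intro)
    show "submodule (group_algebra_grading H g) \<F> ?V" for g
      by (auto simp: P.submodule_iff group_algebra_grading_def group_algebra_simps)
    fix a :: "'a \<Rightarrow> 'f"
    assume a: "a \<in> carrier ?V"
    have "(\<Oplus>\<^bsub>?V\<^esub>g\<in>H. (\<lambda>h. if h \<in> H \<and> h = g then a h else 0))
      = (\<lambda>h. \<Sum>g\<in>H. if h \<in> H \<and> h = g then a h else 0)"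
      by (intro P.finsum_eq finite_H) (auto simp: group_algebra_simps)
    also have "\<dots> = a"
    proof
      fix h
      show "(\<Sum>g\<in>H. if h \<in> H \<and> h = g then a h else 0) = a h"
        using a finite_H by (cases "h \<in> H") (auto simp: group_algebra_simps)
    qed
    finally show "(\<Oplus>\<^bsub>?V\<^esub>g\<in>H. (\<lambda>h. if h \<in> H \<and> h = g then a h else 0)) = a" .
  qed (auto simp: finite_H P.is_module group_algebra_grading_def group_algebra_simps fun_eq_iff)
qed

lemma group_algebra_grading_mult:
  assumes g: "g \<in> carrier G" and h: "h \<in> carrier G"
    and a: "a \<in> group_algebra_grading H g" and b: "b \<in> group_algebra_grading H h"
  shows "a \<otimes>\<^bsub>group_algebra G H\<^esub> b \<in> group_algebra_grading H (g \<otimes> h)"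
  unfolding group_algebra_grading_def group_algebra_simps mem_Collect_eq
proof (intro allI impI sum.neutral ballI)
  fix x p
  assume x: "\<not> (x \<in> H \<and> x = g \<otimes> h)" and p: "p \<in> {(h, k) \<in> H \<times> H. h \<otimes> k = x}"
  have "fst p \<noteq> g \<or> snd p \<noteq> h"
    using x p by auto
  then show "(case p of (h, k) \<Rightarrow> a h * b k) = 0"
    using a b by (auto simp: group_algebra_grading_def split: prod.split)
qed

end

context split_subgroup
begin

lemma group_algebra_eqI:
  fixes a b :: "'a \<Rightarrow> 'f"
  assumes "a \<in> carrier (group_algebra G H)" "b \<in> carrier (group_algebra G H)"
    and "\<And>\<alpha>. \<alpha> \<in> characters G H \<Longrightarrow> fourier H a \<alpha> = fourier H b \<alpha>"
  shows "a = b"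
proof
  fix x
  show "a x = b x"
    using assms fourier_eqD[of a b x] by (cases "x \<in> H") (auto simp: group_algebra_simps)
qed

lemma fourier_group_algebra_mult:
  "\<alpha> \<in> characters G H \<Longrightarrow> fourier H (a \<otimes>\<^bsub>group_algebra G H\<^esub> b) \<alpha> = fourier H a \<alpha> * fourier H b \<alpha>"
  unfolding group_algebra_simps by (rule fourier_convolution)

lemma fourier_group_algebra_one:
  "\<alpha> \<in> characters G H \<Longrightarrow> fourier H \<one>\<^bsub>group_algebra G H\<^esub> \<alpha> = 1"
  by (simp add: group_algebra_simps fourier_one)

lemma fourier_group_algebra_add:
  "fourier H (a \<oplus>\<^bsub>group_algebra G H\<^esub> b) \<alpha> = fourier H a \<alpha> + fourier H b \<alpha>"
  by (simp add: group_algebra_simps fourier_add)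

lemma fourier_group_algebra_smult:
  "fourier H (c \<odot>\<^bsub>group_algebra G H\<^esub> a) \<alpha> = c * fourier H a \<alpha>"
  by (simp add: group_algebra_simps fourier_smult)

lemmas fourier_group_algebra = fourier_group_algebra_mult fourier_group_algebra_one
  fourier_group_algebra_add fourier_group_algebra_smult

text \<open>Each law becomes, at every character, an identity between elements of the field, and
  \<open>group_algebra_eqI\<close> carries it back. Associativity of convolution thus needs no
  rearrangement of sums.\<close>

lemma assoc_algebra_group_algebra: "assoc_algebra \<F> (group_algebra G H :: ('f, 'a \<Rightarrow> 'f) module)"
proof -
  interpret P: pointwise_module "group_algebra G H :: ('f, 'a \<Rightarrow> 'f) module"
    by (rule pointwise_module_group_algebra)
  have one: "\<one>\<^bsub>group_algebra G H\<^esub> \<in> carrier (group_algebra G H :: ('f, 'a \<Rightarrow> 'f) module)"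
    by (auto simp: group_algebra_simps)
  show ?thesis
    by (intro assoc_algebra.intro assoc_algebra_axioms.intro ringI monoidI P.is_module
        P.abelian_group_axioms; (rule group_algebra_eqI)?)
      (auto simp: group_algebra_mult_closed one fourier_group_algebra algebra_simps)
qed

lemma graded_algebra_group_algebra:
  "graded_algebra \<F> G (group_algebra G H :: ('f, 'a \<Rightarrow> 'f) module) (group_algebra_grading H)"
  unfolding graded_algebra_def
  using assoc_algebra_group_algebra group_algebra_grading_mult
    homogeneous_projections.direct_decomposition[OF homogeneous_projections_group_algebra]
  by blast

end


section \<open>The bimodule before balancing\<close>

definition fourier2 :: "'g set \<Rightarrow> 'g set \<Rightarrow> ('g \<times> 'g \<Rightarrow> 'f::field) \<Rightarrow> ('g \<Rightarrow> 'f) \<Rightarrow> ('g \<Rightarrow> 'f) \<Rightarrow> 'f"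
  where "fourier2 H1 H2 u \<alpha> \<beta> = fourier H1 (\<lambda>h1. fourier H2 (\<lambda>h2. u (h1, h2)) \<beta>) \<alpha>"

text \<open>Up to the factor |H1| |H2| these are the vectors dual to the coefficients: by
  orthogonality the double transform of the one for (\<gamma>, \<delta>) vanishes at every other
  pair of characters.\<close>

definition character_tensor :: "'g set \<Rightarrow> 'g set \<Rightarrow> ('g \<Rightarrow> 'f::field) \<Rightarrow> ('g \<Rightarrow> 'f) \<Rightarrow> 'g \<times> 'g \<Rightarrow> 'f"
  where "character_tensor H1 H2 \<alpha> \<beta> p =
    (if p \<in> H1 \<times> H2 then inverse (\<alpha> (fst p)) * inverse (\<beta> (snd p)) else 0)"

definition pre_tensor_grading ::
    "'g monoid \<Rightarrow> 'g set \<Rightarrow> 'g set \<Rightarrow> 'g \<Rightarrow> 'g \<Rightarrow> ('g \<times> 'g \<Rightarrow> 'f::field) set"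
  where "pre_tensor_grading G H1 H2 g d =
    {u \<in> carrier (pre_tensor G H1 H2). \<forall>h1 h2. u (h1, h2) \<noteq> 0 \<longrightarrow> h1 \<otimes>\<^bsub>G\<^esub> g \<otimes>\<^bsub>G\<^esub> h2 = d}"

lemma pre_tensor_simps:
  "carrier (pre_tensor G H1 H2) = {u. \<forall>p. p \<notin> H1 \<times> H2 \<longrightarrow> u p = 0}"
  "\<zero>\<^bsub>pre_tensor G H1 H2\<^esub> = (\<lambda>p. 0)"
  "u \<oplus>\<^bsub>pre_tensor G H1 H2\<^esub> v = (\<lambda>p. u p + v p)"
  "c \<odot>\<^bsub>pre_tensor G H1 H2\<^esub> u = (\<lambda>p. c * u p)"
  "lact (pre_tensor G H1 H2) a u = (\<lambda>(x, h2).
    \<Sum>(h, h1) \<in> {(h, h1) \<in> H1 \<times> H1. h \<otimes>\<^bsub>G\<^esub> h1 = x}. a h * u (h1, h2))"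
  "ract (pre_tensor G H1 H2) u b = (\<lambda>(h1, x).
    \<Sum>(h2, k) \<in> {(h2, k) \<in> H2 \<times> H2. h2 \<otimes>\<^bsub>G\<^esub> k = x}. u (h1, h2) * b k)"
  by (simp_all add: pre_tensor_def)

lemma pre_tensor_outside: "u \<in> carrier (pre_tensor G H1 H2) \<Longrightarrow> p \<notin> H1 \<times> H2 \<Longrightarrow> u p = 0"
  unfolding pre_tensor_simps by blast

lemma pointwise_module_pre_tensor: "pointwise_module (pre_tensor G H1 H2)"
  by unfold_locales (auto simp: pre_tensor_simps)

lemma fourier2_add: "fourier2 H1 H2 (\<lambda>p. u p + v p) \<alpha> \<beta> = fourier2 H1 H2 u \<alpha> \<beta> + fourier2 H1 H2 v \<alpha> \<beta>"
  by (simp add: fourier2_def fourier_add)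

lemma fourier2_smult: "fourier2 H1 H2 (\<lambda>p. c * u p) \<alpha> \<beta> = c * fourier2 H1 H2 u \<alpha> \<beta>"
  by (simp add: fourier2_def fourier_smult)

lemma fourier2_diff: "fourier2 H1 H2 (\<lambda>p. u p - v p) \<alpha> \<beta> = fourier2 H1 H2 u \<alpha> \<beta> - fourier2 H1 H2 v \<alpha> \<beta>"
  using fourier2_add[of H1 H2 u "\<lambda>p. (- 1) * v p"] by (simp only: fourier2_smult) simp

lemma fourier2_sum:
  "fourier2 H1 H2 (\<lambda>p. \<Sum>i\<in>I. u i p) \<alpha> \<beta> = (\<Sum>i\<in>I. fourier2 H1 H2 (u i) \<alpha> \<beta>)"
  by (simp add: fourier2_def fourier_sum)

lemma fourier2_eq_sum: "fourier2 H1 H2 u \<alpha> \<beta> = (\<Sum>h1\<in>H1. \<Sum>h2\<in>H2. u (h1, h2) * \<beta> h2 * \<alpha> h1)"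
  by (simp add: fourier2_def fourier_def sum_distrib_right)

locale subgroup_pair = A: finite_subgroup G H1 + B: finite_subgroup G H2
  for G :: "'g monoid" (structure) and H1 H2
begin

lemma fourier2_pure_tensor:
  fixes v :: "'f::field"
  assumes "x \<in> H1" "y \<in> H2"
  shows "fourier2 H1 H2 (pure_tensor (x, y) v) \<alpha> \<beta> = v * \<alpha> x * \<beta> y"
proof -
  have "fourier2 H1 H2 (pure_tensor (x, y) v) \<alpha> \<beta>
    = (\<Sum>h1\<in>H1. if h1 = x then (\<Sum>h2\<in>H2. if h2 = y then v * \<beta> h2 * \<alpha> h1 else 0) else 0)"
    unfolding fourier2_eq_sum pure_tensor_def
    by (intro sum.cong) (auto intro!: sum.cong sum.neutral)
  then show ?thesis
    using assms by (simp add: A.finite_H B.finite_H)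
qed

lemma pure_tensor_in: "x \<in> H1 \<Longrightarrow> y \<in> H2 \<Longrightarrow> pure_tensor (x, y) v \<in> carrier (pre_tensor G H1 H2)"
  by (auto simp: pre_tensor_simps pure_tensor_def)

lemma lact_pre_tensor_closed:
  assumes "u \<in> carrier (pre_tensor G H1 H2)"
  shows "lact (pre_tensor G H1 H2) a u \<in> carrier (pre_tensor G H1 H2)"
  using assms by (auto simp: pre_tensor_simps intro!: sum.neutral)

lemma ract_pre_tensor_closed:
  assumes "u \<in> carrier (pre_tensor G H1 H2)"
  shows "ract (pre_tensor G H1 H2) u b \<in> carrier (pre_tensor G H1 H2)"
  using assms by (auto simp: pre_tensor_simps intro!: sum.neutral)

text \<open>For a fixed second coordinate the left action is a convolution in the first one, so
  \<open>A.fourier_convolution\<close> applies after transforming the second variable.\<close>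

lemma fourier2_lact:
  assumes "\<alpha> \<in> characters G H1"
  shows "fourier2 H1 H2 (lact (pre_tensor G H1 H2) a u) \<alpha> \<beta> = fourier H1 a \<alpha> * fourier2 H1 H2 u \<alpha> \<beta>"
proof -
  have "fourier2 H1 H2 (lact (pre_tensor G H1 H2) a u) \<alpha> \<beta>
    = fourier H1 (\<lambda>x. \<Sum>(h, h1) \<in> {(h, h1) \<in> H1 \<times> H1. h \<otimes> h1 = x}.
        a h * fourier H2 (\<lambda>h2. u (h1, h2)) \<beta>) \<alpha>"
    unfolding fourier2_def pre_tensor_simps
    by (simp add: fourier_sum case_prod_beta fourier_smult)
  also have "\<dots> = fourier H1 a \<alpha> * fourier2 H1 H2 u \<alpha> \<beta>"
    unfolding fourier2_def by (rule A.fourier_convolution[OF assms])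
  finally show ?thesis .
qed

lemma fourier2_ract:
  assumes "\<beta> \<in> characters G H2"
  shows "fourier2 H1 H2 (ract (pre_tensor G H1 H2) u b) \<alpha> \<beta> = fourier2 H1 H2 u \<alpha> \<beta> * fourier H2 b \<beta>"
proof -
  have "fourier2 H1 H2 (ract (pre_tensor G H1 H2) u b) \<alpha> \<beta>
    = fourier H1 (\<lambda>h1. fourier H2 (\<lambda>x. \<Sum>(h2, k) \<in> {(h2, k) \<in> H2 \<times> H2. h2 \<otimes> k = x}.
        u (h1, h2) * b k) \<beta>) \<alpha>"
    unfolding fourier2_def pre_tensor_simps by simp
  also have "\<dots> = fourier H1 (\<lambda>h1. fourier H2 b \<beta> * fourier H2 (\<lambda>h2. u (h1, h2)) \<beta>) \<alpha>"
    by (subst B.fourier_convolution[OF assms]) (simp add: mult.commute)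
  also have "\<dots> = fourier2 H1 H2 u \<alpha> \<beta> * fourier H2 b \<beta>"
    by (simp add: fourier_smult fourier2_def)
  finally show ?thesis .
qed

lemma fourier2_character_tensor:
  "fourier2 H1 H2 (character_tensor H1 H2 \<gamma> \<delta>) \<alpha> \<beta>
    = (\<Sum>h\<in>H1. inverse (\<gamma> h) * \<alpha> h) * (\<Sum>k\<in>H2. inverse (\<delta> k) * \<beta> k)"
  unfolding fourier2_eq_sum sum_product
  by (intro sum.cong) (auto simp: character_tensor_def)

text \<open>Makes the two pure tensors of a balancing relation homogeneous of the same degree, so
  that degrees survive in the quotient. Commutativity brings \<open>h\<close> and its inverse
  together.\<close>

lemma degree_balanced:
  assumes "h1 \<in> H1" "h2 \<in> H2" "h \<in> H1 \<inter> H2" "g \<in> carrier G"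
  shows "h1 \<otimes> h \<otimes> g \<otimes> (inv h \<otimes> h2) = h1 \<otimes> g \<otimes> h2"
proof -
  have "a \<otimes> k \<otimes> b \<otimes> (l \<otimes> c) = (k \<otimes> l) \<otimes> (a \<otimes> b \<otimes> c)"
    if "a \<in> carrier G" "b \<in> carrier G" "c \<in> carrier G" "k \<in> carrier G" "l \<in> carrier G" for a b c k l
    using that by (simp add: A.m_ac)
  then have "h1 \<otimes> h \<otimes> g \<otimes> (inv h \<otimes> h2) = (h \<otimes> inv h) \<otimes> (h1 \<otimes> g \<otimes> h2)"
    using assms by simp
  then show ?thesis
    using assms by simp
qed

definition degree_component :: "'g \<Rightarrow> 'g \<Rightarrow> ('g \<times> 'g \<Rightarrow> 'f::field) \<Rightarrow> 'g \<times> 'g \<Rightarrow> 'f"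
  where "degree_component g d u p = (if fst p \<otimes> g \<otimes> snd p = d then u p else 0)"

definition degrees :: "'g \<Rightarrow> 'g set"
  where "degrees g = (\<lambda>(h1, h2). h1 \<otimes> g \<otimes> h2) ` (H1 \<times> H2)"

lemma finite_degrees: "finite (degrees g)"
  by (simp add: degrees_def A.finite_H B.finite_H)

lemma homogeneous_projections_pre_tensor:
  assumes g: "g \<in> carrier G"
  shows "homogeneous_projections \<F> (pre_tensor G H1 H2 :: ('f::field, 'g \<Rightarrow> 'f, 'g \<Rightarrow> 'f, 'g \<times> 'g \<Rightarrow> 'f) bimodule)
    G (degrees g) (pre_tensor_grading G H1 H2 g) (degree_component g)"
proof -
  let ?V = "pre_tensor G H1 H2 :: ('f, 'g \<Rightarrow> 'f, 'g \<Rightarrow> 'f, 'g \<times> 'g \<Rightarrow> 'f) bimodule"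
  interpret P: pointwise_module ?V
    by (rule pointwise_module_pre_tensor)
  show ?thesis
  proof (intro homogeneous_projections.intro homogeneous_projections_axioms.intro)
    show "degrees g \<subseteq> carrier G"
      using g by (auto simp: degrees_def)
    show "submodule (pre_tensor_grading G H1 H2 g d) \<F> ?V" for d
      unfolding P.submodule_iff
    proof (intro conjI ballI allI)
      fix u v :: "'g \<times> 'g \<Rightarrow> 'f"
      assume u: "u \<in> pre_tensor_grading G H1 H2 g d" and v: "v \<in> pre_tensor_grading G H1 H2 g d"
      have "u (h1, h2) \<noteq> 0 \<or> v (h1, h2) \<noteq> 0" if "u (h1, h2) + v (h1, h2) \<noteq> 0" for h1 h2
        using that by auto
      with u v show "(\<lambda>p. u p + v p) \<in> pre_tensor_grading G H1 H2 g d"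
        by (fastforce simp: pre_tensor_grading_def pre_tensor_simps)
    qed (auto simp: pre_tensor_grading_def pre_tensor_simps)
    fix u :: "'g \<times> 'g \<Rightarrow> 'f"
    assume u: "u \<in> carrier ?V"
    have "(\<Oplus>\<^bsub>?V\<^esub>d\<in>degrees g. degree_component g d u) = (\<lambda>p. \<Sum>d\<in>degrees g. degree_component g d u p)"
      using u by (intro P.finsum_eq finite_degrees) (auto simp: pre_tensor_simps degree_component_def)
    also have "\<dots> = u"
    proof
      fix p
      show "(\<Sum>d\<in>degrees g. degree_component g d u p) = u p"
      proof (cases "p \<in> H1 \<times> H2")
        case True
        then have "fst p \<otimes> g \<otimes> snd p \<in> degrees g"
          by (force simp: degrees_def)
        then show ?thesis
          by (simp add: degree_component_def finite_degrees)
      qed (auto simp: degree_component_def pre_tensor_outside[OF u] intro!: sum.neutral)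
    qed
    finally show "(\<Oplus>\<^bsub>?V\<^esub>d\<in>degrees g. degree_component g d u) = u" .
  next
    fix d and u :: "'g \<times> 'g \<Rightarrow> 'f"
    assume "d \<notin> degrees g" and u: "u \<in> carrier ?V"
    then have "p \<notin> H1 \<times> H2" if "fst p \<otimes> g \<otimes> snd p = d" for p
      using that by (force simp: degrees_def)
    then show "degree_component g d u = \<zero>\<^bsub>?V\<^esub>"
      using u by (auto simp: degree_component_def pre_tensor_simps fun_eq_iff)
  next
    fix d e and u :: "'g \<times> 'g \<Rightarrow> 'f"
    assume "u \<in> pre_tensor_grading G H1 H2 g e"
    then show "degree_component g d u = (if d = e then u else \<zero>\<^bsub>?V\<^esub>)"
      by (auto simp: degree_component_def pre_tensor_grading_def pre_tensor_simps fun_eq_iff)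
  qed (auto simp: finite_degrees P.is_module pre_tensor_grading_def degree_component_def
      pre_tensor_simps fun_eq_iff split: if_splits)
qed

lemma pre_tensor_grading_act:
  assumes g: "g \<in> carrier G" and h: "h \<in> carrier G" and d: "d \<in> carrier G" and k: "k \<in> carrier G"
    and a: "a \<in> group_algebra_grading H1 h" and u: "u \<in> pre_tensor_grading G H1 H2 g d"
    and b: "b \<in> group_algebra_grading H2 k"
  shows "ract (pre_tensor G H1 H2) (lact (pre_tensor G H1 H2) a u) b
    \<in> pre_tensor_grading G H1 H2 g (h \<otimes> d \<otimes> k)"
proof -
  have u_in: "u \<in> carrier (pre_tensor G H1 H2)"
    using u by (simp add: pre_tensor_grading_def)
  have "x \<otimes> g \<otimes> y = h \<otimes> d \<otimes> k"
    if nz: "ract (pre_tensor G H1 H2) (lact (pre_tensor G H1 H2) a u) b (x, y) \<noteq> 0" for x y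
  proof -
    \<comment> \<open>A nonzero sum has a nonzero summand; its factors reveal the degrees of
      \<open>b\<close>, \<open>a\<close> and \<open>u\<close> in turn.\<close>
    from nz obtain h2 k' where 1: "h2 \<in> H2" "k' \<in> H2" "h2 \<otimes> k' = y"
        "lact (pre_tensor G H1 H2) a u (x, h2) \<noteq> 0" "b k' \<noteq> 0"
      unfolding pre_tensor_simps(6) by (auto elim!: sum.not_neutral_contains_not_neutral)
    from 1(4) obtain h' h1 where 2: "h' \<in> H1" "h1 \<in> H1" "h' \<otimes> h1 = x" "a h' \<noteq> 0" "u (h1, h2) \<noteq> 0"
      unfolding pre_tensor_simps(5) by (auto elim!: sum.not_neutral_contains_not_neutral)
    have "h' = h" "k' = k" "h1 \<otimes> g \<otimes> h2 = d"
      using 1 2 a b u by (auto simp: group_algebra_grading_def pre_tensor_grading_def)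
    then show ?thesis
      using 1 2 g by (auto simp: A.m_assoc)
  qed
  then show ?thesis
    by (simp add: pre_tensor_grading_def lact_pre_tensor_closed ract_pre_tensor_closed u_in)
qed

end

locale split_pair = A: split_subgroup G H1 \<zeta>1 + B: split_subgroup G H2 \<zeta>2
  for G :: "'g monoid" (structure) and H1 H2 and \<zeta>1 \<zeta>2 :: "'f::field"
begin

sublocale subgroup_pair G H1 H2 ..

abbreviation V :: "('f, 'g \<Rightarrow> 'f, 'g \<Rightarrow> 'f, 'g \<times> 'g \<Rightarrow> 'f) bimodule"
  where "V \<equiv> pre_tensor G H1 H2"

sublocale V: pointwise_module V
  by (rule pointwise_module_pre_tensor)

abbreviation dual1 :: "('g \<Rightarrow> 'f) set" where "dual1 \<equiv> characters G H1"
abbreviation dual2 :: "('g \<Rightarrow> 'f) set" where "dual2 \<equiv> characters G H2"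

text \<open>Injectivity is applied one variable at a time: first on \<open>H1\<close> to the partial
  transform at a fixed \<beta>, then on \<open>H2\<close> at a fixed first coordinate.\<close>

lemma fourier2_eqI:
  assumes u: "u \<in> carrier V" and v: "v \<in> carrier V"
    and eq: "\<And>\<alpha> \<beta>. \<alpha> \<in> dual1 \<Longrightarrow> \<beta> \<in> dual2 \<Longrightarrow> fourier2 H1 H2 u \<alpha> \<beta> = fourier2 H1 H2 v \<alpha> \<beta>"
  shows "u = v"
proof
  fix p
  show "u p = v p"
  proof (cases "p \<in> H1 \<times> H2")
    case True
    then obtain x y where p: "p = (x, y)" "x \<in> H1" "y \<in> H2"
      by blast
    have "fourier H2 (\<lambda>h2. u (x, h2)) \<beta> = fourier H2 (\<lambda>h2. v (x, h2)) \<beta>" if "\<beta> \<in> dual2" for \<beta>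
      by (rule A.fourier_eqD[where a = "\<lambda>x. fourier H2 (\<lambda>h2. u (x, h2)) \<beta>" and x = x])
        (use eq that p in \<open>auto simp: fourier2_def\<close>)
    then show ?thesis
      unfolding p(1) by (rule B.fourier_eqD[where a = "\<lambda>y. u (x, y)"]) (use p in auto)
  next
    case False
    then show ?thesis
      by (simp add: pre_tensor_outside[OF u] pre_tensor_outside[OF v])
  qed
qed

text \<open>On coefficients both actions are multiplications by scalars, so the laws, including the
  commutation of the two actions, reduce to those of the field.\<close>

lemma bimodule_pre_tensor: "bimodule \<F> (group_algebra G H1) (group_algebra G H2) V"
  by (intro bimodule.intro bimodule_axioms.intro A.assoc_algebra_group_algebra
      B.assoc_algebra_group_algebra V.is_module; (rule fourier2_eqI)?)
    (auto simp: lact_pre_tensor_closed ract_pre_tensor_closed fourier2_lact fourier2_ract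
      V.add_eq V.smult_eq V.add_in V.smult_in A.fourier_group_algebra B.fourier_group_algebra
      fourier2_add fourier2_smult algebra_simps)

text \<open>Written as a combination of character tensors so that membership in a submodule can be
  checked term by term.\<close>

definition inverse_fourier2 :: "(('g \<Rightarrow> 'f) \<Rightarrow> ('g \<Rightarrow> 'f) \<Rightarrow> 'f) \<Rightarrow> 'g \<times> 'g \<Rightarrow> 'f"
  where "inverse_fourier2 F p = (\<Sum>\<alpha>\<in>dual1. \<Sum>\<beta>\<in>dual2.
    F \<alpha> \<beta> / (of_nat (card H1) * of_nat (card H2)) * character_tensor H1 H2 \<alpha> \<beta> p)"

lemma inverse_fourier2_in: "inverse_fourier2 F \<in> carrier V"
  by (auto simp: pre_tensor_simps inverse_fourier2_def character_tensor_def)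

lemma fourier2_inverse_fourier2:
  assumes "\<alpha> \<in> dual1" "\<beta> \<in> dual2"
  shows "fourier2 H1 H2 (inverse_fourier2 F) \<alpha> \<beta> = F \<alpha> \<beta>"
proof -
  let ?n = "of_nat (card H1) * of_nat (card H2) :: 'f"
  have "fourier2 H1 H2 (inverse_fourier2 F) \<alpha> \<beta>
    = (\<Sum>\<gamma>\<in>dual1. \<Sum>\<delta>\<in>dual2. F \<gamma> \<delta> / ?n * fourier2 H1 H2 (character_tensor H1 H2 \<gamma> \<delta>) \<alpha> \<beta>)"
    unfolding inverse_fourier2_def[abs_def] by (simp only: fourier2_sum fourier2_smult)
  also have "\<dots> = (\<Sum>\<gamma>\<in>dual1. if \<gamma> = \<alpha> then (\<Sum>\<delta>\<in>dual2. if \<delta> = \<beta> then F \<gamma> \<delta> else 0) else 0)"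
    using assms A.of_nat_card_neq_0 B.of_nat_card_neq_0
    by (intro sum.cong)
      (auto simp: fourier2_character_tensor A.character_orthogonality B.character_orthogonality
        intro!: sum.cong)
  also have "\<dots> = F \<alpha> \<beta>"
    using assms by (simp add: A.finite_characters B.finite_characters)
  finally show ?thesis .
qed

end


section \<open>Quotient bimodules\<close>

lemma quotient_bimodule_simps:
  "carrier (quotient_bimodule M W) = a_rcosets\<^bsub>M\<^esub> W"
  "\<zero>\<^bsub>quotient_bimodule M W\<^esub> = W"
  "C \<oplus>\<^bsub>quotient_bimodule M W\<^esub> C' = C <+>\<^bsub>M\<^esub> C'"
  "c \<odot>\<^bsub>quotient_bimodule M W\<^esub> C = W <+>\<^bsub>M\<^esub> ((\<lambda>x. c \<odot>\<^bsub>M\<^esub> x) ` C)"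
  "lact (quotient_bimodule M W) a C = W <+>\<^bsub>M\<^esub> (lact M a ` C)"
  "ract (quotient_bimodule M W) C b = W <+>\<^bsub>M\<^esub> ((\<lambda>x. ract M x b) ` C)"
  by (simp_all add: quotient_bimodule_def)

locale submodule_of_bimodule = module R M for R :: "'f ring" (structure)
    and M :: "('f, 'a, 'b, 'm) bimodule" (structure) +
  fixes W
  assumes submodule_W: "submodule W R M"
begin

lemma additive_subgroup_W: "additive_subgroup W M"
  using submodule_W by (simp add: additive_subgroup_def submodule_def)

sublocale W: abelian_subgroup W M
  by (rule abelian_subgroupI3) (rule additive_subgroup_W M.abelian_group_axioms)+

lemma coset_self: "u \<in> carrier M \<Longrightarrow> u \<in> W +>\<^bsub>M\<^esub> u"
  by (rule W.a_rcos_self)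

lemma mem_coset_iff: "x \<in> W +>\<^bsub>M\<^esub> u \<longleftrightarrow> (\<exists>w\<in>W. x = w \<oplus>\<^bsub>M\<^esub> u)"
  by (auto simp: a_r_coset_def')

lemma coset_eqI:
  assumes "u \<in> carrier M" "v \<in> carrier M" "u \<ominus>\<^bsub>M\<^esub> v \<in> W"
  shows "W +>\<^bsub>M\<^esub> u = W +>\<^bsub>M\<^esub> v"
proof -
  have "u = (u \<ominus>\<^bsub>M\<^esub> v) \<oplus>\<^bsub>M\<^esub> v"
    using assms by (simp add: a_minus_def M.a_assoc M.l_neg)
  then have "u \<in> W +>\<^bsub>M\<^esub> v"
    using assms(3) mem_coset_iff by blast
  then show ?thesis
    using assms W.a_repr_independence' by metis
qed

text \<open>The common core of scalar multiplication, both actions and the homogeneous projections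
  on the quotient: all of them are additive maps preserving \<open>W\<close>.\<close>

lemma coset_map:
  assumes closed: "\<And>x. x \<in> carrier M \<Longrightarrow> \<phi> x \<in> carrier M"
    and add: "\<And>x y. x \<in> carrier M \<Longrightarrow> y \<in> carrier M \<Longrightarrow> \<phi> (x \<oplus>\<^bsub>M\<^esub> y) = \<phi> x \<oplus>\<^bsub>M\<^esub> \<phi> y"
    and W: "\<And>x. x \<in> W \<Longrightarrow> \<phi> x \<in> W" and u: "u \<in> carrier M"
  shows "W <+>\<^bsub>M\<^esub> (\<phi> ` (W +>\<^bsub>M\<^esub> u)) = W +>\<^bsub>M\<^esub> \<phi> u"
proof
  show "W <+>\<^bsub>M\<^esub> (\<phi> ` (W +>\<^bsub>M\<^esub> u)) \<subseteq> W +>\<^bsub>M\<^esub> \<phi> u"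
  proof
    fix x assume "x \<in> W <+>\<^bsub>M\<^esub> (\<phi> ` (W +>\<^bsub>M\<^esub> u))"
    then obtain w w' where w: "w \<in> W" "w' \<in> W" "x = w \<oplus>\<^bsub>M\<^esub> \<phi> (w' \<oplus>\<^bsub>M\<^esub> u)"
      by (auto simp: set_add_def' a_r_coset_def')
    then have "x = (w \<oplus>\<^bsub>M\<^esub> \<phi> w') \<oplus>\<^bsub>M\<^esub> \<phi> u"
      using u by (simp add: add closed M.a_assoc)
    then show "x \<in> W +>\<^bsub>M\<^esub> \<phi> u"
      unfolding mem_coset_iff using w W by blast
  qed
  show "W +>\<^bsub>M\<^esub> \<phi> u \<subseteq> W <+>\<^bsub>M\<^esub> (\<phi> ` (W +>\<^bsub>M\<^esub> u))"
  proof
    fix x assume "x \<in> W +>\<^bsub>M\<^esub> \<phi> u"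
    then obtain w where "w \<in> W" "x = w \<oplus>\<^bsub>M\<^esub> \<phi> u"
      by (auto simp: mem_coset_iff)
    then show "x \<in> W <+>\<^bsub>M\<^esub> (\<phi> ` (W +>\<^bsub>M\<^esub> u))"
      using coset_self[OF u] unfolding set_add_def' by blast
  qed
qed

lemma carrier_quotient: "carrier (quotient_bimodule M W) = (\<lambda>u. W +>\<^bsub>M\<^esub> u) ` carrier M"
  by (auto simp: quotient_bimodule_simps A_RCOSETS_def')

lemma quotient_smult:
  "c \<in> carrier R \<Longrightarrow> u \<in> carrier M \<Longrightarrow> c \<odot>\<^bsub>quotient_bimodule M W\<^esub> (W +>\<^bsub>M\<^esub> u) = W +>\<^bsub>M\<^esub> (c \<odot>\<^bsub>M\<^esub> u)"
  unfolding quotient_bimodule_simps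
  by (rule coset_map) (auto simp: smult_r_distr intro: submoduleE(4)[OF submodule_W])

sublocale quotient: linear_surjection R M "quotient_bimodule M W" "\<lambda>u. W +>\<^bsub>M\<^esub> u"
proof
  show "W +>\<^bsub>M\<^esub> (x \<oplus>\<^bsub>M\<^esub> y) = (W +>\<^bsub>M\<^esub> x) \<oplus>\<^bsub>quotient_bimodule M W\<^esub> (W +>\<^bsub>M\<^esub> y)"
    if "x \<in> carrier M" "y \<in> carrier M" for x y
    using that by (simp add: quotient_bimodule_simps W.a_rcos_sum)
  show "W +>\<^bsub>M\<^esub> \<zero>\<^bsub>M\<^esub> = \<zero>\<^bsub>quotient_bimodule M W\<^esub>"
    unfolding quotient_bimodule_simps
    by (rule M.a_coset_add_zero) (rule submoduleE(1)[OF submodule_W])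
qed (simp_all add: carrier_quotient quotient_smult)

text \<open>Stability of \<open>W\<close> under the projections says that \<open>W\<close> is a
  graded submodule.\<close>

lemma homogeneous_projections_quotient:
  assumes "homogeneous_projections R M G D \<Gamma> \<pi>"
    and W: "\<And>g x. g \<in> carrier G \<Longrightarrow> x \<in> W \<Longrightarrow> \<pi> g x \<in> W"
  shows "homogeneous_projections R (quotient_bimodule M W) G D
    (\<lambda>g. (\<lambda>u. W +>\<^bsub>M\<^esub> u) ` \<Gamma> g) (\<lambda>g C. W <+>\<^bsub>M\<^esub> (\<pi> g ` C))"
proof -
  interpret P: homogeneous_projections R M G D \<Gamma> \<pi> by fact
  show ?thesis
    by (intro quotient.homogeneous_projections_image[OF assms(1)] coset_map)
      (auto simp: P.\<pi>_closed P.\<pi>_add W)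
qed

end

locale subbimodule = bimodule R A B M + submodule_of_bimodule R M W
  for R :: "'f ring" and A :: "('f, 'a) module" and B :: "('f, 'b) module"
    and M :: "('f, 'a, 'b, 'm) bimodule" and W +
  assumes lact_W: "\<And>a x. a \<in> carrier A \<Longrightarrow> x \<in> W \<Longrightarrow> lact M a x \<in> W"
    and ract_W: "\<And>b x. b \<in> carrier B \<Longrightarrow> x \<in> W \<Longrightarrow> ract M x b \<in> W"
begin

lemma quotient_lact:
  assumes "a \<in> carrier A" "u \<in> carrier M"
  shows "lact (quotient_bimodule M W) a (W +>\<^bsub>M\<^esub> u) = W +>\<^bsub>M\<^esub> lact M a u"
  unfolding quotient_bimodule_simps
  by (rule coset_map) (use assms in \<open>auto simp: lact_closed lact_add_right lact_W\<close>)

lemma quotient_ract: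
  assumes "b \<in> carrier B" "u \<in> carrier M"
  shows "ract (quotient_bimodule M W) (W +>\<^bsub>M\<^esub> u) b = W +>\<^bsub>M\<^esub> ract M u b"
  unfolding quotient_bimodule_simps
  by (rule coset_map) (use assms in \<open>auto simp: ract_closed ract_add_left ract_W\<close>)

lemma bimodule_quotient: "bimodule R A B (quotient_bimodule M W)"
  by (rule bimodule_image[OF bimodule_axioms quotient.linear_surjection_axioms])
    (simp_all add: quotient_lact quotient_ract)

end

section \<open>Direct sums of bimodules\<close>

lemma direct_sum_bimodule_simps:
  "carrier (direct_sum_bimodule I M) = (\<Pi>\<^sub>E i\<in>I. carrier (M i))"
  "\<zero>\<^bsub>direct_sum_bimodule I M\<^esub> = (\<lambda>i\<in>I. \<zero>\<^bsub>M i\<^esub>)"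
  "x \<oplus>\<^bsub>direct_sum_bimodule I M\<^esub> y = (\<lambda>i\<in>I. x i \<oplus>\<^bsub>M i\<^esub> y i)"
  "c \<odot>\<^bsub>direct_sum_bimodule I M\<^esub> x = (\<lambda>i\<in>I. c \<odot>\<^bsub>M i\<^esub> x i)"
  "lact (direct_sum_bimodule I M) a x = (\<lambda>i\<in>I. lact (M i) a (x i))"
  "ract (direct_sum_bimodule I M) x b = (\<lambda>i\<in>I. ract (M i) (x i) b)"
  by (simp_all add: direct_sum_bimodule_def)

locale bimodule_family = A: assoc_algebra R A + B: assoc_algebra R B
  for R :: "'f ring" and A :: "('f, 'a) module" and B :: "('f, 'b) module" +
  fixes I :: "'i set" and M :: "'i \<Rightarrow> ('f, 'a, 'b, 'm) bimodule"
  assumes bimodule: "i \<in> I \<Longrightarrow> bimodule R A B (M i)"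
begin

abbreviation S where "S \<equiv> direct_sum_bimodule I M"

lemma direct_sum_eqI:
  "x \<in> carrier S \<Longrightarrow> y \<in> carrier S \<Longrightarrow> (\<And>i. i \<in> I \<Longrightarrow> x i = y i) \<Longrightarrow> x = y"
  unfolding direct_sum_bimodule_simps by (rule PiE_ext)

lemma abelian_group_component: "i \<in> I \<Longrightarrow> abelian_group (M i)"
  by (meson bimodule bimodule.axioms(3) module.axioms(2))

lemma module_component: "i \<in> I \<Longrightarrow> module R (M i)"
  by (meson bimodule bimodule.axioms(3))

lemma direct_sum_apply:
  assumes "i \<in> I"
  shows "\<zero>\<^bsub>S\<^esub> i = \<zero>\<^bsub>M i\<^esub>" "(x \<oplus>\<^bsub>S\<^esub> y) i = x i \<oplus>\<^bsub>M i\<^esub> y i" "(c \<odot>\<^bsub>S\<^esub> x) i = c \<odot>\<^bsub>M i\<^esub> x i"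
    "lact S a x i = lact (M i) a (x i)" "ract S x b i = ract (M i) (x i) b"
  using assms by (simp_all add: direct_sum_bimodule_simps)

lemma direct_sum_component: "i \<in> I \<Longrightarrow> x \<in> carrier S \<Longrightarrow> x i \<in> carrier (M i)"
  by (auto simp: direct_sum_bimodule_simps)

lemma direct_sum_closed:
  "\<zero>\<^bsub>S\<^esub> \<in> carrier S"
  "x \<in> carrier S \<Longrightarrow> y \<in> carrier S \<Longrightarrow> x \<oplus>\<^bsub>S\<^esub> y \<in> carrier S"
  "c \<in> carrier R \<Longrightarrow> x \<in> carrier S \<Longrightarrow> c \<odot>\<^bsub>S\<^esub> x \<in> carrier S"
  "a \<in> carrier A \<Longrightarrow> x \<in> carrier S \<Longrightarrow> lact S a x \<in> carrier S"
  "b \<in> carrier B \<Longrightarrow> x \<in> carrier S \<Longrightarrow> ract S x b \<in> carrier S"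
  by (auto simp: direct_sum_bimodule_simps PiE_iff abelian_groupE(1,2) abelian_group_component
      module.smult_closed[OF module_component] bimodule.lact_closed[OF bimodule]
      bimodule.ract_closed[OF bimodule])

lemma module_direct_sum: "module R S"
proof (rule moduleI)
  show "abelian_group S"
  proof (rule abelian_groupI)
    fix x assume x: "x \<in> carrier S"
    have inv: "\<ominus>\<^bsub>M i\<^esub> x i \<in> carrier (M i)" "\<ominus>\<^bsub>M i\<^esub> x i \<oplus>\<^bsub>M i\<^esub> x i = \<zero>\<^bsub>M i\<^esub>" if "i \<in> I" for i
      using abelian_group.a_inv_closed[OF abelian_group_component]
        abelian_group.l_neg[OF abelian_group_component] direct_sum_component x that by blast+
    then have y: "(\<lambda>i\<in>I. \<ominus>\<^bsub>M i\<^esub> x i) \<in> carrier S"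
      by (auto simp: direct_sum_bimodule_simps)
    moreover have "(\<lambda>i\<in>I. \<ominus>\<^bsub>M i\<^esub> x i) \<oplus>\<^bsub>S\<^esub> x = \<zero>\<^bsub>S\<^esub>"
      by (rule direct_sum_eqI) (use x y inv in \<open>auto simp: direct_sum_closed direct_sum_apply\<close>)
    ultimately show "\<exists>y\<in>carrier S. y \<oplus>\<^bsub>S\<^esub> x = \<zero>\<^bsub>S\<^esub>"
      by blast
  next
    fix x y z assume xyz: "x \<in> carrier S" "y \<in> carrier S" "z \<in> carrier S"
    show "x \<oplus>\<^bsub>S\<^esub> y \<oplus>\<^bsub>S\<^esub> z = x \<oplus>\<^bsub>S\<^esub> (y \<oplus>\<^bsub>S\<^esub> z)"
      by (rule direct_sum_eqI) (use xyz in \<open>auto simp: direct_sum_closed direct_sum_apply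
        direct_sum_component abelian_groupE(3)[OF abelian_group_component]\<close>)
  next
    fix x y assume xy: "x \<in> carrier S" "y \<in> carrier S"
    show "x \<oplus>\<^bsub>S\<^esub> y = y \<oplus>\<^bsub>S\<^esub> x"
      by (rule direct_sum_eqI) (use xy in \<open>auto simp: direct_sum_closed direct_sum_apply
        direct_sum_component abelian_groupE(4)[OF abelian_group_component]\<close>)
  next
    fix x assume x: "x \<in> carrier S"
    show "\<zero>\<^bsub>S\<^esub> \<oplus>\<^bsub>S\<^esub> x = x"
      by (rule direct_sum_eqI) (use x in \<open>auto simp: direct_sum_closed direct_sum_apply
        direct_sum_component abelian_groupE(5)[OF abelian_group_component]\<close>)
  qed (auto simp: direct_sum_closed)
qed (rule A.cring_axioms | (rule direct_sum_eqI)?; auto simp: direct_sum_closed direct_sum_apply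
    direct_sum_component module.smult_l_distr[OF module_component]
    module.smult_r_distr[OF module_component] module.smult_assoc1[OF module_component]
    module.smult_one[OF module_component])+

lemma bimodule_direct_sum: "bimodule R A B S"
  by (intro bimodule.intro bimodule_axioms.intro A.assoc_algebra_axioms B.assoc_algebra_axioms
      module_direct_sum; (rule direct_sum_eqI)?)
    (auto simp: direct_sum_closed direct_sum_apply direct_sum_component
      bimodule.lact_add_left[OF bimodule] bimodule.lact_add_right[OF bimodule]
      bimodule.lact_smult_left[OF bimodule] bimodule.lact_smult_right[OF bimodule]
      bimodule.lact_mult[OF bimodule] bimodule.lact_one[OF bimodule]
      bimodule.ract_add_left[OF bimodule] bimodule.ract_add_right[OF bimodule]
      bimodule.ract_smult_left[OF bimodule] bimodule.ract_smult_right[OF bimodule]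
      bimodule.ract_mult[OF bimodule] bimodule.ract_one[OF bimodule]
      bimodule.lact_ract[OF bimodule])

lemma homogeneous_projections_direct_sum:
  assumes D: "finite D" "D \<subseteq> carrier G"
    and hp: "\<And>i. i \<in> I \<Longrightarrow> homogeneous_projections R (M i) G D (\<Gamma> i) (\<pi> i)"
  shows "homogeneous_projections R S G D (direct_sum_grading I \<Gamma>) (\<lambda>g x. \<lambda>i\<in>I. \<pi> i g (x i))"
proof -
  interpret S: module R S by (rule module_direct_sum)
  have closed: "(\<lambda>i\<in>I. \<pi> i g (x i)) \<in> carrier S" if "g \<in> carrier G" "x \<in> carrier S" for g x
    using that homogeneous_projections.\<pi>_closed[OF hp]
    by (auto simp: direct_sum_bimodule_simps PiE_iff)
  have \<Gamma>_sub: "direct_sum_grading I \<Gamma> g \<subseteq> carrier S" if "g \<in> carrier G" for g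
    using that homogeneous_projections.\<Gamma>_closed[OF hp]
    by (auto simp: direct_sum_bimodule_simps direct_sum_grading_def PiE_iff)
  show ?thesis
  proof (intro homogeneous_projections.intro homogeneous_projections_axioms.intro)
    show "submodule (direct_sum_grading I \<Gamma> g) R S" if g: "g \<in> carrier G" for g
    proof -
      note sub = homogeneous_projections.submodule_\<Gamma>[OF hp g]
      show ?thesis
      proof (rule S.submoduleI)
        show "\<zero>\<^bsub>S\<^esub> \<in> direct_sum_grading I \<Gamma> g"
          using subgroup.one_closed[OF submodule.axioms(1)[OF sub]]
          by (auto simp: direct_sum_grading_def direct_sum_bimodule_simps)
        show add: "x \<oplus>\<^bsub>S\<^esub> y \<in> direct_sum_grading I \<Gamma> g"
          if "x \<in> direct_sum_grading I \<Gamma> g" "y \<in> direct_sum_grading I \<Gamma> g" for x y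
          using that module.submoduleE(5)[OF module_component sub]
          by (auto simp: direct_sum_grading_def direct_sum_bimodule_simps PiE_iff)
        show smult: "c \<odot>\<^bsub>S\<^esub> x \<in> direct_sum_grading I \<Gamma> g"
          if "c \<in> carrier R" "x \<in> direct_sum_grading I \<Gamma> g" for c x
          using that module.submoduleE(4)[OF module_component sub]
          by (auto simp: direct_sum_grading_def direct_sum_bimodule_simps PiE_iff)
        show "\<ominus>\<^bsub>S\<^esub> x \<in> direct_sum_grading I \<Gamma> g" if x: "x \<in> direct_sum_grading I \<Gamma> g" for x
        proof -
          \<comment> \<open>The negative is reached as the multiple by -1, so closure under scalars
            suffices.\<close>
          have xS: "x \<in> carrier S"
            using x \<Gamma>_sub g by blast
          have "(\<ominus>\<^bsub>R\<^esub> \<one>\<^bsub>R\<^esub>) \<odot>\<^bsub>S\<^esub> x \<in> direct_sum_grading I \<Gamma> g"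
            using x by (intro smult) auto
          then show ?thesis
            using xS by (simp add: S.smult_l_minus)
        qed
      qed (rule \<Gamma>_sub[OF g])
    qed
    show "(\<Oplus>\<^bsub>S\<^esub>g\<in>D. (\<lambda>i\<in>I. \<pi> i g (x i))) = x" if x: "x \<in> carrier S" for x
    proof (rule direct_sum_eqI)
      show "(\<Oplus>\<^bsub>S\<^esub>g\<in>D. (\<lambda>i\<in>I. \<pi> i g (x i))) \<in> carrier S"
        using x D(2) by (intro S.M.finsum_closed) (auto intro!: closed)
      fix i assume i: "i \<in> I"
      then have "(\<Oplus>\<^bsub>S\<^esub>g\<in>D. (\<lambda>i\<in>I. \<pi> i g (x i))) i = (\<Oplus>\<^bsub>M i\<^esub>g\<in>D. (\<lambda>i\<in>I. \<pi> i g (x i)) i)"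
        using x D(2)
        by (intro finsum_additive[where \<phi> = "\<lambda>x. x i"])
          (auto simp: direct_sum_apply direct_sum_component S.abelian_monoid_axioms closed
            abelian_group.axioms(1)[OF abelian_group_component])
      then show "(\<Oplus>\<^bsub>S\<^esub>g\<in>D. (\<lambda>i\<in>I. \<pi> i g (x i))) i = x i"
        using i x by (simp add: homogeneous_projections.\<pi>_sum[OF hp] direct_sum_component)
    qed (rule x)
    show "(\<lambda>i\<in>I. \<pi> i g (x i)) \<in> direct_sum_grading I \<Gamma> g" if "g \<in> carrier G" "x \<in> carrier S" for g x
      using that homogeneous_projections.\<pi>_in[OF hp]
      by (auto simp: direct_sum_bimodule_simps direct_sum_grading_def PiE_iff)
    show "(\<lambda>i\<in>I. \<pi> i g ((x \<oplus>\<^bsub>S\<^esub> y) i)) = (\<lambda>i\<in>I. \<pi> i g (x i)) \<oplus>\<^bsub>S\<^esub> (\<lambda>i\<in>I. \<pi> i g (y i))"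
      if "g \<in> carrier G" "x \<in> carrier S" "y \<in> carrier S" for g x y
      using that by (intro direct_sum_eqI closed direct_sum_closed)
        (auto simp: direct_sum_apply direct_sum_component homogeneous_projections.\<pi>_add[OF hp])
    show "(\<lambda>i\<in>I. \<pi> i g (x i)) = (if g = h then x else \<zero>\<^bsub>S\<^esub>)"
      if "g \<in> carrier G" "h \<in> carrier G" "x \<in> direct_sum_grading I \<Gamma> h" for g h x
    proof -
      have x: "x \<in> carrier S" "\<And>i. i \<in> I \<Longrightarrow> x i \<in> \<Gamma> i h"
        using that \<Gamma>_sub by (auto simp: direct_sum_grading_def)
      show ?thesis
        using that x by (intro direct_sum_eqI closed)
          (auto simp: direct_sum_apply direct_sum_closed homogeneous_projections.\<pi>_\<Gamma>[OF hp])
    qed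
    show "(\<lambda>i\<in>I. \<pi> i g (x i)) = \<zero>\<^bsub>S\<^esub>" if "g \<in> carrier G" "g \<notin> D" "x \<in> carrier S" for g x
      using that by (intro direct_sum_eqI closed)
        (auto simp: direct_sum_apply direct_sum_closed direct_sum_component
          homogeneous_projections.\<pi>_outside[OF hp])
  qed (rule module_direct_sum D)+
qed

end


section \<open>The bimodule of a character\<close>

lemma submodule_span_le: "submodule W R V \<Longrightarrow> S \<subseteq> W \<Longrightarrow> submodule_span R V S \<subseteq> W"
  by (auto simp: submodule_span_def)

lemma subset_submodule_span: "S \<subseteq> submodule_span R V S"
  by (auto simp: submodule_span_def)

text \<open>The carrier itself is one of the intersected submodules, so the span stays inside it;
  the closure properties hold in any intersection.\<close>

lemma (in pointwise_module) submodule_submodule_span: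
  assumes "S \<subseteq> carrier V"
  shows "submodule (submodule_span \<F> V S) \<F> V"
proof -
  have "submodule_span \<F> V S \<subseteq> carrier V"
    using carrier_is_submodule assms by (rule submodule_span_le)
  then show ?thesis
    unfolding submodule_iff by (auto simp: submodule_span_def submodule_iff)
qed

section \<open>The balancing submodule in Fourier coordinates\<close>

context split_pair
begin

text \<open>The condition comes from the relation hm = \<chi>(h)mh: on the component of (\<alpha>,
  \<beta>) the element h acts by \<alpha> h from the left and by \<beta> h from the right.\<close>

definition compatible :: "('g \<Rightarrow> 'f) \<Rightarrow> ('g \<Rightarrow> 'f) \<Rightarrow> ('g \<Rightarrow> 'f) \<Rightarrow> bool"
  where "compatible \<chi> \<alpha> \<beta> \<longleftrightarrow> (\<forall>h\<in>H1 \<inter> H2. \<alpha> h = \<chi> h * \<beta> h)"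

abbreviation balancing :: "('g \<Rightarrow> 'f) \<Rightarrow> ('g \<times> 'g \<Rightarrow> 'f) set"
  where "balancing \<chi> \<equiv> submodule_span \<F> V (balancing_relations G H1 H2 \<chi>)"

lemma balancing_relations_eq:
  fixes \<chi> :: "'g \<Rightarrow> 'f"
  shows "balancing_relations G H1 H2 \<chi> =
    {\<lambda>p. pure_tensor (h1 \<otimes> h, inv h \<otimes> h2) v p - pure_tensor (h1, h2) (\<chi> h * v) p
      | h1 h2 h v. h1 \<in> H1 \<and> h2 \<in> H2 \<and> h \<in> H1 \<inter> H2}"
proof -
  have *: "pure_tensor (h1 \<otimes> h, inv h \<otimes> h2) v \<ominus>\<^bsub>V\<^esub> pure_tensor (h1, h2) (\<chi> h * v)
    = (\<lambda>p. pure_tensor (h1 \<otimes> h, inv h \<otimes> h2) v p - pure_tensor (h1, h2) (\<chi> h * v) p)"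
    if "h1 \<in> H1" "h2 \<in> H2" for h1 h2 h v
    using that by (simp add: V.a_minus_eq pure_tensor_in)
  show ?thesis
    unfolding balancing_relations_def by (intro Collect_cong iff_exI rev_conj_cong refl) (simp add: *)
qed

lemma balancing_relations_closed: "balancing_relations G H1 H2 (\<chi> :: 'g \<Rightarrow> 'f) \<subseteq> carrier V"
proof
  fix r
  assume "r \<in> balancing_relations G H1 H2 \<chi>"
  then obtain h1 h2 h v where *: "h1 \<in> H1" "h2 \<in> H2" "h \<in> H1" "h \<in> H2"
    "r = (\<lambda>p. pure_tensor (h1 \<otimes> h, inv h \<otimes> h2) v p - pure_tensor (h1, h2) (\<chi> h * v) p)"
    by (auto simp: balancing_relations_eq)
  then show "r \<in> carrier V"
    using V.minus_closed[OF pure_tensor_in[of "h1 \<otimes> h" "inv h \<otimes> h2" v] pure_tensor_in[of h1 h2 "\<chi> h * v"]]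
    by (simp add: V.a_minus_eq pure_tensor_in)
qed

lemma submodule_balancing: "submodule (balancing \<chi>) \<F> V"
  by (rule V.submodule_submodule_span[OF balancing_relations_closed])

lemma balancing_zero: "(\<lambda>p. 0) \<in> balancing \<chi>"
  and balancing_add: "u \<in> balancing \<chi> \<Longrightarrow> v \<in> balancing \<chi> \<Longrightarrow> (\<lambda>p. u p + v p) \<in> balancing \<chi>"
  and balancing_smult: "u \<in> balancing \<chi> \<Longrightarrow> (\<lambda>p. c * u p) \<in> balancing \<chi>"
  using submodule_balancing[of \<chi>] unfolding V.submodule_iff by simp_all

lemma balancing_relations_subset: "r \<in> balancing_relations G H1 H2 \<chi> \<Longrightarrow> r \<in> balancing \<chi>"
  by (rule subsetD[OF subset_submodule_span])

text \<open>Summing the relations over all \<open>p\<close> with the values of the tensor of characters as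
  coefficients gives a multiple of that tensor, with factor \<open>\<alpha> h / \<beta> h - \<chi> h\<close>.\<close>

lemma character_tensor_in_balancing:
  assumes \<alpha>: "\<alpha> \<in> dual1" and \<beta>: "\<beta> \<in> dual2" and "\<not> compatible \<chi> \<alpha> \<beta>"
  shows "character_tensor H1 H2 \<alpha> \<beta> \<in> balancing \<chi>"
proof -
  let ?E = "character_tensor H1 H2 \<alpha> \<beta>"
  obtain h where h: "h \<in> H1" "h \<in> H2" and neq: "\<alpha> h \<noteq> \<chi> h * \<beta> h"
    using assms(3) by (auto simp: compatible_def)
  define c where "c = \<alpha> h * inverse (\<beta> h) - \<chi> h"
  have c: "c \<noteq> 0"
    using neq characters_neq_0[OF \<beta> h(2)] by (auto simp: c_def field_simps)
  \<comment> \<open>\<open>rel q\<close> is the balancing relation based at \<open>q\<close>, with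
    the value of the character tensor at \<open>q\<close> as its scalar \<open>v\<close>.\<close>
  define rel where "rel q p = pure_tensor (fst q \<otimes> h, inv h \<otimes> snd q) (?E q) p
    - pure_tensor (fst q, snd q) (\<chi> h * ?E q) p" for q p
  have "(\<lambda>p. \<Sum>q\<in>H1 \<times> H2. rel q p) \<in> balancing \<chi>"
  proof (rule V.submodule_sum[OF submodule_balancing])
    fix q assume q: "q \<in> H1 \<times> H2"
    have "rel q \<in> balancing_relations G H1 H2 \<chi>"
      unfolding balancing_relations_eq rel_def[abs_def] using h q
      by (intro CollectI exI[of _ "fst q"] exI[of _ "snd q"] exI[of _ h] exI[of _ "?E q"]) auto
    then show "rel q \<in> balancing \<chi>"
      by (rule balancing_relations_subset)
  qed (simp add: A.finite_H B.finite_H)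
  moreover have "(\<Sum>q\<in>H1 \<times> H2. rel q p) = c * ?E p" for p
  proof (cases "p \<in> H1 \<times> H2")
    case True
    then obtain x y where p: "p = (x, y)" "x \<in> H1" "y \<in> H2"
      by blast
    \<comment> \<open>The only \<open>q\<close> whose shifted tensor lands on \<open>p\<close>. So
      the sum of the relations at \<open>p\<close> compares the values of \<open>?E\<close> at two
      points, which differ by the factor \<open>\<alpha> h * inverse (\<beta> h)\<close>.\<close>
    let ?p' = "(x \<otimes> inv h, h \<otimes> y)"
    have "(q1 \<otimes> h = x \<and> inv h \<otimes> q2 = y) = (q1 = x \<otimes> inv h \<and> q2 = h \<otimes> y)"
      if "q1 \<in> H1" "q2 \<in> H2" for q1 q2
    proof -
      have "q1 = x \<otimes> inv h \<longleftrightarrow> x = q1 \<otimes> h"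
        by (rule A.inv_solve_right) (use that p h in simp_all)
      moreover have "y = inv h \<otimes> q2 \<longleftrightarrow> q2 = h \<otimes> y"
        by (rule A.inv_solve_left) (use that p h in simp_all)
      ultimately show ?thesis
        by metis
    qed
    then have p_eq: "p = (fst q \<otimes> h, inv h \<otimes> snd q) \<longleftrightarrow> q = ?p'" if "q \<in> H1 \<times> H2" for q
      using that unfolding p(1) by (metis mem_Times_iff prod.collapse prod.inject)
    have "rel q p = (if q = ?p' then ?E ?p' else 0) - (if q = p then \<chi> h * ?E p else 0)"
      if "q \<in> H1 \<times> H2" for q
      unfolding rel_def pure_tensor_def p_eq[OF that] prod.collapse by auto
    then have "(\<Sum>q\<in>H1 \<times> H2. rel q p)
      = (\<Sum>q\<in>H1 \<times> H2. (if q = ?p' then ?E ?p' else 0) - (if q = p then \<chi> h * ?E p else 0))"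
      by (intro sum.cong) auto
    also have "\<dots> = ?E ?p' - \<chi> h * ?E p"
      using p h by (simp add: sum_subtractf A.finite_H B.finite_H)
    also have "?E ?p' = \<alpha> h * inverse (\<beta> h) * ?E p"
      using p h \<alpha> \<beta>
      by (simp add: character_tensor_def characters_mult A.characters_inv inverse_mult_distrib)
    finally show ?thesis
      by (simp add: c_def algebra_simps)
  next
    case False
    then have "rel q p = 0" if "q \<in> H1 \<times> H2" for q
      using that h by (auto simp: rel_def pure_tensor_def)
    then show ?thesis
      using False by (simp add: character_tensor_def)
  qed
  ultimately have "(\<lambda>p. c * ?E p) \<in> balancing \<chi>"
    by simp
  then have "(\<lambda>p. inverse c * (c * ?E p)) \<in> balancing \<chi>"
    by (rule balancing_smult)
  then show ?thesis
    using c by (simp add: mult.assoc[symmetric])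
qed

text \<open>A relation has zero coefficient at a compatible pair, because moving h across
  contributes \<alpha> h / \<beta> h = \<chi> h. Conversely, an element whose compatible
  coefficients vanish expands into character tensors of incompatible pairs, and these lie in the
  span.\<close>

lemma balancing_eq:
  "balancing \<chi> = {u \<in> carrier V. \<forall>\<alpha>\<in>dual1. \<forall>\<beta>\<in>dual2. compatible \<chi> \<alpha> \<beta> \<longrightarrow> fourier2 H1 H2 u \<alpha> \<beta> = 0}"
    (is "_ = ?K")
proof
  show "balancing \<chi> \<subseteq> ?K"
  proof (rule submodule_span_le)
    show "submodule ?K \<F> V"
      unfolding V.submodule_iff
      by (auto simp: V.zero_in V.add_in V.smult_in fourier2_add fourier2_smult)
        (simp add: fourier2_eq_sum)
    show "balancing_relations G H1 H2 \<chi> \<subseteq> ?K"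
    proof
      fix r
      assume r: "r \<in> balancing_relations G H1 H2 \<chi>"
      then obtain h1 h2 h v where *: "h1 \<in> H1" "h2 \<in> H2" "h \<in> H1" "h \<in> H2"
        "r = (\<lambda>p. pure_tensor (h1 \<otimes> h, inv h \<otimes> h2) v p - pure_tensor (h1, h2) (\<chi> h * v) p)"
        by (auto simp: balancing_relations_eq)
      have "fourier2 H1 H2 r \<alpha> \<beta> = 0" if "\<alpha> \<in> dual1" "\<beta> \<in> dual2" "compatible \<chi> \<alpha> \<beta>" for \<alpha> \<beta>
      proof -
        have "\<alpha> h = \<chi> h * \<beta> h" "\<beta> h \<noteq> 0"
          using that * characters_neq_0[of \<beta> G H2 h] by (auto simp: compatible_def)
        then show ?thesis
          using that *(1-4) unfolding *(5)
          by (simp add: fourier2_diff fourier2_pure_tensor characters_mult B.characters_inv)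
      qed
      then show "r \<in> ?K"
        using r balancing_relations_closed by blast
    qed
  qed
  show "?K \<subseteq> balancing \<chi>"
  proof
    fix u
    assume u: "u \<in> ?K"
    \<comment> \<open>The expansion of \<open>u\<close> in character tensors, justified by
      injectivity of the double transform.\<close>
    have "u = inverse_fourier2 (fourier2 H1 H2 u)"
      using u by (intro fourier2_eqI inverse_fourier2_in) (auto simp: fourier2_inverse_fourier2)
    also have "\<dots> \<in> balancing \<chi>"
      unfolding inverse_fourier2_def[abs_def]
    proof (intro V.submodule_sum submodule_balancing A.finite_characters B.finite_characters)
      fix \<alpha> \<beta> assume \<alpha>\<beta>: "\<alpha> \<in> dual1" "\<beta> \<in> dual2"
      let ?c = "fourier2 H1 H2 u \<alpha> \<beta> / (of_nat (card H1) * of_nat (card H2))"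
      show "(\<lambda>p. ?c * character_tensor H1 H2 \<alpha> \<beta> p) \<in> balancing \<chi>"
      proof (cases "compatible \<chi> \<alpha> \<beta>")
        case True
        then have "?c = 0"
          using u \<alpha>\<beta> by simp
        then show ?thesis
          by (simp only: balancing_zero mult_zero_left)
      next
        case False
        then show ?thesis
          by (intro balancing_smult character_tensor_in_balancing[OF \<alpha>\<beta>])
      qed
    qed
    finally show "u \<in> balancing \<chi>" .
  qed
qed

text \<open>The elements whose component of degree \<open>d\<close> lies in the span form a
  submodule. It contains the relations, each of them being homogeneous, and hence the whole
  span.\<close>

lemma degree_component_balancing:
  assumes g: "g \<in> carrier G" and u: "u \<in> balancing \<chi>"
  shows "degree_component g d u \<in> balancing \<chi>"
proof -
  let ?K = "{u \<in> carrier V. degree_component g d u \<in> balancing \<chi>}"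
  have K: "submodule ?K \<F> V"
  proof -
    have "degree_component g d (\<lambda>p. 0) = (\<lambda>p. 0 :: 'f)"
      "degree_component g d (\<lambda>p. u p + v p) = (\<lambda>p. degree_component g d u p + degree_component g d v p)"
      "degree_component g d (\<lambda>p. c * u p) = (\<lambda>p. c * degree_component g d u p)"
      for u v :: "'g \<times> 'g \<Rightarrow> 'f" and c
      by (auto simp: degree_component_def fun_eq_iff)
    then show ?thesis
      unfolding V.submodule_iff
      by (auto simp: V.zero_in V.add_in V.smult_in balancing_zero balancing_add balancing_smult)
  qed
  have "balancing_relations G H1 H2 \<chi> \<subseteq> ?K"
  proof
    fix r
    assume r: "r \<in> balancing_relations G H1 H2 \<chi>"
    then obtain h1 h2 h v where *: "h1 \<in> H1" "h2 \<in> H2" "h \<in> H1" "h \<in> H2"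
      "r = (\<lambda>p. pure_tensor (h1 \<otimes> h, inv h \<otimes> h2) v p - pure_tensor (h1, h2) (\<chi> h * v) p)"
      by (auto simp: balancing_relations_eq)
    have "degree_component g d r = (if h1 \<otimes> g \<otimes> h2 = d then r else (\<lambda>p. 0))"
      using degree_balanced[of h1 h2 h g] * g
      by (auto simp: degree_component_def pure_tensor_def fun_eq_iff)
    then show "r \<in> ?K"
      using subsetD[OF balancing_relations_closed r] balancing_relations_subset[OF r] balancing_zero
      by simp
  qed
  with K have "balancing \<chi> \<subseteq> ?K"
    by (rule submodule_span_le)
  then show ?thesis
    using u by blast
qed

text \<open>Read off from \<open>balancing_eq\<close>: the actions rescale every coefficient, so
  vanishing coefficients remain zero.\<close>

lemma subbimodule_balancing:
  "subbimodule \<F> (group_algebra G H1) (group_algebra G H2) V (balancing \<chi>)"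
proof (intro subbimodule.intro bimodule_pre_tensor submodule_of_bimodule.intro V.is_module
    submodule_of_bimodule_axioms.intro submodule_balancing subbimodule_axioms.intro)
  show "lact V a x \<in> balancing \<chi>" if "x \<in> balancing \<chi>" for a x
    using that unfolding balancing_eq by (auto simp: lact_pre_tensor_closed fourier2_lact)
  show "ract V x b \<in> balancing \<chi>" if "x \<in> balancing \<chi>" for b x
    using that unfolding balancing_eq by (auto simp: ract_pre_tensor_closed fourier2_ract)
qed

section \<open>The quotient as a graded bimodule, and its coordinates\<close>

abbreviation Q :: "('g \<Rightarrow> 'f) \<Rightarrow> ('f, 'g \<Rightarrow> 'f, 'g \<Rightarrow> 'f, ('g \<times> 'g \<Rightarrow> 'f) set) bimodule"
  where "Q \<chi> \<equiv> char_bimodule G H1 H2 \<chi>"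

abbreviation coset :: "('g \<Rightarrow> 'f) \<Rightarrow> ('g \<times> 'g \<Rightarrow> 'f) \<Rightarrow> ('g \<times> 'g \<Rightarrow> 'f) set"
  where "coset \<chi> u \<equiv> balancing \<chi> +>\<^bsub>V\<^esub> u"

lemma bimodule_char_bimodule: "bimodule \<F> (group_algebra G H1) (group_algebra G H2) (Q \<chi>)"
  unfolding char_bimodule_def by (rule subbimodule.bimodule_quotient[OF subbimodule_balancing])

lemma char_bimodule_grading_eq:
  "char_bimodule_grading G H1 H2 \<chi> g d = coset \<chi> ` pre_tensor_grading G H1 H2 g d"
  by (auto simp: char_bimodule_grading_def pre_tensor_grading_def)

lemma homogeneous_projections_char_bimodule:
  assumes g: "g \<in> carrier G"
  shows "homogeneous_projections \<F> (Q \<chi>) G (degrees g) (char_bimodule_grading G H1 H2 \<chi> g)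
    (\<lambda>d C. balancing \<chi> <+>\<^bsub>V\<^esub> (degree_component g d ` C))"
proof -
  interpret W: subbimodule \<F> "group_algebra G H1" "group_algebra G H2" V "balancing \<chi>"
    by (rule subbimodule_balancing)
  show ?thesis
    unfolding char_bimodule_def char_bimodule_grading_eq[abs_def]
    by (rule W.homogeneous_projections_quotient[OF homogeneous_projections_pre_tensor[OF g]])
      (rule degree_component_balancing[OF g])
qed

lemma carrier_char_bimodule: "carrier (Q \<chi>) = coset \<chi> ` carrier V"
proof -
  interpret W: subbimodule \<F> "group_algebra G H1" "group_algebra G H2" V "balancing \<chi>"
    by (rule subbimodule_balancing)
  show ?thesis
    unfolding char_bimodule_def by (rule W.carrier_quotient)
qed

lemma coset_ops:
  assumes u: "u \<in> carrier V"
  shows "v \<in> carrier V \<Longrightarrow> coset \<chi> u \<oplus>\<^bsub>Q \<chi>\<^esub> coset \<chi> v = coset \<chi> (u \<oplus>\<^bsub>V\<^esub> v)"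
    and "c \<odot>\<^bsub>Q \<chi>\<^esub> coset \<chi> u = coset \<chi> (c \<odot>\<^bsub>V\<^esub> u)"
    and "a \<in> carrier (group_algebra G H1) \<Longrightarrow> lact (Q \<chi>) a (coset \<chi> u) = coset \<chi> (lact V a u)"
    and "b \<in> carrier (group_algebra G H2) \<Longrightarrow> ract (Q \<chi>) (coset \<chi> u) b = coset \<chi> (ract V u b)"
proof -
  interpret W: subbimodule \<F> "group_algebra G H1" "group_algebra G H2" V "balancing \<chi>"
    by (rule subbimodule_balancing)
  show "v \<in> carrier V \<Longrightarrow> coset \<chi> u \<oplus>\<^bsub>Q \<chi>\<^esub> coset \<chi> v = coset \<chi> (u \<oplus>\<^bsub>V\<^esub> v)"
    "c \<odot>\<^bsub>Q \<chi>\<^esub> coset \<chi> u = coset \<chi> (c \<odot>\<^bsub>V\<^esub> u)"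
    "a \<in> carrier (group_algebra G H1) \<Longrightarrow> lact (Q \<chi>) a (coset \<chi> u) = coset \<chi> (lact V a u)"
    "b \<in> carrier (group_algebra G H2) \<Longrightarrow> ract (Q \<chi>) (coset \<chi> u) b = coset \<chi> (ract V u b)"
    unfolding char_bimodule_def using u
    by (simp_all add: W.quotient.q_add W.quotient_smult W.quotient_lact W.quotient_ract)
qed

lemma group_algebra_grading_closed: "group_algebra_grading H h \<subseteq> carrier (group_algebra G H)"
  by (auto simp: group_algebra_grading_def group_algebra_simps)

lemma char_bimodule_grading_act:
  assumes g: "g \<in> carrier G" and h: "h \<in> carrier G" and d: "d \<in> carrier G" and k: "k \<in> carrier G"
    and a: "a \<in> group_algebra_grading H1 h" and C: "C \<in> char_bimodule_grading G H1 H2 \<chi> g d"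
    and b: "b \<in> group_algebra_grading H2 k"
  shows "ract (Q \<chi>) (lact (Q \<chi>) a C) b \<in> char_bimodule_grading G H1 H2 \<chi> g (h \<otimes> d \<otimes> k)"
proof -
  obtain u where u: "u \<in> pre_tensor_grading G H1 H2 g d" "C = coset \<chi> u"
    using C by (auto simp: char_bimodule_grading_eq)
  then have "ract (Q \<chi>) (lact (Q \<chi>) a C) b = coset \<chi> (ract V (lact V a u) b)"
    using subsetD[OF group_algebra_grading_closed a] subsetD[OF group_algebra_grading_closed b]
    by (simp add: coset_ops pre_tensor_grading_def lact_pre_tensor_closed)
  then show ?thesis
    using pre_tensor_grading_act[OF g h d k a u(1) b] by (auto simp: char_bimodule_grading_eq)
qed

text \<open>On compatible pairs of characters the value does not depend on the representative of the
  coset.\<close>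

definition coset_fourier2 :: "('g \<times> 'g \<Rightarrow> 'f) set \<Rightarrow> ('g \<Rightarrow> 'f) \<Rightarrow> ('g \<Rightarrow> 'f) \<Rightarrow> 'f"
  where "coset_fourier2 C = fourier2 H1 H2 (SOME u. u \<in> C)"

lemma coset_fourier2:
  assumes u: "u \<in> carrier V" and "\<alpha> \<in> dual1" "\<beta> \<in> dual2" "compatible \<chi> \<alpha> \<beta>"
  shows "coset_fourier2 (coset \<chi> u) \<alpha> \<beta> = fourier2 H1 H2 u \<alpha> \<beta>"
proof -
  interpret W: subbimodule \<F> "group_algebra G H1" "group_algebra G H2" V "balancing \<chi>"
    by (rule subbimodule_balancing)
  have "(SOME v. v \<in> coset \<chi> u) \<in> coset \<chi> u"
    unfolding some_in_eq using W.coset_self[OF u] by blast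
  then obtain w where w: "w \<in> balancing \<chi>" "(SOME v. v \<in> coset \<chi> u) = w \<oplus>\<^bsub>V\<^esub> u"
    unfolding W.mem_coset_iff by blast
  have "fourier2 H1 H2 w \<alpha> \<beta> = 0"
    using w(1) assms(2-) unfolding balancing_eq by blast
  then show ?thesis
    unfolding coset_fourier2_def w(2) V.add_eq fourier2_add by simp
qed

text \<open>By \<open>balancing_eq\<close> the difference of the representatives is in the span.
  Hence the coefficients at compatible pairs are a complete set of coordinates on the
  quotient.\<close>

lemma coset_eqI:
  assumes u: "u \<in> carrier V" and v: "v \<in> carrier V"
    and eq: "\<And>\<alpha> \<beta>. \<alpha> \<in> dual1 \<Longrightarrow> \<beta> \<in> dual2 \<Longrightarrow> compatible \<chi> \<alpha> \<beta> \<Longrightarrow>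
      fourier2 H1 H2 u \<alpha> \<beta> = fourier2 H1 H2 v \<alpha> \<beta>"
  shows "coset \<chi> u = coset \<chi> v"
proof -
  interpret W: subbimodule \<F> "group_algebra G H1" "group_algebra G H2" V "balancing \<chi>"
    by (rule subbimodule_balancing)
  have "fourier2 H1 H2 (u \<ominus>\<^bsub>V\<^esub> v) \<alpha> \<beta> = 0"
    if "\<alpha> \<in> dual1" "\<beta> \<in> dual2" "compatible \<chi> \<alpha> \<beta>" for \<alpha> \<beta>
    unfolding V.a_minus_eq[OF v] fourier2_diff eq[OF that] by simp
  then have "u \<ominus>\<^bsub>V\<^esub> v \<in> balancing \<chi>"
    unfolding balancing_eq using V.minus_closed[OF u v] by blast
  then show ?thesis
    by (rule W.coset_eqI[OF u v])
qed

end


section \<open>Triangular algebras and incidence algebras\<close>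

lemma triangular_algebra_simps:
  "carrier (triangular_algebra A B M) = carrier A \<times> carrier M \<times> carrier B"
  "(a, m, b) \<otimes>\<^bsub>triangular_algebra A B M\<^esub> (a', m', b') =
    (a \<otimes>\<^bsub>A\<^esub> a', lact M a m' \<oplus>\<^bsub>M\<^esub> ract M m b', b \<otimes>\<^bsub>B\<^esub> b')"
  "\<one>\<^bsub>triangular_algebra A B M\<^esub> = (\<one>\<^bsub>A\<^esub>, \<zero>\<^bsub>M\<^esub>, \<one>\<^bsub>B\<^esub>)"
  "\<zero>\<^bsub>triangular_algebra A B M\<^esub> = (\<zero>\<^bsub>A\<^esub>, \<zero>\<^bsub>M\<^esub>, \<zero>\<^bsub>B\<^esub>)"
  "(a, m, b) \<oplus>\<^bsub>triangular_algebra A B M\<^esub> (a', m', b') = (a \<oplus>\<^bsub>A\<^esub> a', m \<oplus>\<^bsub>M\<^esub> m', b \<oplus>\<^bsub>B\<^esub> b')"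
  "c \<odot>\<^bsub>triangular_algebra A B M\<^esub> (a, m, b) = (c \<odot>\<^bsub>A\<^esub> a, c \<odot>\<^bsub>M\<^esub> m, c \<odot>\<^bsub>B\<^esub> b)"
  by (simp_all add: triangular_algebra_def)

context bimodule
begin

abbreviation T :: "('f, 'a \<times> 'm \<times> 'b) module" where "T \<equiv> triangular_algebra A B M"

lemma lact_zero: "a \<in> carrier A \<Longrightarrow> lact M a \<zero>\<^bsub>M\<^esub> = \<zero>\<^bsub>M\<^esub>"
  using lact_smult_right[of "\<zero>\<^bsub>R\<^esub>" a "\<zero>\<^bsub>M\<^esub>"] by (simp add: lact_closed)

lemma ract_zero: "b \<in> carrier B \<Longrightarrow> ract M \<zero>\<^bsub>M\<^esub> b = \<zero>\<^bsub>M\<^esub>"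
  using ract_smult_left[of "\<zero>\<^bsub>R\<^esub>" "\<zero>\<^bsub>M\<^esub>" b] by (simp add: ract_closed)

lemma module_triangular: "module R T"
proof (rule moduleI)
  show "abelian_group T"
  proof (rule abelian_groupI)
    fix x assume "x \<in> carrier T"
    then obtain a m b where x: "x = (a, m, b)" "a \<in> carrier A" "m \<in> carrier M" "b \<in> carrier B"
      by (auto simp: triangular_algebra_simps)
    then show "\<exists>y\<in>carrier T. y \<oplus>\<^bsub>T\<^esub> x = \<zero>\<^bsub>T\<^esub>"
      by (intro bexI[of _ "(\<ominus>\<^bsub>A\<^esub> a, \<ominus>\<^bsub>M\<^esub> m, \<ominus>\<^bsub>B\<^esub> b)"])
        (auto simp: triangular_algebra_simps A.M.l_neg M.M.l_neg B.M.l_neg)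
  qed (auto simp: triangular_algebra_simps A.M.a_ac M.M.a_ac B.M.a_ac)
qed (auto simp: triangular_algebra_simps A.cring_axioms A.smult_l_distr A.smult_r_distr
    A.smult_assoc1 B.smult_l_distr B.smult_r_distr B.smult_assoc1 M.smult_l_distr M.smult_r_distr
    M.smult_assoc1)

text \<open>In the off-diagonal entry, associativity combines the associativity of each action with
  the commutation of the two actions.\<close>

lemma assoc_algebra_triangular: "assoc_algebra R T"
proof -
  interpret T: module R T
    by (rule module_triangular)
  have "monoid T"
  proof (rule monoidI)
    fix x y z assume "x \<in> carrier T" "y \<in> carrier T" "z \<in> carrier T"
    then obtain a m b a' m' b' a'' m'' b'' where *:
      "x = (a, m, b)" "a \<in> carrier A" "m \<in> carrier M" "b \<in> carrier B"
      "y = (a', m', b')" "a' \<in> carrier A" "m' \<in> carrier M" "b' \<in> carrier B"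
      "z = (a'', m'', b'')" "a'' \<in> carrier A" "m'' \<in> carrier M" "b'' \<in> carrier B"
      by (auto simp: triangular_algebra_simps)
    then show "x \<otimes>\<^bsub>T\<^esub> y \<otimes>\<^bsub>T\<^esub> z = x \<otimes>\<^bsub>T\<^esub> (y \<otimes>\<^bsub>T\<^esub> z)"
      by (simp add: triangular_algebra_simps A.A.m_assoc B.A.m_assoc lact_mult ract_mult
          lact_add_right ract_add_left lact_closed ract_closed lact_ract M.M.a_assoc)
  qed (auto simp: triangular_algebra_simps lact_closed ract_closed lact_zero ract_zero lact_one
      ract_one)
  then have "ring T"
    by (intro ringI T.abelian_group_axioms)
      (auto simp: triangular_algebra_simps lact_closed ract_closed lact_add_left lact_add_right
        ract_add_left ract_add_right A.A.l_distr A.A.r_distr B.A.l_distr B.A.r_distr M.M.a_ac)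
  then show ?thesis
    by (intro assoc_algebra.intro assoc_algebra_axioms.intro module_triangular)
      (auto simp: triangular_algebra_simps lact_closed ract_closed lact_smult_left lact_smult_right
        ract_smult_left ract_smult_right A.smult_mult_left A.smult_mult_right B.smult_mult_left
        B.smult_mult_right M.smult_r_distr)
qed

lemma homogeneous_projections_triangular:
  assumes A: "homogeneous_projections R A G D \<Gamma>A \<pi>A" and B: "homogeneous_projections R B G D \<Gamma>B \<pi>B"
    and M: "homogeneous_projections R M G D \<Gamma>M \<pi>M"
  shows "homogeneous_projections R T G D (triangular_grading \<Gamma>A \<Gamma>B \<Gamma>M)
    (\<lambda>g (a, m, b). (\<pi>A g a, \<pi>M g m, \<pi>B g b))"
proof -
  interpret T: module R T
    by (rule module_triangular)
  interpret hA: homogeneous_projections R A G D \<Gamma>A \<pi>A by (rule A)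
  interpret hB: homogeneous_projections R B G D \<Gamma>B \<pi>B by (rule B)
  interpret hM: homogeneous_projections R M G D \<Gamma>M \<pi>M by (rule M)
  show ?thesis
  proof (intro homogeneous_projections.intro homogeneous_projections_axioms.intro)
    show "submodule (triangular_grading \<Gamma>A \<Gamma>B \<Gamma>M g) R T" if g: "g \<in> carrier G" for g
    proof -
      note sub = hA.submodule_\<Gamma>[OF g] hM.submodule_\<Gamma>[OF g] hB.submodule_\<Gamma>[OF g]
      have smult: "c \<odot>\<^bsub>T\<^esub> x \<in> triangular_grading \<Gamma>A \<Gamma>B \<Gamma>M g"
        if "c \<in> carrier R" "x \<in> triangular_grading \<Gamma>A \<Gamma>B \<Gamma>M g" for c x
        using that A.submoduleE(4)[OF sub(1)] M.submoduleE(4)[OF sub(2)] B.submoduleE(4)[OF sub(3)]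
        by (auto simp: triangular_grading_def triangular_algebra_simps)
      have closed: "triangular_grading \<Gamma>A \<Gamma>B \<Gamma>M g \<subseteq> carrier T"
        using hA.\<Gamma>_closed[OF g] hB.\<Gamma>_closed[OF g] hM.\<Gamma>_closed[OF g]
        by (auto simp: triangular_grading_def triangular_algebra_simps)
      show ?thesis
      proof (rule T.submoduleI)
        show "\<zero>\<^bsub>T\<^esub> \<in> triangular_grading \<Gamma>A \<Gamma>B \<Gamma>M g"
          using sub[THEN submodule.axioms(1), THEN subgroup.one_closed]
          by (simp add: triangular_grading_def triangular_algebra_simps)
        show "x \<oplus>\<^bsub>T\<^esub> y \<in> triangular_grading \<Gamma>A \<Gamma>B \<Gamma>M g"
          if "x \<in> triangular_grading \<Gamma>A \<Gamma>B \<Gamma>M g" "y \<in> triangular_grading \<Gamma>A \<Gamma>B \<Gamma>M g" for x y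
          using that A.submoduleE(5)[OF sub(1)] M.submoduleE(5)[OF sub(2)] B.submoduleE(5)[OF sub(3)]
          by (auto simp: triangular_grading_def triangular_algebra_simps)
        show "\<ominus>\<^bsub>T\<^esub> x \<in> triangular_grading \<Gamma>A \<Gamma>B \<Gamma>M g" if x: "x \<in> triangular_grading \<Gamma>A \<Gamma>B \<Gamma>M g" for x
          using smult[OF _ x, of "\<ominus>\<^bsub>R\<^esub> \<one>\<^bsub>R\<^esub>"] subsetD[OF closed x] by (simp add: T.smult_l_minus)
      qed (use closed smult in auto)
    qed
    fix x assume x: "x \<in> carrier T"
    then obtain a m b where abm: "x = (a, m, b)" "a \<in> carrier A" "m \<in> carrier M" "b \<in> carrier B"
      by (auto simp: triangular_algebra_simps)
    let ?s = "\<Oplus>\<^bsub>T\<^esub>g\<in>D. (\<pi>A g a, \<pi>M g m, \<pi>B g b)"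
    have in_T: "(\<pi>A g a, \<pi>M g m, \<pi>B g b) \<in> carrier T" if "g \<in> D" for g
      using that hA.D_subset abm
      by (auto simp: triangular_algebra_simps hA.\<pi>_closed hB.\<pi>_closed hM.\<pi>_closed)
    \<comment> \<open>Each coordinate map is additive, so the sum of the components is computed
      entry by entry over the common index set \<open>D\<close>.\<close>
    have "fst ?s = (\<Oplus>\<^bsub>A\<^esub>g\<in>D. fst (\<pi>A g a, \<pi>M g m, \<pi>B g b))"
      using T.abelian_monoid_axioms A.abelian_monoid_axioms
      by (rule finsum_additive) (use in_T in \<open>auto simp: triangular_algebra_simps\<close>)
    moreover have "fst (snd ?s) = (\<Oplus>\<^bsub>M\<^esub>g\<in>D. fst (snd (\<pi>A g a, \<pi>M g m, \<pi>B g b)))"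
      using T.abelian_monoid_axioms M.abelian_monoid_axioms
      by (rule finsum_additive[where \<phi> = "\<lambda>x. fst (snd x)"])
        (use in_T in \<open>auto simp: triangular_algebra_simps\<close>)
    moreover have "snd (snd ?s) = (\<Oplus>\<^bsub>B\<^esub>g\<in>D. snd (snd (\<pi>A g a, \<pi>M g m, \<pi>B g b)))"
      using T.abelian_monoid_axioms B.abelian_monoid_axioms
      by (rule finsum_additive[where \<phi> = "\<lambda>x. snd (snd x)"])
        (use in_T in \<open>auto simp: triangular_algebra_simps\<close>)
    ultimately have "?s = (a, m, b)"
      using abm by (simp add: hA.\<pi>_sum hB.\<pi>_sum hM.\<pi>_sum prod_eq_iff)
    then show "(\<Oplus>\<^bsub>T\<^esub>g\<in>D. (case x of (a, m, b) \<Rightarrow> (\<pi>A g a, \<pi>M g m, \<pi>B g b))) = x"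
      by (simp add: abm(1))
  qed (auto simp: module_triangular triangular_grading_def triangular_algebra_simps hA.finite_D
      subsetD[OF hA.D_subset] hA.\<pi>_in hB.\<pi>_in hM.\<pi>_in hA.\<pi>_add hB.\<pi>_add hM.\<pi>_add
      hA.\<pi>_\<Gamma> hB.\<pi>_\<Gamma> hM.\<pi>_\<Gamma> hA.\<pi>_outside hB.\<pi>_outside hM.\<pi>_outside)
qed

end

text \<open>The grading condition on a bimodule speaks of two-sided products only. The units have
  degree one, so inserting them on either side gives the one-sided conditions that occur in the
  matrix product.\<close>

lemma graded_algebra_triangular:
  fixes A :: "('f, 'a) module" and B :: "('f, 'b) module" and M :: "('f, 'a, 'b, 'm) bimodule"
  assumes "comm_group G" and M: "graded_bimodule R G A \<Gamma>A B \<Gamma>B M \<Gamma>M"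
    and one: "\<one>\<^bsub>A\<^esub> \<in> \<Gamma>A \<one>\<^bsub>G\<^esub>" "\<one>\<^bsub>B\<^esub> \<in> \<Gamma>B \<one>\<^bsub>G\<^esub>"
    and proj: "homogeneous_projections R A G D \<Gamma>A \<pi>A" "homogeneous_projections R B G D \<Gamma>B \<pi>B"
      "homogeneous_projections R M G D \<Gamma>M \<pi>M"
  shows "graded_algebra R G (triangular_algebra A B M) (triangular_grading \<Gamma>A \<Gamma>B \<Gamma>M)"
proof -
  interpret G: comm_group G by fact
  interpret bimodule R A B M
    using M by (simp add: graded_bimodule_def)
  interpret hA: homogeneous_projections R A G D \<Gamma>A \<pi>A by (rule proj)
  interpret hB: homogeneous_projections R B G D \<Gamma>B \<pi>B by (rule proj)
  interpret hM: homogeneous_projections R M G D \<Gamma>M \<pi>M by (rule proj)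
  interpret hT: homogeneous_projections R T G D "triangular_grading \<Gamma>A \<Gamma>B \<Gamma>M"
    "\<lambda>g (a, m, b). (\<pi>A g a, \<pi>M g m, \<pi>B g b)"
    by (rule homogeneous_projections_triangular) (rule proj)+
  have act: "ract M (lact M a m) b \<in> \<Gamma>M (h \<otimes>\<^bsub>G\<^esub> g \<otimes>\<^bsub>G\<^esub> k)"
    if "h \<in> carrier G" "g \<in> carrier G" "k \<in> carrier G" "a \<in> \<Gamma>A h" "m \<in> \<Gamma>M g" "b \<in> \<Gamma>B k" for h g k a m b
    using M that by (simp add: graded_bimodule_def)
  have lact: "lact M a m \<in> \<Gamma>M (h \<otimes>\<^bsub>G\<^esub> g)"
    if "h \<in> carrier G" "g \<in> carrier G" "a \<in> \<Gamma>A h" "m \<in> \<Gamma>M g" for h g a m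
    using act[OF that(1,2) G.one_closed that(3,4) one(2)] that
    by (simp add: ract_one lact_closed hA.\<Gamma>_closed hM.\<Gamma>_closed)
  have ract: "ract M m b \<in> \<Gamma>M (g \<otimes>\<^bsub>G\<^esub> k)"
    if "g \<in> carrier G" "k \<in> carrier G" "m \<in> \<Gamma>M g" "b \<in> \<Gamma>B k" for g k m b
    using act[OF G.one_closed that(1,2) one(1) that(3,4)] that
    by (simp add: lact_one hM.\<Gamma>_closed)
  show ?thesis
    unfolding graded_algebra_def
  proof (intro conjI ballI assoc_algebra_triangular hT.direct_decomposition)
    fix g h x y
    assume gh: "g \<in> carrier G" "h \<in> carrier G"
      and "x \<in> triangular_grading \<Gamma>A \<Gamma>B \<Gamma>M g" "y \<in> triangular_grading \<Gamma>A \<Gamma>B \<Gamma>M h"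
    then obtain a m b a' m' b' where *: "x = (a, m, b)" "a \<in> \<Gamma>A g" "m \<in> \<Gamma>M g" "b \<in> \<Gamma>B g"
      "y = (a', m', b')" "a' \<in> \<Gamma>A h" "m' \<in> \<Gamma>M h" "b' \<in> \<Gamma>B h"
      by (auto simp: triangular_grading_def)
    have "lact M a m' \<oplus>\<^bsub>M\<^esub> ract M m b' \<in> \<Gamma>M (g \<otimes>\<^bsub>G\<^esub> h)"
      using gh * by (intro M.submoduleE(5) hM.submodule_\<Gamma> lact ract) auto
    then show "x \<otimes>\<^bsub>T\<^esub> y \<in> triangular_grading \<Gamma>A \<Gamma>B \<Gamma>M (g \<otimes>\<^bsub>G\<^esub> h)"
      using M gh * by (simp add: triangular_grading_def triangular_algebra_simps graded_bimodule_def
          graded_algebra_def)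
  qed
qed

section \<open>Incidence algebras of finite posets\<close>

lemma incidence_algebra_simps:
  "carrier (incidence_algebra P r) = {a. \<forall>x y. (x, y) \<notin> r \<longrightarrow> a x y = 0}"
  "a \<otimes>\<^bsub>incidence_algebra P r\<^esub> b = (\<lambda>x z. \<Sum>y\<in>P. a x y * b y z)"
  "\<one>\<^bsub>incidence_algebra P r\<^esub> = (\<lambda>x y. if x \<in> P \<and> x = y then 1 else 0)"
  "\<zero>\<^bsub>incidence_algebra P r\<^esub> = (\<lambda>x y. 0)"
  "a \<oplus>\<^bsub>incidence_algebra P r\<^esub> b = (\<lambda>x y. a x y + b x y)"
  "c \<odot>\<^bsub>incidence_algebra P r\<^esub> a = (\<lambda>x y. c * a x y)"
  by (simp_all add: incidence_algebra_def)

text \<open>Transitivity keeps products supported on \<open>r\<close>, and reflexivity puts the unit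
  there. The relation lies in \<open>P \<times> P\<close>, so entries outside \<open>P\<close>
  vanish and the sum over \<open>P\<close> loses nothing.\<close>

lemma assoc_algebra_incidence_algebra:
  assumes P: "finite P" and r: "partial_order_on P r"
  shows "assoc_algebra \<F> (incidence_algebra P r :: ('f::field, 'x \<Rightarrow> 'x \<Rightarrow> 'f) module)"
proof -
  let ?I = "incidence_algebra P r :: ('f, 'x \<Rightarrow> 'x \<Rightarrow> 'f) module"
  have refl: "(x, x) \<in> r" if "x \<in> P" for x
    using r that by (auto simp: partial_order_on_def preorder_on_def refl_on_def)
  have sub: "x \<in> P" "y \<in> P" if "(x, y) \<in> r" for x y
    using r that by (auto simp: partial_order_on_def preorder_on_def)
  have trans: "(x, z) \<in> r" if "(x, y) \<in> r" "(y, z) \<in> r" for x y z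
    using r that by (auto simp: partial_order_on_def preorder_on_def dest: transD)
  have "abelian_group ?I"
  proof (rule abelian_groupI)
    show "\<exists>y\<in>carrier ?I. y \<oplus>\<^bsub>?I\<^esub> x = \<zero>\<^bsub>?I\<^esub>" if "x \<in> carrier ?I" for x
      using that by (intro bexI[of _ "\<lambda>i j. - x i j"]) (auto simp: incidence_algebra_simps)
  qed (auto simp: incidence_algebra_simps algebra_simps)
  then have module: "module \<F> ?I"
    by (intro moduleI) (auto simp: incidence_algebra_simps algebra_simps)
  have mult_closed: "a \<otimes>\<^bsub>?I\<^esub> b \<in> carrier ?I" if a: "a \<in> carrier ?I" and b: "b \<in> carrier ?I" for a b
    unfolding incidence_algebra_simps mem_Collect_eq
  proof (intro allI impI sum.neutral ballI)
    fix x y z assume "(x, z) \<notin> r"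
    then have "(x, y) \<notin> r \<or> (y, z) \<notin> r"
      using trans by blast
    then show "a x y * b y z = 0"
      using a b by (auto simp: incidence_algebra_simps)
  qed
  have outside: "a x y = 0" if "a \<in> carrier ?I" "x \<notin> P \<or> y \<notin> P" for a x y
    using that sub unfolding incidence_algebra_simps by blast
  have "monoid ?I"
  proof (rule monoidI)
    show "\<one>\<^bsub>?I\<^esub> \<in> carrier ?I"
      using refl by (auto simp: incidence_algebra_simps)
    show "a \<otimes>\<^bsub>?I\<^esub> b \<otimes>\<^bsub>?I\<^esub> c = a \<otimes>\<^bsub>?I\<^esub> (b \<otimes>\<^bsub>?I\<^esub> c)" for a b c
    proof (intro ext)
      fix w z
      have "(\<Sum>y\<in>P. (\<Sum>x\<in>P. a w x * b x y) * c y z) = (\<Sum>y\<in>P. \<Sum>x\<in>P. a w x * b x y * c y z)"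
        by (simp add: sum_distrib_right)
      also have "\<dots> = (\<Sum>x\<in>P. \<Sum>y\<in>P. a w x * b x y * c y z)"
        by (rule sum.swap)
      also have "\<dots> = (\<Sum>x\<in>P. a w x * (\<Sum>y\<in>P. b x y * c y z))"
        by (simp add: sum_distrib_left mult.assoc)
      finally show "(a \<otimes>\<^bsub>?I\<^esub> b \<otimes>\<^bsub>?I\<^esub> c) w z = (a \<otimes>\<^bsub>?I\<^esub> (b \<otimes>\<^bsub>?I\<^esub> c)) w z"
        by (simp add: incidence_algebra_simps)
    qed
    fix a assume a: "a \<in> carrier ?I"
    have "(\<one>\<^bsub>?I\<^esub> \<otimes>\<^bsub>?I\<^esub> a) x z = (\<Sum>y\<in>P. if y = x then a x z else 0)" for x z
      unfolding incidence_algebra_simps by (intro sum.cong) auto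
    then show "\<one>\<^bsub>?I\<^esub> \<otimes>\<^bsub>?I\<^esub> a = a"
      using P outside[OF a] by (auto simp: fun_eq_iff)
    have "(a \<otimes>\<^bsub>?I\<^esub> \<one>\<^bsub>?I\<^esub>) x z = (\<Sum>y\<in>P. if y = z then a x z else 0)" for x z
      unfolding incidence_algebra_simps by (intro sum.cong) auto
    then show "a \<otimes>\<^bsub>?I\<^esub> \<one>\<^bsub>?I\<^esub> = a"
      using P outside[OF a] by (auto simp: fun_eq_iff)
  qed (rule mult_closed)
  then have "ring ?I"
    using \<open>abelian_group ?I\<close>
    by (intro ringI) (auto simp: incidence_algebra_simps algebra_simps sum.distrib)
  then show ?thesis
    using module
    by (intro assoc_algebra.intro assoc_algebra_axioms.intro)
      (auto simp: incidence_algebra_simps sum_distrib_left mult.assoc mult.left_commute)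
qed


section \<open>The poset of characters\<close>

locale character_family = split_pair G H1 H2 \<zeta>1 \<zeta>2
  for G :: "'g monoid" (structure) and H1 H2 and \<zeta>1 \<zeta>2 :: "'f::field" +
  fixes I :: "'i set" and \<chi> :: "'i \<Rightarrow> 'g \<Rightarrow> 'f" and g :: "'i \<Rightarrow> 'g"
  assumes finite_I: "finite I"
    and \<chi>: "i \<in> I \<Longrightarrow> \<chi> i \<in> characters G (H1 \<inter> H2)"
    and \<chi>_inj: "i \<in> I \<Longrightarrow> j \<in> I \<Longrightarrow> \<chi> i = \<chi> j \<Longrightarrow> i = j"
    and g: "i \<in> I \<Longrightarrow> g i \<in> carrier G"
begin

abbreviation \<A> :: "('f, 'g \<Rightarrow> 'f) module" where "\<A> \<equiv> group_algebra G H1"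
abbreviation \<B> :: "('f, 'g \<Rightarrow> 'f) module" where "\<B> \<equiv> group_algebra G H2"

abbreviation M where "M \<equiv> direct_sum_bimodule I (\<lambda>i. Q (\<chi> i))"

abbreviation \<Gamma>M where
  "\<Gamma>M \<equiv> direct_sum_grading I (\<lambda>i. char_bimodule_grading G H1 H2 (\<chi> i) (g i))"

sublocale family: bimodule_family \<F> \<A> \<B> I "\<lambda>i. Q (\<chi> i)"
  by (intro bimodule_family.intro bimodule_family_axioms.intro A.assoc_algebra_group_algebra
      B.assoc_algebra_group_algebra bimodule_char_bimodule)

sublocale M: bimodule \<F> \<A> \<B> M
  by (rule family.bimodule_direct_sum)

text \<open>One finite set of degrees for the projections of all three blocks.\<close>

definition degree_support :: "'g set"
  where "degree_support = H1 \<union> H2 \<union> (\<Union>i\<in>I. degrees (g i))"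

lemma degree_support: "finite degree_support" "degree_support \<subseteq> carrier G"
  using g by (auto simp: degree_support_def A.finite_H B.finite_H finite_I finite_degrees degrees_def)

lemma homogeneous_projections_A:
  "homogeneous_projections \<F> \<A> G degree_support (group_algebra_grading H1)
    (\<lambda>g a h. if h \<in> H1 \<and> h = g then a h else 0)"
  using A.homogeneous_projections_group_algebra
  by (rule homogeneous_projections.mono_support) (use degree_support in \<open>auto simp: degree_support_def\<close>)

lemma homogeneous_projections_B:
  "homogeneous_projections \<F> \<B> G degree_support (group_algebra_grading H2)
    (\<lambda>g a h. if h \<in> H2 \<and> h = g then a h else 0)"
  using B.homogeneous_projections_group_algebra
  by (rule homogeneous_projections.mono_support) (use degree_support in \<open>auto simp: degree_support_def\<close>)

lemma homogeneous_projections_M: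
  "homogeneous_projections \<F> M G degree_support \<Gamma>M
    (\<lambda>d x. \<lambda>i\<in>I. balancing (\<chi> i) <+>\<^bsub>V\<^esub> (degree_component (g i) d ` x i))"
proof (rule family.homogeneous_projections_direct_sum[OF degree_support])
  fix i assume i: "i \<in> I"
  show "homogeneous_projections \<F> (Q (\<chi> i)) G degree_support
    (char_bimodule_grading G H1 H2 (\<chi> i) (g i))
    (\<lambda>d C. balancing (\<chi> i) <+>\<^bsub>V\<^esub> (degree_component (g i) d ` C))"
    using homogeneous_projections_char_bimodule[OF g[OF i]]
    by (rule homogeneous_projections.mono_support) (use i degree_support in \<open>auto simp: degree_support_def\<close>)
qed

lemma graded_bimodule_M:
  "graded_bimodule \<F> G \<A> (group_algebra_grading H1) \<B> (group_algebra_grading H2) M \<Gamma>M"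
  unfolding graded_bimodule_def
proof (intro conjI ballI A.graded_algebra_group_algebra B.graded_algebra_group_algebra
    M.bimodule_axioms homogeneous_projections.direct_decomposition[OF homogeneous_projections_M])
  fix h d k m and a b :: "'g \<Rightarrow> 'f"
  assume *: "h \<in> carrier G" "d \<in> carrier G" "k \<in> carrier G" "a \<in> group_algebra_grading H1 h"
    "m \<in> \<Gamma>M d" "b \<in> group_algebra_grading H2 k"
  then show "ract M (lact M a m) b \<in> \<Gamma>M (h \<otimes> d \<otimes> k)"
    by (auto simp: direct_sum_grading_def direct_sum_bimodule_simps PiE_iff
        intro!: char_bimodule_grading_act g)
qed

lemma graded_algebra_T:
  "graded_algebra \<F> G M.T (triangular_grading (group_algebra_grading H1) (group_algebra_grading H2) \<Gamma>M)"
  by (rule graded_algebra_triangular[OF A.comm_group_axioms graded_bimodule_M _ _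
        homogeneous_projections_A homogeneous_projections_B homogeneous_projections_M])
    (auto simp: group_algebra_simps group_algebra_grading_def)

text \<open>Since \<beta> has no zeros on \<open>H2\<close>, compatibility forces \<chi> i =
  \<alpha> / \<beta> on the intersection. The distinctness of the given characters enters here, and
  it limits \<open>M\<close> to one coordinate for each pair.\<close>

lemma compatible_unique:
  assumes "i \<in> I" "j \<in> I" "\<beta> \<in> dual2" "compatible (\<chi> i) \<alpha> \<beta>" "compatible (\<chi> j) \<alpha> \<beta>"
  shows "i = j"
proof (rule \<chi>_inj)
  have "\<chi> i h = \<chi> j h" if "h \<in> H1 \<inter> H2" for h
    using assms(4,5) that characters_neq_0[OF assms(3), of h] by (auto simp: compatible_def)
  then show "\<chi> i = \<chi> j"
    by (intro characters_eqI[OF \<chi> \<chi>]) (use assms in auto)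
qed (use assms in auto)

text \<open>By \<open>compatible_unique\<close> at most one summand survives when \<beta> is a
  character, so this is the single coordinate of \<open>m\<close> at the pair; the sum avoids
  choosing the index.\<close>

definition M_fourier :: "('i \<Rightarrow> ('g \<times> 'g \<Rightarrow> 'f) set) \<Rightarrow> ('g \<Rightarrow> 'f) \<Rightarrow> ('g \<Rightarrow> 'f) \<Rightarrow> 'f"
  where "M_fourier m \<alpha> \<beta> = (\<Sum>i\<in>I. if compatible (\<chi> i) \<alpha> \<beta> then coset_fourier2 (m i) \<alpha> \<beta> else 0)"

lemma M_fourier_compatible:
  assumes i: "i \<in> I" and \<beta>: "\<beta> \<in> dual2" and comp: "compatible (\<chi> i) \<alpha> \<beta>"
  shows "M_fourier m \<alpha> \<beta> = coset_fourier2 (m i) \<alpha> \<beta>"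
proof -
  have "compatible (\<chi> j) \<alpha> \<beta> \<longleftrightarrow> j = i" if "j \<in> I" for j
    using compatible_unique[OF that i \<beta> _ comp] comp by blast
  then have "M_fourier m \<alpha> \<beta> = (\<Sum>j\<in>I. if j = i then coset_fourier2 (m i) \<alpha> \<beta> else 0)"
    unfolding M_fourier_def by (intro sum.cong) auto
  then show ?thesis
    using i finite_I by simp
qed

lemma M_fourier_incompatible:
  "(\<And>i. i \<in> I \<Longrightarrow> \<not> compatible (\<chi> i) \<alpha> \<beta>) \<Longrightarrow> M_fourier m \<alpha> \<beta> = 0"
  by (auto simp: M_fourier_def intro!: sum.neutral)

lemma M_component:
  assumes "m \<in> carrier M" "i \<in> I"
  obtains u where "u \<in> carrier V" "m i = coset (\<chi> i) u"
  using assms by (auto simp: direct_sum_bimodule_simps carrier_char_bimodule PiE_iff)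

lemma M_fourier_ops:
  assumes m: "m \<in> carrier M" and \<alpha>: "\<alpha> \<in> dual1" and \<beta>: "\<beta> \<in> dual2"
  shows "m' \<in> carrier M \<Longrightarrow> M_fourier (m \<oplus>\<^bsub>M\<^esub> m') \<alpha> \<beta> = M_fourier m \<alpha> \<beta> + M_fourier m' \<alpha> \<beta>"
    and "M_fourier (c \<odot>\<^bsub>M\<^esub> m) \<alpha> \<beta> = c * M_fourier m \<alpha> \<beta>"
    and "a \<in> carrier \<A> \<Longrightarrow> M_fourier (lact M a m) \<alpha> \<beta> = fourier H1 a \<alpha> * M_fourier m \<alpha> \<beta>"
    and "b \<in> carrier \<B> \<Longrightarrow> M_fourier (ract M m b) \<alpha> \<beta> = M_fourier m \<alpha> \<beta> * fourier H2 b \<beta>"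
proof -
  note ops = family.direct_sum_apply coset_ops coset_fourier2[OF _ \<alpha> \<beta>] V.add_eq V.smult_eq
    V.add_in V.smult_in lact_pre_tensor_closed ract_pre_tensor_closed fourier2_add fourier2_smult
    fourier2_lact[OF \<alpha>] fourier2_ract[OF \<beta>]
  \<comment> \<open>All four rules are proved together so that one case distinction serves them: a
    compatible pair reduces them to one summand, and otherwise both sides are zero.\<close>
  have "(m' \<in> carrier M \<longrightarrow> M_fourier (m \<oplus>\<^bsub>M\<^esub> m') \<alpha> \<beta> = M_fourier m \<alpha> \<beta> + M_fourier m' \<alpha> \<beta>) \<and>
    M_fourier (c \<odot>\<^bsub>M\<^esub> m) \<alpha> \<beta> = c * M_fourier m \<alpha> \<beta> \<and>
    (a \<in> carrier \<A> \<longrightarrow> M_fourier (lact M a m) \<alpha> \<beta> = fourier H1 a \<alpha> * M_fourier m \<alpha> \<beta>) \<and>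
    (b \<in> carrier \<B> \<longrightarrow> M_fourier (ract M m b) \<alpha> \<beta> = M_fourier m \<alpha> \<beta> * fourier H2 b \<beta>)"
  proof (cases "\<exists>i\<in>I. compatible (\<chi> i) \<alpha> \<beta>")
    case True
    then obtain i where i: "i \<in> I" and comp: "compatible (\<chi> i) \<alpha> \<beta>"
      by blast
    obtain u where u: "u \<in> carrier V" "m i = coset (\<chi> i) u"
      using M_component[OF m i] .
    have "M_fourier (m \<oplus>\<^bsub>M\<^esub> m') \<alpha> \<beta> = M_fourier m \<alpha> \<beta> + M_fourier m' \<alpha> \<beta>" if m': "m' \<in> carrier M"
    proof -
      obtain u' where u': "u' \<in> carrier V" "m' i = coset (\<chi> i) u'"
        using M_component[OF m' i] .
      show ?thesis
        unfolding M_fourier_compatible[OF i \<beta> comp] using i comp u u' by (simp add: ops)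
    qed
    then show ?thesis
      unfolding M_fourier_compatible[OF i \<beta> comp] using i comp u by (simp add: ops)
  next
    case False
    then show ?thesis
      by (simp add: M_fourier_incompatible)
  qed
  then show "m' \<in> carrier M \<Longrightarrow> M_fourier (m \<oplus>\<^bsub>M\<^esub> m') \<alpha> \<beta> = M_fourier m \<alpha> \<beta> + M_fourier m' \<alpha> \<beta>"
    "M_fourier (c \<odot>\<^bsub>M\<^esub> m) \<alpha> \<beta> = c * M_fourier m \<alpha> \<beta>"
    "a \<in> carrier \<A> \<Longrightarrow> M_fourier (lact M a m) \<alpha> \<beta> = fourier H1 a \<alpha> * M_fourier m \<alpha> \<beta>"
    "b \<in> carrier \<B> \<Longrightarrow> M_fourier (ract M m b) \<alpha> \<beta> = M_fourier m \<alpha> \<beta> * fourier H2 b \<beta>"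
    by blast+
qed

lemma M_fourier_zero:
  assumes "\<alpha> \<in> dual1" "\<beta> \<in> dual2"
  shows "M_fourier \<zero>\<^bsub>M\<^esub> \<alpha> \<beta> = 0"
proof -
  have "M_fourier \<zero>\<^bsub>M\<^esub> \<alpha> \<beta> + M_fourier \<zero>\<^bsub>M\<^esub> \<alpha> \<beta> = M_fourier \<zero>\<^bsub>M\<^esub> \<alpha> \<beta> + 0"
    by (simp only: M_fourier_ops(1)[OF M.M.zero_closed assms M.M.zero_closed, symmetric]
        M.M.l_zero[OF M.M.zero_closed] add_0_right)
  then show ?thesis
    by (rule add_left_imp_eq)
qed

text \<open>Component \<open>i\<close> is determined by its coefficients at the pairs compatible
  with \<chi> i, and there \<open>M_fourier\<close> shows exactly these.\<close>

lemma M_fourier_eqI: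
  assumes m: "m \<in> carrier M" and m': "m' \<in> carrier M"
    and eq: "\<And>\<alpha> \<beta>. \<alpha> \<in> dual1 \<Longrightarrow> \<beta> \<in> dual2 \<Longrightarrow> M_fourier m \<alpha> \<beta> = M_fourier m' \<alpha> \<beta>"
  shows "m = m'"
proof (rule family.direct_sum_eqI[OF m m'])
  fix i assume i: "i \<in> I"
  obtain u where u: "u \<in> carrier V" "m i = coset (\<chi> i) u"
    using M_component[OF m i] .
  obtain u' where u': "u' \<in> carrier V" "m' i = coset (\<chi> i) u'"
    using M_component[OF m' i] .
  show "m i = m' i"
    unfolding u(2) u'(2)
  proof (rule coset_eqI[OF u(1) u'(1)])
    fix \<alpha> \<beta> assume *: "\<alpha> \<in> dual1" "\<beta> \<in> dual2" "compatible (\<chi> i) \<alpha> \<beta>"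
    show "fourier2 H1 H2 u \<alpha> \<beta> = fourier2 H1 H2 u' \<alpha> \<beta>"
      using eq[OF *(1,2)] unfolding M_fourier_compatible[OF i *(2,3)] u(2) u'(2)
      by (simp add: coset_fourier2 * u u')
  qed
qed

text \<open>The same \<open>inverse_fourier2 F\<close> serves in every summand, because a compatible
  pair reads only the summand it is compatible with.\<close>

lemma M_fourier_surj:
  "\<exists>m\<in>carrier M. \<forall>\<alpha>\<in>dual1. \<forall>\<beta>\<in>dual2. (\<exists>i\<in>I. compatible (\<chi> i) \<alpha> \<beta>) \<longrightarrow> M_fourier m \<alpha> \<beta> = F \<alpha> \<beta>"
proof (intro bexI ballI impI)
  let ?m = "\<lambda>i\<in>I. coset (\<chi> i) (inverse_fourier2 F)"
  show "?m \<in> carrier M"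
    by (auto simp: direct_sum_bimodule_simps carrier_char_bimodule inverse_fourier2_in)
  fix \<alpha> \<beta> assume \<alpha>\<beta>: "\<alpha> \<in> dual1" "\<beta> \<in> dual2" and "\<exists>i\<in>I. compatible (\<chi> i) \<alpha> \<beta>"
  then obtain i where i: "i \<in> I" "compatible (\<chi> i) \<alpha> \<beta>"
    by blast
  then show "M_fourier ?m \<alpha> \<beta> = F \<alpha> \<beta>"
    using \<alpha>\<beta>
    by (simp add: M_fourier_compatible[OF i(1) \<alpha>\<beta>(2) i(2)] coset_fourier2 inverse_fourier2_in
        fourier2_inverse_fourier2)
qed

end

text \<open>The points of the poset are natural numbers naming characters. Disjoint index sets keep
  characters of \<open>H1\<close> and of \<open>H2\<close> apart even where the two sets of
  characters meet, for instance when the subgroups coincide.\<close>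

locale indexed_character_family = character_family G H1 H2 \<zeta>1 \<zeta>2 I \<chi> g
  for G :: "'g monoid" (structure) and H1 H2 and \<zeta>1 \<zeta>2 :: "'f::field"
    and I :: "'i set" and \<chi> g +
  fixes P1 P2 :: "nat set" and \<alpha> \<beta> :: "nat \<Rightarrow> 'g \<Rightarrow> 'f"
  assumes P_disjoint: "P1 \<inter> P2 = {}" and finite_P: "finite P1" "finite P2"
    and \<alpha>: "bij_betw \<alpha> P1 dual1" and \<beta>: "bij_betw \<beta> P2 dual2"
begin

definition r :: "nat rel" where
  "r = Id_on (P1 \<union> P2) \<union> {(x, y). x \<in> P1 \<and> y \<in> P2 \<and> (\<exists>i\<in>I. compatible (\<chi> i) (\<alpha> x) (\<beta> y))}"

abbreviation P where "P \<equiv> P1 \<union> P2"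
abbreviation \<I> :: "('f, nat \<Rightarrow> nat \<Rightarrow> 'f) module" where "\<I> \<equiv> incidence_algebra P r"

lemma \<alpha>_in: "x \<in> P1 \<Longrightarrow> \<alpha> x \<in> dual1" and \<beta>_in: "y \<in> P2 \<Longrightarrow> \<beta> y \<in> dual2"
  using \<alpha> \<beta> by (auto dest: bij_betwE)

lemma not_both: "x \<in> P1 \<Longrightarrow> x \<notin> P2" "x \<in> P2 \<Longrightarrow> x \<notin> P1"
  using P_disjoint by auto

text \<open>Strict relations lead only from \<open>P1\<close> to \<open>P2\<close>, so two of them
  never compose and none can be reversed.\<close>

lemma partial_order_r: "partial_order_on P r"
proof -
  have "r \<subseteq> P \<times> P" "refl_on P r"
    by (auto simp: r_def refl_on_def)
  moreover have "trans r"
    unfolding trans_def r_def using P_disjoint by blast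
  moreover have "antisym r"
    unfolding antisym_def r_def using P_disjoint by blast
  ultimately show ?thesis
    by (simp add: partial_order_on_def preorder_on_def)
qed

text \<open>The upper block needs no test for membership in \<open>r\<close>: at a pair that is
  compatible with no \<chi> i, \<open>M_fourier\<close> is already zero.\<close>

definition \<Phi> :: "('g \<Rightarrow> 'f) \<times> ('i \<Rightarrow> ('g \<times> 'g \<Rightarrow> 'f) set) \<times> ('g \<Rightarrow> 'f) \<Rightarrow> nat \<Rightarrow> nat \<Rightarrow> 'f"
  where "\<Phi> t x y = (case t of (a, m, b) \<Rightarrow>
    if x \<in> P1 \<and> x = y then fourier H1 a (\<alpha> x)
    else if x \<in> P2 \<and> x = y then fourier H2 b (\<beta> x)
    else if x \<in> P1 \<and> y \<in> P2 then M_fourier m (\<alpha> x) (\<beta> y) else 0)"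

lemma \<Phi>_simps:
  "x \<in> P1 \<Longrightarrow> \<Phi> (a, m, b) x x = fourier H1 a (\<alpha> x)"
  "x \<in> P2 \<Longrightarrow> \<Phi> (a, m, b) x x = fourier H2 b (\<beta> x)"
  "x \<in> P1 \<Longrightarrow> y \<in> P2 \<Longrightarrow> \<Phi> (a, m, b) x y = M_fourier m (\<alpha> x) (\<beta> y)"
  "x \<noteq> y \<or> x \<notin> P \<Longrightarrow> x \<notin> P1 \<or> y \<notin> P2 \<Longrightarrow> \<Phi> t x y = 0"
  subgoal by (simp add: \<Phi>_def)
  subgoal by (simp add: \<Phi>_def not_both(2))
  subgoal using not_both(1)[of x] by (auto simp: \<Phi>_def)
  subgoal by (auto simp: \<Phi>_def split: prod.split)
  done

lemma pair_cases:
  obtains (diag1) "x = y" "x \<in> P1" | (diag2) "x = y" "x \<in> P2"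
    | (upper) "x \<in> P1" "y \<in> P2" "x \<noteq> y"
    | (outside) "x \<noteq> y \<or> x \<notin> P" "x \<notin> P1 \<or> y \<notin> P2"
  using P_disjoint by blast

lemma \<Phi>_closed: "\<Phi> t \<in> carrier \<I>"
proof -
  obtain a m b where t: "t = (a, m, b)"
    by (cases t)
  have "\<Phi> t x y = 0" if xy: "(x, y) \<notin> r" for x y
  proof (cases rule: pair_cases[where x = x and y = y])
    case upper
    then have "\<not> (\<exists>i\<in>I. compatible (\<chi> i) (\<alpha> x) (\<beta> y))"
      using xy by (auto simp: r_def)
    then show ?thesis
      using upper unfolding t by (simp add: \<Phi>_simps(3) M_fourier_incompatible)
  qed (use xy in \<open>auto simp: r_def \<Phi>_simps(4)\<close>)
  then show ?thesis
    by (simp add: incidence_algebra_simps)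
qed

lemma \<Phi>_mult:
  assumes t: "t \<in> carrier M.T" and t': "t' \<in> carrier M.T"
  shows "\<Phi> (t \<otimes>\<^bsub>M.T\<^esub> t') = \<Phi> t \<otimes>\<^bsub>\<I>\<^esub> \<Phi> t'"
proof (intro ext)
  fix x y
  obtain a m b where abm: "t = (a, m, b)" "a \<in> carrier \<A>" "m \<in> carrier M" "b \<in> carrier \<B>"
    using t by (auto simp: triangular_algebra_simps)
  obtain a' m' b' where abm': "t' = (a', m', b')" "a' \<in> carrier \<A>" "m' \<in> carrier M" "b' \<in> carrier \<B>"
    using t' by (auto simp: triangular_algebra_simps)
  \<comment> \<open>An entry in a column of \<open>P1\<close> can be nonzero only on the diagonal,
    so only z = x contributes. Dually, the sum over \<open>P2\<close> below reduces to z = y; the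
    two surviving terms match the left and the right action.\<close>
  have "(\<Sum>z\<in>P1. \<Phi> t x z * \<Phi> t' z y) = (\<Sum>z\<in>P1. if z = x then \<Phi> t x x * \<Phi> t' x y else 0)"
    by (intro sum.cong) (auto simp: \<Phi>_def abm(1) dest: not_both)
  also have "\<dots> = (if x \<in> P1 then \<Phi> t x x * \<Phi> t' x y else 0)"
    by (simp add: finite_P)
  finally have sum1: "(\<Sum>z\<in>P1. \<Phi> t x z * \<Phi> t' z y) = (if x \<in> P1 then \<Phi> t x x * \<Phi> t' x y else 0)" .
  have "(\<Sum>z\<in>P2. \<Phi> t x z * \<Phi> t' z y) = (\<Sum>z\<in>P2. if z = y then \<Phi> t x y * \<Phi> t' y y else 0)"
    by (intro sum.cong) (auto simp: \<Phi>_def abm'(1) dest: not_both)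
  also have "\<dots> = (if y \<in> P2 then \<Phi> t x y * \<Phi> t' y y else 0)"
    by (simp add: finite_P)
  finally have sum2: "(\<Sum>z\<in>P2. \<Phi> t x z * \<Phi> t' z y) = (if y \<in> P2 then \<Phi> t x y * \<Phi> t' y y else 0)" .
  have "(\<Phi> t \<otimes>\<^bsub>\<I>\<^esub> \<Phi> t') x y = (\<Sum>z\<in>P1. \<Phi> t x z * \<Phi> t' z y) + (\<Sum>z\<in>P2. \<Phi> t x z * \<Phi> t' z y)"
    by (simp add: incidence_algebra_simps sum.union_disjoint finite_P P_disjoint)
  also have "\<dots> = \<Phi> (t \<otimes>\<^bsub>M.T\<^esub> t') x y"
  proof -
    \<comment> \<open>The cases follow the blocks of the matrix; the lower row needs no distinction
      by column, because its entries off the diagonal vanish.\<close>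
    consider (11) "x \<in> P1" "x \<notin> P2" "y \<notin> P2" | (12) "x \<in> P1" "x \<notin> P2" "y \<in> P2" "y \<notin> P1"
      | (2) "x \<in> P2" "x \<notin> P1" | (0) "x \<notin> P1" "x \<notin> P2"
      using P_disjoint by blast
    then show ?thesis
    proof cases
      case 11
      then show ?thesis
        unfolding sum1 sum2 using \<alpha>_in
        by (auto simp: \<Phi>_def abm(1) abm'(1) triangular_algebra_simps A.fourier_group_algebra)
    next
      case 12
      then have "x \<noteq> y"
        by auto
      with 12 show ?thesis
        unfolding sum1 sum2 using abm abm' \<alpha>_in[of x] \<beta>_in[of y]
        by (simp add: \<Phi>_def triangular_algebra_simps M_fourier_ops M.lact_closed M.ract_closed)
    next
      case 2
      then show ?thesis
        unfolding sum1 sum2 using \<beta>_in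
        by (auto simp: \<Phi>_def abm(1) abm'(1) triangular_algebra_simps B.fourier_group_algebra)
    next
      case 0
      then show ?thesis
        unfolding sum1 sum2 by (auto simp: \<Phi>_def abm(1) abm'(1) triangular_algebra_simps)
    qed
  qed
  finally show "\<Phi> (t \<otimes>\<^bsub>M.T\<^esub> t') x y = (\<Phi> t \<otimes>\<^bsub>\<I>\<^esub> \<Phi> t') x y" ..
qed

lemma \<Phi>_add:
  assumes t: "t \<in> carrier M.T" and t': "t' \<in> carrier M.T"
  shows "\<Phi> (t \<oplus>\<^bsub>M.T\<^esub> t') = \<Phi> t \<oplus>\<^bsub>\<I>\<^esub> \<Phi> t'"
proof (intro ext)
  fix x y
  obtain a m b where abm: "t = (a, m, b)" "m \<in> carrier M"
    using t by (auto simp: triangular_algebra_simps)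
  obtain a' m' b' where abm': "t' = (a', m', b')" "m' \<in> carrier M"
    using t' by (auto simp: triangular_algebra_simps)
  show "\<Phi> (t \<oplus>\<^bsub>M.T\<^esub> t') x y = (\<Phi> t \<oplus>\<^bsub>\<I>\<^esub> \<Phi> t') x y"
    using abm(2) abm'(2) unfolding abm(1) abm'(1) triangular_algebra_simps incidence_algebra_simps
    by (cases rule: pair_cases[where x = x and y = y])
      (simp_all add: \<Phi>_simps A.fourier_group_algebra_add B.fourier_group_algebra_add M_fourier_ops
        \<alpha>_in \<beta>_in)
qed

lemma \<Phi>_smult:
  assumes t: "t \<in> carrier M.T"
  shows "\<Phi> (c \<odot>\<^bsub>M.T\<^esub> t) = c \<odot>\<^bsub>\<I>\<^esub> \<Phi> t"
proof (intro ext)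
  fix x y
  obtain a m b where abm: "t = (a, m, b)" "m \<in> carrier M"
    using t by (auto simp: triangular_algebra_simps)
  show "\<Phi> (c \<odot>\<^bsub>M.T\<^esub> t) x y = (c \<odot>\<^bsub>\<I>\<^esub> \<Phi> t) x y"
    using abm(2) unfolding abm(1) triangular_algebra_simps incidence_algebra_simps
    by (cases rule: pair_cases[where x = x and y = y])
      (simp_all add: \<Phi>_simps A.fourier_group_algebra_smult B.fourier_group_algebra_smult
        M_fourier_ops \<alpha>_in \<beta>_in)
qed

lemma \<Phi>_one: "\<Phi> \<one>\<^bsub>M.T\<^esub> = \<one>\<^bsub>\<I>\<^esub>"
proof (intro ext)
  fix x y
  show "\<Phi> \<one>\<^bsub>M.T\<^esub> x y = \<one>\<^bsub>\<I>\<^esub> x y"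
    unfolding triangular_algebra_simps incidence_algebra_simps
    by (cases rule: pair_cases[where x = x and y = y])
      (auto simp: \<Phi>_simps A.fourier_group_algebra_one B.fourier_group_algebra_one M_fourier_zero
        \<alpha>_in \<beta>_in)
qed

lemma \<Phi>_inj: "inj_on \<Phi> (carrier M.T)"
proof (rule inj_onI)
  fix t t'
  assume t: "t \<in> carrier M.T" and t': "t' \<in> carrier M.T" and eq: "\<Phi> t = \<Phi> t'"
  obtain a m b where abm: "t = (a, m, b)" "a \<in> carrier \<A>" "m \<in> carrier M" "b \<in> carrier \<B>"
    using t by (auto simp: triangular_algebra_simps)
  obtain a' m' b' where abm': "t' = (a', m', b')" "a' \<in> carrier \<A>" "m' \<in> carrier M" "b' \<in> carrier \<B>"
    using t' by (auto simp: triangular_algebra_simps)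
  have dual1: "\<exists>x\<in>P1. \<gamma> = \<alpha> x" if "\<gamma> \<in> dual1" for \<gamma>
    using \<alpha> that by (auto simp: bij_betw_def)
  have dual2: "\<exists>y\<in>P2. \<delta> = \<beta> y" if "\<delta> \<in> dual2" for \<delta>
    using \<beta> that by (auto simp: bij_betw_def)
  have "fourier H1 a (\<alpha> x) = fourier H1 a' (\<alpha> x)" if "x \<in> P1" for x
    using fun_cong[OF fun_cong[OF eq, of x], of x] that by (simp add: \<Phi>_def abm(1) abm'(1))
  then have "a = a'"
    using dual1 by (intro A.group_algebra_eqI abm abm') blast
  moreover have "fourier H2 b (\<beta> y) = fourier H2 b' (\<beta> y)" if "y \<in> P2" for y
    using fun_cong[OF fun_cong[OF eq, of y], of y] that not_both[of y]
    by (simp add: \<Phi>_def abm(1) abm'(1))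
  then have "b = b'"
    using dual2 by (intro B.group_algebra_eqI abm abm') blast
  moreover have "M_fourier m (\<alpha> x) (\<beta> y) = M_fourier m' (\<alpha> x) (\<beta> y)" if "x \<in> P1" "y \<in> P2" for x y
    using fun_cong[OF fun_cong[OF eq, of x], of y] that not_both[of y]
    by (auto simp: \<Phi>_def abm(1) abm'(1) split: if_splits)
  then have "m = m'"
    using dual1 dual2 by (intro M_fourier_eqI abm abm') blast
  ultimately show "t = t'"
    by (simp add: abm abm')
qed

text \<open>The diagonal is matched by inverse transforms, the upper block by
  \<open>M_fourier_surj\<close>. The latter prescribes values at compatible pairs only, which
  suffices since \<open>N\<close> is supported on \<open>r\<close>.\<close>

lemma \<Phi>_surj: "carrier \<I> \<subseteq> \<Phi> ` carrier M.T"
proof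
  fix N assume N: "N \<in> carrier \<I>"
  \<comment> \<open>The indices of characters, used to read the entries of \<open>N\<close> as
    functions of characters.\<close>
  define \<alpha>' where "\<alpha>' = inv_into P1 \<alpha>"
  define \<beta>' where "\<beta>' = inv_into P2 \<beta>"
  have inv: "\<alpha>' (\<alpha> x) = x" if "x \<in> P1" for x
    using \<alpha> that by (simp add: \<alpha>'_def bij_betw_def inv_into_f_f)
  have inv': "\<beta>' (\<beta> y) = y" if "y \<in> P2" for y
    using \<beta> that by (simp add: \<beta>'_def bij_betw_def inv_into_f_f)
  define a where "a = inverse_fourier G H1 (\<lambda>\<gamma>. N (\<alpha>' \<gamma>) (\<alpha>' \<gamma>))"
  define b where "b = inverse_fourier G H2 (\<lambda>\<delta>. N (\<beta>' \<delta>) (\<beta>' \<delta>))"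
  obtain m where m: "m \<in> carrier M"
    "\<forall>\<gamma>\<in>dual1. \<forall>\<delta>\<in>dual2. (\<exists>i\<in>I. compatible (\<chi> i) \<gamma> \<delta>) \<longrightarrow>
      M_fourier m \<gamma> \<delta> = N (\<alpha>' \<gamma>) (\<beta>' \<delta>)"
    using M_fourier_surj[of "\<lambda>\<gamma> \<delta>. N (\<alpha>' \<gamma>) (\<beta>' \<delta>)"] ..
  have "a \<in> carrier \<A>" "b \<in> carrier \<B>"
    by (auto simp: a_def b_def group_algebra_simps inverse_fourier_def)
  then have t: "(a, m, b) \<in> carrier M.T"
    using m(1) by (simp add: triangular_algebra_simps)
  have N0: "N x y = 0" if "(x, y) \<notin> r" for x y
    using N that by (simp add: incidence_algebra_simps)
  have "\<Phi> (a, m, b) x y = N x y" for x y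
  proof -
    consider (1) "x \<in> P1" "x = y" | (2) "x \<in> P2" "x = y" "x \<notin> P1"
      | (12) "x \<in> P1" "y \<in> P2" "x \<noteq> y" "\<exists>i\<in>I. compatible (\<chi> i) (\<alpha> x) (\<beta> y)"
      | (0) "x \<in> P1" "y \<in> P2" "x \<noteq> y" "\<not> (\<exists>i\<in>I. compatible (\<chi> i) (\<alpha> x) (\<beta> y))"
      | (out) "x \<noteq> y \<or> x \<notin> P" "x \<notin> P1 \<or> y \<notin> P2"
      using P_disjoint by blast
    then show ?thesis
    proof cases
      case 1
      then show ?thesis
        by (simp add: \<Phi>_def a_def A.fourier_inverse_fourier \<alpha>_in inv)
    next
      case 2
      then show ?thesis
        by (simp add: \<Phi>_def b_def B.fourier_inverse_fourier \<beta>_in inv')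
    next
      case 12
      then show ?thesis
        by (simp add: \<Phi>_def m(2) \<alpha>_in \<beta>_in inv inv')
    next
      case 0
      then have "(x, y) \<notin> r"
        by (auto simp: r_def)
      with 0 show ?thesis
        by (simp add: \<Phi>_def N0 M_fourier_incompatible)
    next
      case out
      then have "(x, y) \<notin> r"
        by (auto simp: r_def)
      with out show ?thesis
        by (auto simp: \<Phi>_def N0)
    qed
  qed
  then have "N = \<Phi> (a, m, b)"
    by (simp add: fun_eq_iff)
  with t show "N \<in> \<Phi> ` carrier M.T"
    by blast
qed

lemma \<Phi>_iso: "\<Phi> \<in> ring_iso M.T \<I>"
proof -
  have "\<Phi> \<in> ring_hom M.T \<I>"
    by (rule ring_hom_memI) (simp_all add: \<Phi>_closed \<Phi>_mult \<Phi>_add \<Phi>_one)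
  moreover have "\<Phi> ` carrier M.T \<subseteq> carrier \<I>"
    by (rule image_subsetI) (rule \<Phi>_closed)
  then have "bij_betw \<Phi> (carrier M.T) (carrier \<I>)"
    unfolding bij_betw_def using \<Phi>_inj \<Phi>_surj by (intro conjI subset_antisym)
  ultimately show ?thesis
    by (simp add: ring_iso_def)
qed

lemma incidence_algebra_iso_triangular_algebra:
  shows "graded_algebra \<F> G \<I>
      (\<lambda>d. \<Phi> ` triangular_grading (group_algebra_grading H1) (group_algebra_grading H2) \<Gamma>M d)"
    and "graded_algebra_iso \<F> G \<I>
      (\<lambda>d. \<Phi> ` triangular_grading (group_algebra_grading H1) (group_algebra_grading H2) \<Gamma>M d)
      M.T (triangular_grading (group_algebra_grading H1) (group_algebra_grading H2) \<Gamma>M)"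
proof -
  have "assoc_algebra \<F> \<I>"
    using finite_P by (intro assoc_algebra_incidence_algebra partial_order_r) simp
  note image = graded_algebra_image[OF graded_algebra_T M.homogeneous_projections_triangular[OF
        homogeneous_projections_A homogeneous_projections_B homogeneous_projections_M]
      this \<Phi>_iso \<Phi>_smult]
  show "graded_algebra \<F> G \<I>
      (\<lambda>d. \<Phi> ` triangular_grading (group_algebra_grading H1) (group_algebra_grading H2) \<Gamma>M d)"
    by (rule image)
  show "graded_algebra_iso \<F> G \<I>
      (\<lambda>d. \<Phi> ` triangular_grading (group_algebra_grading H1) (group_algebra_grading H2) \<Gamma>M d)
      M.T (triangular_grading (group_algebra_grading H1) (group_algebra_grading H2) \<Gamma>M)"
    by (rule image)
qed

end

section \<open>Enumeration of the characters and choice of the witnesses\<close>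

theorem theorem4p1:
  fixes G :: "'g monoid" and H1 H2 :: "'g set" and t :: nat
    and \<chi> :: "nat \<Rightarrow> 'g \<Rightarrow> 'f::field" and g :: "nat \<Rightarrow> 'g"
  assumes "comm_group G"
    and "subgroup H1 G" and "finite H1"
    and "subgroup H2 G" and "finite H2"
    and "\<exists>\<zeta>::'f. primitive_root_of_unity (subgroup_exponent G H1) \<zeta>"
    and "\<exists>\<zeta>::'f. primitive_root_of_unity (subgroup_exponent G H2) \<zeta>"
    and "\<forall>i\<in>{1..t}. \<chi> i \<in> characters G (H1 \<inter> H2)"
    and "\<forall>i\<in>{1..t}. \<forall>j\<in>{1..t}. i \<noteq> j \<longrightarrow> \<chi> i \<noteq> \<chi> j"
    and "\<forall>i\<in>{1..t}. g i \<in> carrier G"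
  shows "\<exists>(P :: nat set) r \<Gamma> (M :: ('f, 'g \<Rightarrow> 'f, 'g \<Rightarrow> 'f, nat \<Rightarrow> ('g \<times> 'g \<Rightarrow> 'f) set) bimodule) \<Gamma>M.
    finite P \<and> partial_order_on P r \<and>
    graded_algebra \<F> G (incidence_algebra P r :: ('f, nat \<Rightarrow> nat \<Rightarrow> 'f) module) \<Gamma> \<and>
    graded_bimodule \<F> G
      (group_algebra G H1) (group_algebra_grading H1)
      (group_algebra G H2) (group_algebra_grading H2) M \<Gamma>M \<and>
    graded_bimodule_iso \<F> G (group_algebra G H1) (group_algebra G H2) M \<Gamma>M
      (direct_sum_bimodule {1..t} (\<lambda>i. char_bimodule G H1 H2 (\<chi> i)))
      (direct_sum_grading {1..t} (\<lambda>i. char_bimodule_grading G H1 H2 (\<chi> i) (g i))) \<and>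
    graded_algebra_iso \<F> G (incidence_algebra P r) \<Gamma>
      (triangular_algebra (group_algebra G H1) (group_algebra G H2) M)
      (triangular_grading (group_algebra_grading H1) (group_algebra_grading H2) \<Gamma>M)"
proof -
  obtain \<zeta>1 \<zeta>2 :: 'f where \<zeta>: "primitive_root_of_unity (subgroup_exponent G H1) \<zeta>1"
    "primitive_root_of_unity (subgroup_exponent G H2) \<zeta>2"
    using assms(6,7) by blast
  interpret comm_group G by fact
  interpret character_family G H1 H2 \<zeta>1 \<zeta>2 "{1..t}" \<chi> g
  proof (intro character_family.intro split_pair.intro split_subgroup.intro finite_subgroup.intro
      split_subgroup_axioms.intro finite_subgroup_axioms.intro character_family_axioms.intro)
    show "i = j" if "i \<in> {1..t}" "j \<in> {1..t}" "\<chi> i = \<chi> j" for i j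
      using assms(9) that by blast
  qed (use assms(1-5,8,10) \<zeta> in simp_all)
  obtain \<alpha> where \<alpha>: "bij_betw \<alpha> {0..<card dual1} dual1"
    using ex_bij_betw_nat_finite[OF A.finite_characters] by blast
  obtain \<beta>0 where \<beta>0: "bij_betw \<beta>0 {0..<card dual2} dual2"
    using ex_bij_betw_nat_finite[OF B.finite_characters] by blast
  let ?n1 = "card dual1" and ?n2 = "card dual2"
  \<comment> \<open>The second enumeration is shifted past the first, which makes the index sets
    disjoint.\<close>
  have "bij_betw (\<lambda>y. y - ?n1) {?n1..<?n1 + ?n2} {0..<?n2}"
    by (rule bij_betw_byWitness[where f' = "\<lambda>y. y + ?n1"]) auto
  then have \<beta>: "bij_betw (\<beta>0 \<circ> (\<lambda>y. y - ?n1)) {?n1..<?n1 + ?n2} dual2"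
    using \<beta>0 by (rule bij_betw_trans)
  interpret indexed_character_family G H1 H2 \<zeta>1 \<zeta>2 "{1..t}" \<chi> g "{0..<?n1}" "{?n1..<?n1 + ?n2}"
    \<alpha> "\<beta>0 \<circ> (\<lambda>y. y - ?n1)"
    by unfold_locales (use \<alpha> \<beta> in auto)
  \<comment> \<open>The direct sum itself is taken for \<open>M\<close>, so the identity is the
    required isomorphism of bimodules.\<close>
  have "graded_bimodule_iso \<F> G \<A> \<B> M \<Gamma>M M \<Gamma>M"
    unfolding graded_bimodule_iso_def by (intro exI[of _ id]) simp
  then show ?thesis
    using finite_P partial_order_r incidence_algebra_iso_triangular_algebra graded_bimodule_M
    by (intro exI conjI) auto
qed

end
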